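(* Let $(M,\omega)$ be a closed connected symplectic manifold equipped with a Riemannian metric $g$. Let $(U,\mathcal H)\in\mathfrak T(M,\omega,g)$. Then there exists a constant $C$, depending on $(U,\mathcal H)$, such that for all smooth functions $\xi_1,\xi_2:[0,1]\to[0,1]$ with $\xi_1$ monotone, $$D^1\big((U,\mathcal H)^{\xi_1},(U,\mathcal H)^{\xi_2}\big)\le C\,\|\xi_1-\xi_2\|_{ham}.$$
   Context: $M$ is closed of dimension $2n$. Let $\mathcal H^1(M,g)$ be the space of $g$-harmonic $1$-forms; fix a basis $(h_i)$ and put $|\sum_i\lambda_ih_i|:=\sum_i|\lambda_i|$. $\mathfrak T(M,\omega,g)$ is the set of pairs $(U,\mathcal H)$ with $U:[0,1]\times M\to\mathbb R$ smooth, $\int_MU_t\,\omega^n=0$ for all $t$, and $\mathcal H:[0,1]\to\mathcal H^1(M,g)$ smooth. Each $(U,\mathcal H)$ generates a unique symplectic isotopy $\phi_{(U,\mathcal H)}=\{\phi_t\}$, $\phi_0=\mathrm{id}$, determined by $\iota(\dot\phi_t)\omega=dU_t+\mathcal H_t$ with $\dot\phi_t=\frac{d\phi_t}{dt}\circ\phi_t^{-1}$; $(U,\mathcal H)$ is its generator. $\overline{(U,\mathcal H)}$ denotes the generator of the inverse isotopy $\{\phi_t^{-1}\}$; explicitly $\overline{(U,\mathcal H)}=(-U\circ\phi_{(U,\mathcal H)}-\widetilde\Delta(\mathcal H,\phi_{(U,\mathcal H)}),-\mathcal H)$, where $\Delta_t(\mathcal H,\{\phi_s\})=\int_0^t\mathcal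 H_t(\dot\phi_s)\circ\phi_s\,ds$ and $\widetilde\Delta_t$ is $\Delta_t$ minus its mean value with respect to $\omega^n$. For smooth $\xi:[0,1]\to[0,1]$, $(U,\mathcal H)^\xi:=(U^\xi,\mathcal H^\xi)$ with $U^\xi_t=\dot\xi(t)U_{\xi(t)}$, $\mathcal H^\xi_t=\dot\xi(t)\mathcal H_{\xi(t)}$. For a curve $\xi:[0,1]\to\mathbb R$, $\|\xi\|_{ham}=\sup_t|\xi(t)|+\int_0^1|\dot\xi(t)|dt$. With $\mathrm{osc}(f)=\max f-\min f$, $$D_0((U,\mathcal H),(V,\mathcal K))=\int_0^1\big(\mathrm{osc}(U_t-V_t)+|\mathcal H_t-\mathcal K_t|\big)dt,$$ $$D^1((U,\mathcal H),(V,\mathcal K))=\tfrac12\Big(D_0((U,\mathcal H),(V,\mathcal K))+D_0(\overline{(U,\mathcal H)},\overline{(V,\mathcal K)})\Big).$$ *)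

theory Defs
  imports "HOL-Analysis.Analysis"
begin

section \<open>Smooth maps\<close>

text \<open>
  Derivatives are taken within \<open>S\<close>, so that the same notion serves open sets, the closed interval
  \<open>[0,1]\<close> and products \<open>[0,1] \<times> V\<close> with \<open>V\<close> open; on each of these the derivative within
  the set is unique (and one-sided at the end points of the interval).
\<close>

primrec Ck_on :: "nat \<Rightarrow> 'a::real_normed_vector set \<Rightarrow> ('a \<Rightarrow> 'b::real_normed_vector) \<Rightarrow> bool" where
  "Ck_on 0 S f = continuous_on S f"
| "Ck_on (Suc k) S f =
    (f differentiable_on S \<and> (\<forall>v. Ck_on k S (\<lambda>x. frechet_derivative f (at x within S) v)))"

definition smooth_on :: "'a::real_normed_vector set \<Rightarrow> ('a \<Rightarrow> 'b::real_normed_vector) \<Rightarrow> bool" where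
  "smooth_on S f \<longleftrightarrow> (\<forall>k. Ck_on k S f)"

section \<open>Closed connected manifolds\<close>

text \<open>
  The manifold is the type \<open>'m\<close>; its smooth structure is an atlas (not necessarily maximal).
  A chart is a pair of its domain and its coordinate map. Second countability follows from
  compactness.
\<close>

type_synonym ('m, 'd) chart = "'m set \<times> ('m \<Rightarrow> real ^ 'd)"

definition cdom :: "('m, 'd) chart \<Rightarrow> 'm set" where "cdom c = fst c"

definition crd :: "('m, 'd) chart \<Rightarrow> 'm \<Rightarrow> real ^ 'd" where "crd c = snd c"

definition crange :: "('m, 'd) chart \<Rightarrow> (real ^ 'd) set" where "crange c = crd c ` cdom c"

definition cinv :: "('m, 'd) chart \<Rightarrow> real ^ 'd \<Rightarrow> 'm" where "cinv c = inv_into (cdom c) (crd c)"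

definition smooth_atlas :: "('m::topological_space, 'd::finite) chart set \<Rightarrow> bool" where
  "smooth_atlas A \<longleftrightarrow>
    (\<Union>c\<in>A. cdom c) = UNIV \<and>
    (\<forall>c\<in>A. open (cdom c) \<and> open (crange c) \<and>
       homeomorphism (cdom c) (crange c) (crd c) (cinv c)) \<and>
    (\<forall>c\<in>A. \<forall>d\<in>A. smooth_on (crd c ` (cdom c \<inter> cdom d)) (crd d \<circ> cinv c))"

definition closed_connected_manifold :: "('m::t2_space, 'd::finite) chart set \<Rightarrow> bool" where
  "closed_connected_manifold A \<longleftrightarrow>
    smooth_atlas A \<and> compact (UNIV :: 'm set) \<and> connected (UNIV :: 'm set)"

section \<open>Tensor fields\<close>

text \<open>
  A covariant tensor field (vector field) is given by its local representatives: for a chart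
  \<open>c\<close> and a point \<open>y\<close> of its range, a multilinear form on (a vector of) the coordinate
  space, these being related by the usual transformation law on overlaps. Values at other
  arguments are irrelevant.
\<close>

type_synonym ('m, 'd) form1 = "('m, 'd) chart \<Rightarrow> real ^ 'd \<Rightarrow> real ^ 'd \<Rightarrow> real"
type_synonym ('m, 'd) form2 = "('m, 'd) chart \<Rightarrow> real ^ 'd \<Rightarrow> real ^ 'd \<Rightarrow> real ^ 'd \<Rightarrow> real"
type_synonym ('m, 'd) vfield = "('m, 'd) chart \<Rightarrow> real ^ 'd \<Rightarrow> real ^ 'd"

definition trans_deriv :: "('m, 'd::finite) chart \<Rightarrow> ('m, 'd) chart \<Rightarrow> 'm \<Rightarrow> real ^ 'd \<Rightarrow> real ^ 'd" where
  "trans_deriv c d p = frechet_derivative (crd d \<circ> cinv c) (at (crd c p))"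

definition one_form :: "('m, 'd::finite) chart set \<Rightarrow> ('m, 'd) form1 \<Rightarrow> bool" where
  "one_form A \<alpha> \<longleftrightarrow>
    (\<forall>c\<in>A. (\<forall>y\<in>crange c. linear (\<alpha> c y)) \<and> (\<forall>v. smooth_on (crange c) (\<lambda>y. \<alpha> c y v))) \<and>
    (\<forall>c\<in>A. \<forall>d\<in>A. \<forall>p\<in>cdom c \<inter> cdom d. \<forall>v.
       \<alpha> c (crd c p) v = \<alpha> d (crd d p) (trans_deriv c d p v))"

definition two_tensor :: "('m, 'd::finite) chart set \<Rightarrow> ('m, 'd) form2 \<Rightarrow> bool" where
  "two_tensor A \<beta> \<longleftrightarrow>
    (\<forall>c\<in>A. (\<forall>y\<in>crange c. bilinear (\<beta> c y)) \<and> (\<forall>v w. smooth_on (crange c) (\<lambda>y. \<beta> c y v w))) \<and>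
    (\<forall>c\<in>A. \<forall>d\<in>A. \<forall>p\<in>cdom c \<inter> cdom d. \<forall>v w.
       \<beta> c (crd c p) v w = \<beta> d (crd d p) (trans_deriv c d p v) (trans_deriv c d p w))"

definition d0 :: "('m \<Rightarrow> real) \<Rightarrow> ('m, 'd::finite) form1" where
  "d0 f c y v = frechet_derivative (f \<circ> cinv c) (at y) v"

definition d1 :: "('m, 'd::finite) form1 \<Rightarrow> ('m, 'd) form2" where
  "d1 \<alpha> c y v w =
    frechet_derivative (\<lambda>z. \<alpha> c z w) (at y) v - frechet_derivative (\<lambda>z. \<alpha> c z v) (at y) w"

definition d2 :: "('m, 'd::finite) form2 \<Rightarrow> ('m, 'd) chart \<Rightarrow>
    real ^ 'd \<Rightarrow> real ^ 'd \<Rightarrow> real ^ 'd \<Rightarrow> real ^ 'd \<Rightarrow> real" where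
  "d2 \<beta> c y u v w =
    frechet_derivative (\<lambda>z. \<beta> c z v w) (at y) u
    - frechet_derivative (\<lambda>z. \<beta> c z u w) (at y) v
    + frechet_derivative (\<lambda>z. \<beta> c z u v) (at y) w"

definition symplectic_form :: "('m, 'd::finite) chart set \<Rightarrow> ('m, 'd) form2 \<Rightarrow> bool" where
  "symplectic_form A \<omega> \<longleftrightarrow>
    two_tensor A \<omega> \<and>
    (\<forall>c\<in>A. \<forall>y\<in>crange c.
       (\<forall>v. \<omega> c y v v = 0) \<and>
       (\<forall>u v w. d2 \<omega> c y u v w = 0) \<and>
       (\<forall>v. (\<forall>w. \<omega> c y v w = 0) \<longrightarrow> v = 0))"

definition riemannian_metric :: "('m, 'd::finite) chart set \<Rightarrow> ('m, 'd) form2 \<Rightarrow> bool" where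
  "riemannian_metric A g \<longleftrightarrow>
    two_tensor A g \<and>
    (\<forall>c\<in>A. \<forall>y\<in>crange c.
       (\<forall>v w. g c y v w = g c y w v) \<and> (\<forall>v. v \<noteq> 0 \<longrightarrow> g c y v v > 0))"

section \<open>Harmonic 1-forms\<close>

definition gram :: "('m, 'd::finite) form2 \<Rightarrow> ('m, 'd) chart \<Rightarrow> real ^ 'd \<Rightarrow> real ^ 'd ^ 'd" where
  "gram g c y = (\<chi> i j. g c y (axis i 1) (axis j 1))"

definition pderiv_at :: "'d::finite \<Rightarrow> (real ^ 'd \<Rightarrow> real) \<Rightarrow> real ^ 'd \<Rightarrow> real" where
  "pderiv_at i f y = frechet_derivative f (at y) (axis i 1)"

text \<open>
  The codifferential in local coordinates, with \<open>|g|\<close> the Gram determinant: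
  \<open>\<delta>\<alpha> = - |g|^(-1/2) \<partial>_i (|g|^(1/2) g^(ij) \<alpha>_j)\<close> on 1-forms and
  \<open>(\<delta>\<beta>)_k = - g_(kl) |g|^(-1/2) \<partial>_i (|g|^(1/2) g^(ia) g^(lb) \<beta>_(ab))\<close> on 2-forms.
\<close>

definition codiff1 :: "('m, 'd::finite) form2 \<Rightarrow> ('m, 'd) form1 \<Rightarrow> ('m, 'd) chart \<Rightarrow> real ^ 'd \<Rightarrow> real" where
  "codiff1 g \<alpha> c y =
    - (1 / sqrt (det (gram g c y))) *
      (\<Sum>i\<in>UNIV. pderiv_at i
         (\<lambda>z. sqrt (det (gram g c z)) *
            (\<Sum>j\<in>UNIV. matrix_inv (gram g c z) $ i $ j * \<alpha> c z (axis j 1))) y)"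

definition codiff2 :: "('m, 'd::finite) form2 \<Rightarrow> ('m, 'd) form2 \<Rightarrow> ('m, 'd) form1" where
  "codiff2 g \<beta> c y v =
    (\<Sum>k\<in>UNIV. v $ k *
      (- (\<Sum>l\<in>UNIV. gram g c y $ k $ l * (1 / sqrt (det (gram g c y))) *
        (\<Sum>i\<in>UNIV. pderiv_at i
           (\<lambda>z. sqrt (det (gram g c z)) *
              (\<Sum>a\<in>UNIV. \<Sum>b\<in>UNIV.
                 matrix_inv (gram g c z) $ i $ a * matrix_inv (gram g c z) $ l $ b *
                 \<beta> c z (axis a 1) (axis b 1))) y))))"

definition hodge_laplacian :: "('m, 'd::finite) form2 \<Rightarrow> ('m, 'd) form1 \<Rightarrow> ('m, 'd) form1" where
  "hodge_laplacian g \<alpha> c y v =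
    frechet_derivative (codiff1 g \<alpha> c) (at y) v + codiff2 g (d1 \<alpha>) c y v"

definition harmonic :: "('m, 'd::finite) chart set \<Rightarrow> ('m, 'd) form2 \<Rightarrow> ('m, 'd) form1 \<Rightarrow> bool" where
  "harmonic A g \<alpha> \<longleftrightarrow>
    one_form A \<alpha> \<and> (\<forall>c\<in>A. \<forall>y\<in>crange c. \<forall>v. hodge_laplacian g \<alpha> c y v = 0)"

definition lin_comb_of :: "('m, 'd::finite) chart set \<Rightarrow> nat \<Rightarrow> (nat \<Rightarrow> ('m, 'd) form1) \<Rightarrow>
    (nat \<Rightarrow> real) \<Rightarrow> ('m, 'd) form1 \<Rightarrow> bool" where
  "lin_comb_of A b h l \<alpha> \<longleftrightarrow>
    (\<forall>c\<in>A. \<forall>y\<in>crange c. \<forall>v. \<alpha> c y v = (\<Sum>i<b. l i * h i c y v))"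

definition harmonic_basis :: "('m, 'd::finite) chart set \<Rightarrow> ('m, 'd) form2 \<Rightarrow> nat \<Rightarrow>
    (nat \<Rightarrow> ('m, 'd) form1) \<Rightarrow> bool" where
  "harmonic_basis A g b h \<longleftrightarrow>
    (\<forall>i<b. harmonic A g (h i)) \<and>
    (\<forall>\<alpha>. harmonic A g \<alpha> \<longrightarrow> (\<exists>l. lin_comb_of A b h l \<alpha>)) \<and>
    (\<forall>l. lin_comb_of A b h l (\<lambda>c y v. 0) \<longrightarrow> (\<forall>i<b. l i = 0))"

text \<open>Only the coordinates with index below \<open>b\<close> are determined (uniquely, for a basis).\<close>

definition coords :: "('m, 'd::finite) chart set \<Rightarrow> nat \<Rightarrow> (nat \<Rightarrow> ('m, 'd) form1) \<Rightarrow>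
    ('m, 'd) form1 \<Rightarrow> nat \<Rightarrow> real" where
  "coords A b h \<alpha> = (SOME l. lin_comb_of A b h l \<alpha>)"

definition hnorm :: "('m, 'd::finite) chart set \<Rightarrow> nat \<Rightarrow> (nat \<Rightarrow> ('m, 'd) form1) \<Rightarrow>
    ('m, 'd) form1 \<Rightarrow> real" where
  "hnorm A b h \<alpha> = (\<Sum>i<b. \<bar>coords A b h \<alpha> i\<bar>)"

section \<open>Integration against the n-th power of the symplectic form\<close>

definition wedge_power :: "('m, 'd::finite) form2 \<Rightarrow> nat \<Rightarrow> ('m, 'd) chart \<Rightarrow> real ^ 'd \<Rightarrow>
    (nat \<Rightarrow> real ^ 'd) \<Rightarrow> real" where
  "wedge_power \<omega> n c y v =
    (1 / 2 ^ n) * (\<Sum>\<sigma> | \<sigma> permutes {..<2 * n}.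
       of_int (sign \<sigma>) * (\<Prod>i<n. \<omega> c y (v (\<sigma> (2 * i))) (v (\<sigma> (2 * i + 1)))))"

definition std_frame :: "nat \<Rightarrow> real ^ 'd::finite" where
  "std_frame i = axis ((SOME e. bij_betw e {..<CARD('d)} (UNIV :: 'd set)) i) 1"

text \<open>
  The manifold is oriented by \<open>\<omega>\<^sup>n\<close>, so integrating \<open>f \<omega>\<^sup>n\<close> means integrating \<open>f\<close>
  against the positive measure whose density in a chart is the absolute value of the coefficient of
  \<open>\<omega>\<^sup>n\<close>. The condition determines the measure, since finitely many charts cover.
\<close>

definition liouville :: "('m::topological_space, 'd::finite) chart set \<Rightarrow> ('m, 'd) form2 \<Rightarrow> nat \<Rightarrow> 'm measure" where
  "liouville A \<omega> n = (THE \<mu>. sets \<mu> = sets borel \<and>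
    (\<forall>c\<in>A. \<forall>B\<in>sets borel. B \<subseteq> cdom c \<longrightarrow>
       emeasure \<mu> B =
         (\<integral>\<^sup>+y\<in>crd c ` B. ennreal \<bar>wedge_power \<omega> n c y std_frame\<bar> \<partial>lborel)))"

section \<open>Generators and their isotopies\<close>

type_synonym ('m, 'd) gen = "(real \<Rightarrow> 'm \<Rightarrow> real) \<times> (real \<Rightarrow> ('m, 'd) form1)"

definition generators :: "('m::topological_space, 'd::finite) chart set \<Rightarrow> ('m, 'd) form2 \<Rightarrow>
    ('m, 'd) form2 \<Rightarrow> nat \<Rightarrow> nat \<Rightarrow> (nat \<Rightarrow> ('m, 'd) form1) \<Rightarrow> ('m, 'd) gen set" where
  "generators A \<omega> g n b h = {(U, H).
    (\<forall>c\<in>A. smooth_on ({0..1} \<times> crange c) (\<lambda>(t, y). U t (cinv c y))) \<and>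
    (\<forall>t\<in>{0..1}. integral\<^sup>L (liouville A \<omega> n) (U t) = 0) \<and>
    (\<forall>t\<in>{0..1}. harmonic A g (H t)) \<and>
    (\<forall>i<b. smooth_on {0..1} (\<lambda>t. coords A b h (H t) i))}"

text \<open>The vector field \<open>(d\<phi>\<^sub>t/dt) \<circ> \<phi>\<^sub>t\<^sup>-\<^sup>1\<close>.\<close>

definition velocity :: "(real \<Rightarrow> 'm \<Rightarrow> 'm) \<Rightarrow> real \<Rightarrow> ('m, 'd::finite) vfield" where
  "velocity \<phi> t c y =
    vector_derivative (\<lambda>s. crd c (\<phi> s (inv (\<phi> t) (cinv c y)))) (at t within {0..1})"

definition generates :: "('m::topological_space, 'd::finite) chart set \<Rightarrow> ('m, 'd) form2 \<Rightarrow>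
    ('m, 'd) gen \<Rightarrow> (real \<Rightarrow> 'm \<Rightarrow> 'm) \<Rightarrow> bool" where
  "generates A \<omega> = (\<lambda>(U, H) \<phi>.
    continuous_on ({0..1} \<times> UNIV) (\<lambda>(t, x). \<phi> t x) \<and>
    (\<forall>t\<in>{0..1}. bij (\<phi> t)) \<and>
    \<phi> 0 = id \<and>
    (\<forall>t\<in>{0..1}. \<forall>c\<in>A.
       (\<forall>x. \<phi> t x \<in> cdom c \<longrightarrow> (\<lambda>s. crd c (\<phi> s x)) differentiable (at t within {0..1})) \<and>
       (\<forall>y\<in>crange c. \<forall>v. \<omega> c y (velocity \<phi> t c y) v = d0 (U t) c y v + H t c y v)))"

text \<open>
  For smooth data with closed \<open>H\<^sub>t\<close> these equations have exactly one solution on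
  \<open>[0,1] \<times> M\<close>, namely the symplectic isotopy generated by \<open>(U, H)\<close>: by the theory of
  ordinary differential equations it is automatically a smooth family of diffeomorphisms, and
  it preserves \<open>\<omega>\<close> because \<open>\<iota>(velocity) \<omega>\<close> is closed. Times outside \<open>[0,1]\<close> are never used.
\<close>

definition isotopy :: "('m::topological_space, 'd::finite) chart set \<Rightarrow> ('m, 'd) form2 \<Rightarrow>
    ('m, 'd) gen \<Rightarrow> real \<Rightarrow> 'm \<Rightarrow> 'm" where
  "isotopy A \<omega> P = (SOME \<phi>. generates A \<omega> P \<phi>)"

text \<open>The function \<open>\<alpha>(X)\<close>; its value does not depend on the chart chosen around the point.\<close>

definition contract :: "('m, 'd::finite) chart set \<Rightarrow> ('m, 'd) form1 \<Rightarrow> ('m, 'd) vfield \<Rightarrow> 'm \<Rightarrow> real" where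
  "contract A \<alpha> X p = (let c = (SOME c. c \<in> A \<and> p \<in> cdom c) in \<alpha> c (crd c p) (X c (crd c p)))"

definition Delta :: "('m, 'd::finite) chart set \<Rightarrow> (real \<Rightarrow> ('m, 'd) form1) \<Rightarrow>
    (real \<Rightarrow> 'm \<Rightarrow> 'm) \<Rightarrow> real \<Rightarrow> 'm \<Rightarrow> real" where
  "Delta A H \<phi> t x = integral {0..t} (\<lambda>s. contract A (H t) (velocity \<phi> s) (\<phi> s x))"

definition Delta_normalized :: "('m::topological_space, 'd::finite) chart set \<Rightarrow> ('m, 'd) form2 \<Rightarrow> nat \<Rightarrow>
    (real \<Rightarrow> ('m, 'd) form1) \<Rightarrow> (real \<Rightarrow> 'm \<Rightarrow> 'm) \<Rightarrow> real \<Rightarrow> 'm \<Rightarrow> real" where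
  "Delta_normalized A \<omega> n H \<phi> t x =
    Delta A H \<phi> t x
    - integral\<^sup>L (liouville A \<omega> n) (Delta A H \<phi> t) / measure (liouville A \<omega> n) UNIV"

text \<open>
  The generator of the inverse isotopy, in its explicit form: the pullback of \<open>dU\<^sub>t + H\<^sub>t\<close> by
  \<open>\<phi>\<^sub>t\<close> is \<open>d(U\<^sub>t \<circ> \<phi>\<^sub>t + Delta\<^sub>t) + H\<^sub>t\<close>, and the mean value is removed to normalize.
\<close>

definition gen_inverse :: "('m::topological_space, 'd::finite) chart set \<Rightarrow> ('m, 'd) form2 \<Rightarrow> nat \<Rightarrow>
    ('m, 'd) gen \<Rightarrow> ('m, 'd) gen" where
  "gen_inverse A \<omega> n = (\<lambda>(U, H). let \<phi> = isotopy A \<omega> (U, H) in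
    (\<lambda>t x. - U t (\<phi> t x) - Delta_normalized A \<omega> n H \<phi> t x, \<lambda>t c y v. - H t c y v))"

definition reparam :: "(real \<Rightarrow> real) \<Rightarrow> ('m, 'd) gen \<Rightarrow> ('m, 'd) gen" where
  "reparam \<xi> = (\<lambda>(U, H).
    (\<lambda>t x. vector_derivative \<xi> (at t within {0..1}) * U (\<xi> t) x,
     \<lambda>t c y v. vector_derivative \<xi> (at t within {0..1}) * H (\<xi> t) c y v))"

section \<open>Distances\<close>

definition ham_norm :: "(real \<Rightarrow> real) \<Rightarrow> real" where
  "ham_norm \<xi> = (SUP t\<in>{0..1}. \<bar>\<xi> t\<bar>)
    + integral {0..1} (\<lambda>t. \<bar>vector_derivative \<xi> (at t within {0..1})\<bar>)"

definition osc :: "('m \<Rightarrow> real) \<Rightarrow> real" where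
  "osc f = (SUP x. f x) - (INF x. f x)"

definition D0 :: "('m, 'd::finite) chart set \<Rightarrow> nat \<Rightarrow> (nat \<Rightarrow> ('m, 'd) form1) \<Rightarrow>
    ('m, 'd) gen \<Rightarrow> ('m, 'd) gen \<Rightarrow> real" where
  "D0 A b h = (\<lambda>(U, H) (V, K). integral {0..1}
    (\<lambda>t. osc (\<lambda>x. U t x - V t x) + hnorm A b h (\<lambda>c y v. H t c y v - K t c y v)))"

definition D1 :: "('m::topological_space, 'd::finite) chart set \<Rightarrow> ('m, 'd) form2 \<Rightarrow> nat \<Rightarrow> nat \<Rightarrow>
    (nat \<Rightarrow> ('m, 'd) form1) \<Rightarrow> ('m, 'd) gen \<Rightarrow> ('m, 'd) gen \<Rightarrow> real" where
  "D1 A \<omega> n b h P Q =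
    (D0 A b h P Q + D0 A b h (gen_inverse A \<omega> n P) (gen_inverse A \<omega> n Q)) / 2"

end

theory Submission
  imports Defs
begin

text \<open>
  The isotopy generated by \<open>(U, \<H>)\<^sup>\<xi>\<close> is \<open>\<phi>\<^bsub>\<xi>(t)\<^esub> \<circ> \<phi>\<^bsub>\<xi>(0)\<^esub>\<^sup>-\<^sup>1\<close>, where \<open>\<phi>\<close> is generated by \<open>(U, \<H>)\<close>. Up to
  constants, which the oscillation does not see, the inverse of its generator is therefore
  \<open>-\<xi>'(t) F(\<xi>(t), \<xi>(0), x)\<close> with a function \<open>F\<close> that depends on \<open>(U, \<H>)\<close> only: after substituting
  \<open>u = \<xi>(s)\<close> the integral in \<open>\<Delta>\<close> is the integral of \<open>\<H>(X\<^sub>u)\<close> along the flow line from time \<open>\<xi>(0)\<close>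
  to time \<open>\<xi>(t)\<close>. As \<open>F\<close> is bounded and Lipschitz in both times, uniformly in \<open>x\<close>,
  \<open>\<bar>\<xi>\<^sub>1' F\<^sub>1 - \<xi>\<^sub>2' F\<^sub>2\<bar> \<le> B \<bar>\<xi>\<^sub>1' - \<xi>\<^sub>2'\<bar> + C \<bar>\<xi>\<^sub>1'\<bar> sup \<bar>\<xi>\<^sub>1 - \<xi>\<^sub>2\<bar>\<close>, and \<open>\<integral> \<bar>\<xi>\<^sub>1'\<bar> \<le> 1\<close> by monotonicity.

  The flow and its Lipschitz dependence on the initial time are obtained from Picard iteration in
  charts and from Gronwall's inequality for the distance induced by an embedding of the manifold
  by bump functions.
\<close>

section \<open>Ordinary differential equations in Euclidean space\<close>

text \<open>\<open>D0\<close> compares two generators at the same point of the manifold, so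
  quantitative control is required in the two times only; in the point, continuity of the flow
  suffices. The obstacle is the initial time. Two flow lines that pass through \<open>x\<close> at
  different times are apart at a common time and may run through many charts, whose coordinate
  distances do not fit together. Finitely many real functions therefore replace the coordinates:
  along an integral curve the derivative of each is again a Lipschitz function of the point, so that
  the squared distance in the embedding obeys a scalar differential inequality. For this the
  functions may be C^1 with Lipschitz derivative, which squares of truncated quadratic polynomials
  are. Regularity is accordingly tracked as local Lipschitz continuity, a property that sums,
  products, inverses of nonvanishing functions and changes of chart preserve, and that passes from
  the generator to its vector field. Since \<open>isotopy\<close> is a choice, it is compared with
  the explicit flow through uniqueness of integral curves.\<close>

text \<open>\<open>Ck_on\<close> makes the derivative continuous in each fixed direction only.
  Compactness bounds it on the finitely many basis directions, linearity turns this into a bound on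
  the operator norm, and convexity allows the mean value inequality. The derivative is taken within
  the larger set \<open>T\<close>, which need not be open.\<close>

lemma Ck_one_lipschitz:
  fixes f :: "'a::euclidean_space \<Rightarrow> 'b::real_normed_vector"
  assumes f: "Ck_on (Suc 0) T f" and S: "S \<subseteq> T" "compact S" "convex S"
  obtains L where "L \<ge> 0" "\<And>x y. x \<in> S \<Longrightarrow> y \<in> S \<Longrightarrow> norm (f x - f y) \<le> L * norm (x - y)"
proof -
  define D where "D x = frechet_derivative f (at x within T)" for x
  have der: "(f has_derivative D x) (at x within T)" if "x \<in> T" for x
    using f that unfolding D_def by (auto simp: differentiable_on_def frechet_derivative_works)
  have cont: "continuous_on T (\<lambda>x. D x v)" for v
    using f unfolding D_def by simp
  have "\<exists>B. \<forall>x\<in>S. norm (D x v) \<le> B" for v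
  proof -
    have "compact ((\<lambda>x. D x v) ` S)"
      using S cont[of v] by (intro compact_continuous_image) (auto intro: continuous_on_subset)
    then have "bounded ((\<lambda>x. D x v) ` S)" by (rule compact_imp_bounded)
    then show ?thesis unfolding bounded_iff by auto
  qed
  then obtain B where B: "\<And>v x. x \<in> S \<Longrightarrow> norm (D x v) \<le> B v" by metis
  have on: "onorm (D x) \<le> (\<Sum>b\<in>Basis. \<bar>B b\<bar>)" if "x \<in> S" for x
  proof (rule onorm_le)
    fix v
    have lin: "linear (D x)"
      using der[of x] that S by (auto dest: has_derivative_linear)
    have "D x v = D x (\<Sum>b\<in>Basis. (v \<bullet> b) *\<^sub>R b)" by (simp add: euclidean_representation)
    also have "\<dots> = (\<Sum>b\<in>Basis. (v \<bullet> b) *\<^sub>R D x b)"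
      by (simp add: linear_sum[OF lin] linear_cmul[OF lin])
    also have "norm \<dots> \<le> (\<Sum>b\<in>Basis. norm v * \<bar>B b\<bar>)"
    proof (rule sum_norm_le)
      fix b :: 'a assume b: "b \<in> Basis"
      have "norm (D x b) \<le> \<bar>B b\<bar>" using B[OF that, of b] by linarith
      then show "norm ((v \<bullet> b) *\<^sub>R D x b) \<le> norm v * \<bar>B b\<bar>"
        using Basis_le_norm[OF b, of v] by (auto intro: mult_mono)
    qed
    finally show "norm (D x v) \<le> (\<Sum>b\<in>Basis. \<bar>B b\<bar>) * norm v"
      by (simp add: sum_distrib_left mult.commute)
  qed
  show thesis
  proof (rule that)
    show "0 \<le> (\<Sum>b\<in>(Basis::'a set). \<bar>B b\<bar>)" by (simp add: sum_nonneg)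
    show "norm (f x - f y) \<le> (\<Sum>b\<in>Basis. \<bar>B b\<bar>) * norm (x - y)" if "x \<in> S" "y \<in> S" for x y
      by (rule differentiable_bound[OF S(3) _ on])
         (use that S der in \<open>auto intro: has_derivative_subset\<close>)
  qed
qed

lemma Ck_on_differentiable:
  assumes "Ck_on (Suc k) S f" "x \<in> S"
  shows "(f has_derivative frechet_derivative f (at x within S)) (at x within S)"
  using assms by (auto simp: differentiable_on_def frechet_derivative_works)

text \<open>With \<open>f\<close> globally bounded and Lipschitz, the integral operator acts on
  bounded continuous functions on the whole line once time is cut off by \<open>cl\<close>, and
  Banach's fixed point theorem applies there. The integral from \<open>t0\<close> to
  \<open>t\<close> is a difference of two integrals from \<open>t0 - \<tau>\<close>, of lengths at
  most \<open>2 * \<tau>\<close> and \<open>\<tau>\<close>: hence the factor 3 in the bound and the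
  contraction constant \<open>3 * L * \<tau>\<close>, at most 1/2.\<close>

lemma picard_lindeloef:
  fixes f :: "real \<Rightarrow> 'a::euclidean_space \<Rightarrow> 'a"
  assumes cont: "continuous_on UNIV (\<lambda>(t, y). f t y)"
    and lip: "\<And>t y y'. norm (f t y - f t y') \<le> L * norm (y - y')"
    and bound: "\<And>t y. norm (f t y) \<le> B"
    and \<tau>: "\<tau> > 0" "6 * L * \<tau> \<le> 1"
  obtains z where "z t0 = y0"
    "\<And>t. t \<in> {t0 - \<tau>..t0 + \<tau>} \<Longrightarrow> norm (z t - y0) \<le> 3 * \<tau> * B"
    "\<And>t. t \<in> {t0 - \<tau>..t0 + \<tau>} \<Longrightarrow>
      (z has_vector_derivative f t (z t)) (at t within {t0 - \<tau>..t0 + \<tau>})"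
proof -
  define a b where "a = t0 - \<tau>" and "b = t0 + \<tau>"
  define cl where "cl t = max a (min b t)" for t :: real
  have cl: "cl t \<in> {a..b}" "a \<le> cl t" "cl t \<le> b" for t using \<tau> by (auto simp: cl_def a_def b_def)
  have cl_id: "cl t = t" if "t \<in> {a..b}" for t using that by (auto simp: cl_def)
  define G where "G z t = y0 + (integral {a..cl t} (\<lambda>s. f s (z s)) - integral {a..t0} (\<lambda>s. f s (z s)))"
    for z :: "real \<Rightarrow> 'a" and t
  have cf: "continuous_on T (\<lambda>s. f s (z s))" if "continuous_on T z" for z T
    using continuous_on_compose2[OF cont continuous_on_Pair[OF continuous_on_id that]] by simp
  have int: "(\<lambda>s. f s (z s)) integrable_on {a..c}" if "continuous_on UNIV z" for z c
    by (rule integrable_continuous_real, rule cf) (rule continuous_on_subset[OF that], auto)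
  have G_cont: "continuous_on UNIV (G z)" if "continuous_on UNIV z" for z
  proof -
    have "continuous_on {a..b} (\<lambda>c. integral {a..c} (\<lambda>s. f s (z s)))"
      by (rule indefinite_integral_continuous_1) (rule int[OF that])
    moreover have "continuous_on UNIV cl" unfolding cl_def by (intro continuous_intros)
    ultimately have "continuous_on UNIV (\<lambda>t. integral {a..cl t} (\<lambda>s. f s (z s)))"
      by (rule continuous_on_compose2) (use cl in auto)
    then show ?thesis unfolding G_def by (intro continuous_intros)
  qed
  have intb: "norm (integral {a..c} (\<lambda>s. f s (z s))) \<le> B * (c - a)"
    if "continuous_on UNIV z" "c \<in> {a..b}" for z c
    using that bound by (intro integral_bound cf) (auto intro: continuous_on_subset)
  have B0: "B \<ge> 0" using bound[of 0 0] norm_ge_zero order_trans by blast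
  have G_bound: "norm (G z t - y0) \<le> 3 * \<tau> * B" if "continuous_on UNIV z" for z t
  proof -
    have "norm (G z t - y0) \<le> norm (integral {a..cl t} (\<lambda>s. f s (z s))) + norm (integral {a..t0} (\<lambda>s. f s (z s)))"
      unfolding G_def by (simp add: norm_triangle_ineq4)
    also have "\<dots> \<le> B * (cl t - a) + B * (t0 - a)"
      using intb[OF that cl(1)[of t]] intb[OF that, of t0] \<tau> by (auto simp: a_def b_def)
    also have "\<dots> \<le> B * (2 * \<tau>) + B * \<tau>"
      using cl(3)[of t] B0 by (intro add_mono mult_left_mono) (auto simp: a_def b_def)
    finally show ?thesis by (simp add: algebra_simps)
  qed
  have G_bc: "G z \<in> bcontfun" if "continuous_on UNIV z" for z
  proof (rule bcontfun_normI[OF G_cont[OF that]])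
    fix t show "norm (G z t) \<le> norm y0 + 3 * \<tau> * B"
      using G_bound[OF that, of t] norm_triangle_ineq2[of "G z t" y0] by linarith
  qed
  define T where "T z = Bcontfun (G (apply_bcontfun z))" for z
  have T: "apply_bcontfun (T z) = G (apply_bcontfun z)" for z
    unfolding T_def by (rule Bcontfun_inverse) (simp add: G_bc)
  have contr: "dist (T x) (T y) \<le> 1 / 2 * dist x y" for x y
  proof -
    have L: "L * norm (apply_bcontfun x s - apply_bcontfun y s) \<le> \<bar>L\<bar> * dist x y" for s
      using dist_bounded[of x s y] by (intro mult_mono) (auto simp: dist_norm)
    have *: "norm (integral {a..c} (\<lambda>s. f s (apply_bcontfun x s)) - integral {a..c} (\<lambda>s. f s (apply_bcontfun y s))) \<le> \<bar>L\<bar> * dist x y * (c - a)"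
      if "c \<in> {a..b}" for c
    proof -
      have "norm (integral {a..c} (\<lambda>s. f s (apply_bcontfun x s) - f s (apply_bcontfun y s))) \<le> \<bar>L\<bar> * dist x y * (c - a)"
        using that L
        by (intro integral_bound order_trans[OF lip] continuous_on_diff cf) auto
      then show ?thesis by (subst (asm) integral_diff) (auto intro!: int)
    qed
    \<comment> \<open>The sign of \<open>L\<close> can be read off from \<open>lip\<close> at two
      distinct points; a basis vector and 0 serve.\<close>
    have L0: "L \<ge> 0" using order_trans[OF norm_ge_zero lip[of 0 "SOME b. b\<in>Basis" 0]]
      by (simp add: zero_le_mult_iff some_in_eq)
    show ?thesis
    proof -
      have "dist (T x) (T y) \<le> dist x y / 2"
      proof (rule dist_bound)
        fix t
        have "dist (apply_bcontfun (T x) t) (apply_bcontfun (T y) t) \<le>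
          norm (integral {a..cl t} (\<lambda>s. f s (apply_bcontfun x s)) - integral {a..cl t} (\<lambda>s. f s (apply_bcontfun y s)))
          + norm (integral {a..t0} (\<lambda>s. f s (apply_bcontfun x s)) - integral {a..t0} (\<lambda>s. f s (apply_bcontfun y s)))"
          unfolding T G_def dist_norm
          by (rule order_trans[OF _ norm_triangle_ineq4]) (simp add: algebra_simps)
        also have "\<dots> \<le> \<bar>L\<bar> * dist x y * (cl t - a) + \<bar>L\<bar> * dist x y * (t0 - a)"
          using *[OF cl(1)[of t]] *[of t0] \<tau> by (auto simp: a_def b_def)
        also have "\<dots> \<le> \<bar>L\<bar> * dist x y * (2 * \<tau>) + \<bar>L\<bar> * dist x y * \<tau>"
          using cl(3)[of t] by (intro add_mono mult_left_mono) (auto simp: a_def b_def)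
        also have "\<dots> = (6 * L * \<tau>) * dist x y / 2" using L0 by (simp add: algebra_simps)
        also have "\<dots> \<le> dist x y / 2" using mult_right_mono[OF \<tau>(2), of "dist x y"] by simp
        finally show "dist (apply_bcontfun (T x) t) (apply_bcontfun (T y) t) \<le> dist x y / 2" .
      qed
      then show ?thesis by simp
    qed
  qed
  have "\<exists>!z. T z = z" using contr by (intro banach_fix_type[of "1/2"]) auto
  then obtain zz where "T zz = zz" by blast
  define z where "z = apply_bcontfun zz"
  have z: "z = G z" using T[of zz] \<open>T zz = zz\<close> by (simp add: z_def)
  have zc: "continuous_on UNIV z" by (simp add: z_def)
  have t0: "t0 \<in> {a..b}" using \<tau> by (auto simp: a_def b_def)
  show thesis
  proof (rule that[of z])
    show "z t0 = y0" by (subst z) (simp add: G_def cl_id[OF t0])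
    fix t assume "t \<in> {t0 - \<tau>..t0 + \<tau>}"
    then have t: "t \<in> {a..b}" by (simp add: a_def b_def)
    show "norm (z t - y0) \<le> 3 * \<tau> * B" by (subst z) (rule G_bound[OF zc])
    have "((\<lambda>c. integral {a..c} (\<lambda>s. f s (z s))) has_vector_derivative f t (z t)) (at t within {a..b})"
      by (rule integral_has_vector_derivative[OF _ t]) (rule cf, rule continuous_on_subset[OF zc], auto)
    then have "((\<lambda>c. y0 + (integral {a..c} (\<lambda>s. f s (z s)) - integral {a..t0} (\<lambda>s. f s (z s))))
      has_vector_derivative f t (z t)) (at t within {a..b})"
      by (auto intro!: derivative_eq_intros)
    then have "(z has_vector_derivative f t (z t)) (at t within {a..b})"
      by (rule has_vector_derivative_transform[OF t, rotated]) (subst z, simp add: G_def cl_id)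
    then show "(z has_vector_derivative f t (z t)) (at t within {t0 - \<tau>..t0 + \<tau>})"
      by (simp add: a_def b_def)
  qed
qed

lemma has_real_derivative_nonneg_imp_le:
  fixes f :: "real \<Rightarrow> real"
  assumes der: "\<And>x. x \<in> {a..b} \<Longrightarrow> (f has_real_derivative f' x) (at x within {a..b})"
    and nonneg: "\<And>x. x \<in> {a..b} \<Longrightarrow> 0 \<le> f' x"
    and st: "a \<le> s" "s \<le> t" "t \<le> b"
  shows "f s \<le> f t"
proof (rule DERIV_nonneg_imp_increasing_open[OF st(2)])
  fix x assume x: "s < x" "x < t"
  then have "(f has_real_derivative f' x) (at x within {a<..<b})"
    using st by (intro has_field_derivative_subset[OF der]) auto
  moreover have "at x within {a<..<b} = at x"
    using x st by (intro at_within_open) auto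
  ultimately show "\<exists>y. (f has_real_derivative y) (at x) \<and> 0 \<le> y"
    using x st nonneg[of x] by auto
next
  show "continuous_on {s..t} f"
    using der st by (intro continuous_on_subset[OF DERIV_continuous_on[of "{a..b}"]]) auto
qed

text \<open>The bound on the absolute value of \<open>e'\<close> makes
  \<open>e x * exp (- K * x)\<close> decrease and \<open>e x * exp (K * x)\<close> increase, so the
  estimate runs in both directions of time. Backward time occurs because a flow line may be
  evaluated before its initial time.\<close>

lemma gronwall_abs:
  fixes e :: "real \<Rightarrow> real"
  assumes der: "\<And>t. t \<in> {a..b} \<Longrightarrow> (e has_real_derivative e' t) (at t within {a..b})"
    and le: "\<And>t. t \<in> {a..b} \<Longrightarrow> \<bar>e' t\<bar> \<le> K * e t"
    and st: "s \<in> {a..b}" "t \<in> {a..b}"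
  shows "e t \<le> exp (K * \<bar>t - s\<bar>) * e s"
proof (cases "s \<le> t")
  case True
  have "- (e s * exp (- K * s)) \<le> - (e t * exp (- K * t))"
  proof (rule has_real_derivative_nonneg_imp_le[of a b "\<lambda>x. - (e x * exp (- K * x))" "\<lambda>x. (K * e x - e' x) * exp (- K * x)"])
    fix x assume "x \<in> {a..b}"
    then show "((\<lambda>x. - (e x * exp (- K * x))) has_real_derivative (K * e x - e' x) * exp (- K * x)) (at x within {a..b})"
      by (auto intro!: derivative_eq_intros der simp: algebra_simps)
    show "0 \<le> (K * e x - e' x) * exp (- K * x)"
      using le[OF \<open>x \<in> {a..b}\<close>] by (intro mult_nonneg_nonneg) auto
  qed (use True st in auto)
  then have "e t * exp (- K * t) \<le> e s * exp (- K * s)" by simp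
  then have "e t * exp (- K * t) * exp (K * t) \<le> e s * exp (- K * s) * exp (K * t)"
    by (rule mult_right_mono) simp
  then show ?thesis using True by (simp add: mult.assoc exp_add[symmetric] algebra_simps)
next
  case False
  have "e t * exp (K * t) \<le> e s * exp (K * s)"
  proof (rule has_real_derivative_nonneg_imp_le[of a b "\<lambda>x. e x * exp (K * x)" "\<lambda>x. (e' x + K * e x) * exp (K * x)"])
    fix x assume "x \<in> {a..b}"
    then show "((\<lambda>x. e x * exp (K * x)) has_real_derivative (e' x + K * e x) * exp (K * x)) (at x within {a..b})"
      by (auto intro!: derivative_eq_intros der simp: algebra_simps)
    show "0 \<le> (e' x + K * e x) * exp (K * x)"
      using le[OF \<open>x \<in> {a..b}\<close>] by (intro mult_nonneg_nonneg) auto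
  qed (use False st in auto)
  then have "e t * exp (K * t) * exp (- K * t) \<le> e s * exp (K * s) * exp (- K * t)"
    by (rule mult_right_mono) simp
  then show ?thesis using False by (simp add: mult.assoc exp_add[symmetric] algebra_simps)
qed

section \<open>Locally Lipschitz functions on a compact manifold\<close>

locale compact_manifold =
  fixes A :: "('m::t2_space, 'd::finite) chart set"
  assumes manifold: "closed_connected_manifold A"
begin

lemma compact_UNIV: "compact (UNIV :: 'm set)"
  using manifold by (simp add: closed_connected_manifold_def)

lemma chart_at: obtains c where "c \<in> A" "p \<in> cdom c"
  using manifold unfolding closed_connected_manifold_def smooth_atlas_def by blast

context
  fixes c assumes c: "c \<in> A"
begin

lemma open_cdom: "open (cdom c)" and open_crange: "open (crange c)"
  and homeo: "homeomorphism (cdom c) (crange c) (crd c) (cinv c)"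
  using c manifold unfolding closed_connected_manifold_def smooth_atlas_def by blast+

lemma continuous_on_crd: "continuous_on (cdom c) (crd c)"
  and continuous_on_cinv: "continuous_on (crange c) (cinv c)"
  using homeo by (auto simp: homeomorphism_def)

lemma cinv_crd: "p \<in> cdom c \<Longrightarrow> cinv c (crd c p) = p"
  and crd_cinv: "y \<in> crange c \<Longrightarrow> crd c (cinv c y) = y"
  and cinv_in: "y \<in> crange c \<Longrightarrow> cinv c y \<in> cdom c"
  and crd_in: "p \<in> cdom c \<Longrightarrow> crd c p \<in> crange c"
  using homeo by (auto simp: homeomorphism_def)

lemma open_crd_preimage: "open B \<Longrightarrow> open {p \<in> cdom c. crd c p \<in> B}"
  using continuous_on_open_vimage[OF open_cdom, of "crd c"] continuous_on_crd
  by (auto simp: vimage_def Int_def conj_commute)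

lemma open_crd_image:
  assumes "open W" "W \<subseteq> cdom c"
  shows "open (crd c ` W)"
proof -
  have "crd c ` W = {y \<in> crange c. cinv c y \<in> W}"
    using assms cinv_crd crd_in by (auto simp: subset_iff) (metis crd_cinv imageI)
  moreover have "open (cinv c -` W \<inter> crange c)"
    using continuous_on_open_vimage[OF open_crange, of "cinv c"] continuous_on_cinv assms by blast
  ultimately show ?thesis by (simp add: vimage_def Int_def conj_commute)
qed

end

lemma smooth_transition:
  "c \<in> A \<Longrightarrow> d \<in> A \<Longrightarrow> Ck_on k (crd c ` (cdom c \<inter> cdom d)) (crd d \<circ> cinv c)"
  using manifold unfolding closed_connected_manifold_def smooth_atlas_def smooth_on_def by blast

lemma has_derivative_transition:
  assumes "c \<in> A" "d \<in> A" "p \<in> cdom c" "p \<in> cdom d"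
  shows "((crd d \<circ> cinv c) has_derivative trans_deriv c d p) (at (crd c p))"
proof -
  have "open (crd c ` (cdom c \<inter> cdom d))"
    using assms by (intro open_crd_image open_Int open_cdom) auto
  moreover have "crd c p \<in> crd c ` (cdom c \<inter> cdom d)" using assms by blast
  ultimately show ?thesis
    using Ck_on_differentiable[OF smooth_transition[OF assms(1,2), of "Suc 0"], of "crd c p"]
    unfolding trans_deriv_def by (metis at_within_open)
qed

section \<open>Calculus of locally Lipschitz functions of time and point\<close>

text \<open>Distances are measured by the coordinates of a single chart, jointly with time, and
  times are confined to the interval on which generators are prescribed.\<close>

definition lip_on :: "('m, 'd) chart \<Rightarrow> 'm set \<Rightarrow> real \<Rightarrow> (real \<Rightarrow> 'm \<Rightarrow> real) \<Rightarrow> bool" where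
  "lip_on c W L f \<longleftrightarrow> (\<forall>x\<in>W. \<forall>y\<in>W. \<forall>s\<in>{0..1}. \<forall>t\<in>{0..1}.
      \<bar>f s x - f t y\<bar> \<le> L * (\<bar>s - t\<bar> + norm (crd c x - crd c y)))"

definition loclip :: "('m, 'd) chart \<Rightarrow> 'm \<Rightarrow> (real \<Rightarrow> 'm \<Rightarrow> real) \<Rightarrow> bool" where
  "loclip c p f \<longleftrightarrow> (\<exists>W L. open W \<and> p \<in> W \<and> W \<subseteq> cdom c \<and> lip_on c W L f)"

lemma lip_onD:
  "lip_on c W L f \<Longrightarrow> x \<in> W \<Longrightarrow> y \<in> W \<Longrightarrow> s \<in> {0..1} \<Longrightarrow> t \<in> {0..1} \<Longrightarrow>
    \<bar>f s x - f t y\<bar> \<le> L * (\<bar>s - t\<bar> + norm (crd c x - crd c y))"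
  by (simp add: lip_on_def)

lemma loclipI:
  assumes "open W" "p \<in> W" "W \<subseteq> cdom c"
    "\<And>x y s t. x \<in> W \<Longrightarrow> y \<in> W \<Longrightarrow> s \<in> {0..1} \<Longrightarrow> t \<in> {0..1} \<Longrightarrow>
      \<bar>f s x - f t y\<bar> \<le> L * (\<bar>s - t\<bar> + norm (crd c x - crd c y))"
  shows "loclip c p f"
  unfolding loclip_def lip_on_def using assms by blast

text \<open>Comparing times 0 and 1 at \<open>p\<close> shows that \<open>L\<close> is nonnegative.
  Shrinking to coordinate distance 1 from \<open>p\<close> adds a bound, which products require: the
  value differs from \<open>f 0 p\<close> by at most \<open>L\<close> times one unit of time plus
  one unit of space.\<close>

lemma loclipE:
  assumes c: "c \<in> A" and f: "loclip c p f"
  obtains W L B where "open W" "p \<in> W" "W \<subseteq> cdom c" "L \<ge> 0" "B \<ge> 0" "lip_on c W L f"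
    "\<forall>x\<in>W. \<forall>t\<in>{0..1}. \<bar>f t x\<bar> \<le> B"
proof -
  obtain W L where W: "open W" "p \<in> W" "W \<subseteq> cdom c" and L: "lip_on c W L f"
    using f by (auto simp: loclip_def)
  define V where "V = W \<inter> {q \<in> cdom c. crd c q \<in> ball (crd c p) 1}"
  have L0: "L \<ge> 0" using lip_onD[OF L W(2) W(2), of 0 1] by auto
  show thesis
  proof (rule that)
    show "open V" unfolding V_def using W c by (intro open_Int open_crd_preimage) auto
    show "p \<in> V" "V \<subseteq> cdom c" using W by (auto simp: V_def)
    show "L \<ge> 0" by (rule L0)
    show "0 \<le> \<bar>f 0 p\<bar> + L * 2" using L0 by simp
    show "lip_on c V L f"
      using L by (simp add: lip_on_def V_def)
    have "\<bar>f t x\<bar> \<le> \<bar>f 0 p\<bar> + L * 2" if "x \<in> V" "t \<in> {0..1}" for t x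
    proof -
      have "\<bar>f t x - f 0 p\<bar> \<le> L * (\<bar>t - 0\<bar> + norm (crd c x - crd c p))"
        using that W by (intro lip_onD[OF L]) (auto simp: V_def)
      also have "\<dots> \<le> L * 2"
        using that L0 by (intro mult_left_mono) (auto simp: V_def dist_norm norm_minus_commute)
      finally show ?thesis by linarith
    qed
    then show "\<forall>x\<in>V. \<forall>t\<in>{0..1}. \<bar>f t x\<bar> \<le> \<bar>f 0 p\<bar> + L * 2" by blast
  qed
qed

lemma loclip_const: "c \<in> A \<Longrightarrow> p \<in> cdom c \<Longrightarrow> loclip c p (\<lambda>t x. a)"
  by (rule loclipI[of "cdom c" _ _ _ 0]) (auto simp: open_cdom)

lemma loclip_crd: "c \<in> A \<Longrightarrow> p \<in> cdom c \<Longrightarrow> loclip c p (\<lambda>t x. crd c x $ i)"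
  by (rule loclipI[of "cdom c" _ _ _ 1])
     (auto simp: open_cdom vector_minus_component[symmetric] simp del: vector_minus_component
        intro!: order_trans[OF component_le_norm_cart])

lemma loclip_add:
  assumes c: "c \<in> A" and f: "loclip c p f" and g: "loclip c p g"
  shows "loclip c p (\<lambda>t x. f t x + g t x)"
proof -
  from loclipE[OF c f] obtain W L where W: "open W" "p \<in> W" "W \<subseteq> cdom c"
    and L: "lip_on c W L f" by metis
  from loclipE[OF c g] obtain W' L' where W': "open W'" "p \<in> W'" "W' \<subseteq> cdom c"
    and L': "lip_on c W' L' g" by metis
  show ?thesis
  proof (rule loclipI[of "W \<inter> W'" _ _ _ "L + L'"])
    fix x y s t assume "x \<in> W \<inter> W'" "y \<in> W \<inter> W'" "s \<in> {0..1::real}" "t \<in> {0..1::real}"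
    then have "\<bar>f s x - f t y\<bar> \<le> L * (\<bar>s - t\<bar> + norm (crd c x - crd c y))"
      "\<bar>g s x - g t y\<bar> \<le> L' * (\<bar>s - t\<bar> + norm (crd c x - crd c y))" using lip_onD[OF L] lip_onD[OF L'] by auto
    then show "\<bar>f s x + g s x - (f t y + g t y)\<bar> \<le> (L + L') * (\<bar>s - t\<bar> + norm (crd c x - crd c y))"
      unfolding distrib_right by linarith
  qed (use W W' in auto)
qed

lemma loclip_mult:
  assumes c: "c \<in> A" and f: "loclip c p f" and g: "loclip c p g"
  shows "loclip c p (\<lambda>t x. f t x * g t x)"
proof -
  from loclipE[OF c f] obtain W L B where W: "open W" "p \<in> W" "W \<subseteq> cdom c" "B \<ge> 0"
    and L: "lip_on c W L f"
    and B: "\<forall>x\<in>W. \<forall>t\<in>{0..1}. \<bar>f t x\<bar> \<le> B" by metis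
  from loclipE[OF c g] obtain W' L' B' where W': "open W'" "p \<in> W'" "W' \<subseteq> cdom c" "B' \<ge> 0"
    and L': "lip_on c W' L' g"
    and B': "\<forall>x\<in>W'. \<forall>t\<in>{0..1}. \<bar>g t x\<bar> \<le> B'" by metis
  show ?thesis
  proof (rule loclipI[of "W \<inter> W'" _ _ _ "B * L' + B' * L"])
    fix x y s t assume a: "x \<in> W \<inter> W'" "y \<in> W \<inter> W'" "s \<in> {0..1::real}" "t \<in> {0..1::real}"
    define D where "D = \<bar>s - t\<bar> + norm (crd c x - crd c y)"
    have "\<bar>f s x * g s x - f t y * g t y\<bar> = \<bar>f s x * (g s x - g t y) + g t y * (f s x - f t y)\<bar>"
      by (simp add: algebra_simps)
    also have "\<dots> \<le> \<bar>f s x\<bar> * \<bar>g s x - g t y\<bar> + \<bar>g t y\<bar> * \<bar>f s x - f t y\<bar>"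
      by (rule order_trans[OF abs_triangle_ineq]) (simp add: abs_mult)
    also have "\<dots> \<le> B * (L' * D) + B' * (L * D)"
      unfolding D_def using a W W' by (intro add_mono mult_mono lip_onD[OF L] lip_onD[OF L'] B[rule_format] B'[rule_format]) auto
    finally show "\<bar>f s x * g s x - f t y * g t y\<bar>
        \<le> (B * L' + B' * L) * (\<bar>s - t\<bar> + norm (crd c x - crd c y))"
      by (simp add: D_def[symmetric] algebra_simps)
  qed (use W W' in auto)
qed

lemma loclip_sum:
  assumes "c \<in> A" "p \<in> cdom c" "\<And>i. i \<in> I \<Longrightarrow> loclip c p (f i)"
  shows "loclip c p (\<lambda>t x. \<Sum>i\<in>I. f i t x)"
  using assms(3)
  by (induction I rule: infinite_finite_induct) (auto intro: loclip_const loclip_add assms(1,2))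

lemma loclip_max0:
  assumes "c \<in> A" "loclip c p f"
  shows "loclip c p (\<lambda>t x. max 0 (f t x))"
proof -
  from loclipE[OF assms] obtain W L where W: "open W" "p \<in> W" "W \<subseteq> cdom c"
    and L: "lip_on c W L f" by metis
  show ?thesis
    by (rule loclipI[OF W, of _ L], rule order_trans[OF _ lip_onD[OF L]]) (auto simp: max_def)
qed

lemma loclip_cong:
  assumes c: "c \<in> A" and f: "loclip c p f" and V: "open V" "p \<in> V"
    and eq: "\<And>x t. x \<in> V \<Longrightarrow> t \<in> {0..1} \<Longrightarrow> f t x = g t x"
  shows "loclip c p g"
proof -
  from loclipE[OF c f] obtain W L where W: "open W" "p \<in> W" "W \<subseteq> cdom c"
    and L: "lip_on c W L f" by metis
  show ?thesis
    by (rule loclipI[of "W \<inter> V" _ _ _ L]) (use W V lip_onD[OF L] eq in \<open>auto simp: eq[symmetric]\<close>)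
qed

lemma crd_ball:
  assumes c: "c \<in> A" "p \<in> W" "open W" "W \<subseteq> cdom c"
  obtains e where "e > 0" "cball (crd c p) e \<subseteq> crd c ` W"
    "{q \<in> cdom c. crd c q \<in> cball (crd c p) e} \<subseteq> W"
proof -
  have "open (crd c ` W)" using c by (intro open_crd_image)
  then obtain e where e: "e > 0" "cball (crd c p) e \<subseteq> crd c ` W"
    using c by (meson imageI open_contains_cball)
  moreover have "q \<in> W" if q: "q \<in> cdom c" "crd c q \<in> cball (crd c p) e" for q
  proof -
    obtain w where w: "w \<in> W" "crd c q = crd c w" using e(2) q(2) by blast
    then have "q = w" using cinv_crd[OF c(1)] q(1) c(4) by (metis subsetD)
    then show ?thesis using w by simp
  qed
  ultimately show thesis using that[of e] by auto
qed

text \<open>A transition map is smooth, hence Lipschitz on a closed ball, so the coordinate distance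
  of one chart is controlled by that of the other near a common point. Thus \<open>loclip\<close>
  may be established in whichever chart is convenient.\<close>

lemma loclip_transition:
  assumes c: "c \<in> A" "p \<in> cdom c" and d: "d \<in> A" "p \<in> cdom d" and f: "loclip c p f"
  shows "loclip d p f"
proof -
  from loclipE[OF c(1) f] obtain W L where W: "open W" "p \<in> W" "W \<subseteq> cdom c" "L \<ge> 0"
    and L: "lip_on c W L f" by metis
  have "open (W \<inter> cdom d)" "p \<in> W \<inter> cdom d" "W \<inter> cdom d \<subseteq> cdom d"
    using W d open_cdom[OF d(1)] by auto
  from d(1) this(2,1,3) obtain e where e: "e > 0" "cball (crd d p) e \<subseteq> crd d ` (W \<inter> cdom d)"
    "{q \<in> cdom d. crd d q \<in> cball (crd d p) e} \<subseteq> W \<inter> cdom d" by (rule crd_ball)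
  have sub: "cball (crd d p) e \<subseteq> crd d ` (cdom d \<inter> cdom c)" using e W by blast
  from Ck_one_lipschitz[OF smooth_transition[OF d(1) c(1)] sub compact_cball convex_cball]
  obtain M where M: "M \<ge> 0" and *: "\<And>x y. x \<in> cball (crd d p) e \<Longrightarrow> y \<in> cball (crd d p) e \<Longrightarrow>
      norm ((crd c \<circ> cinv d) x - (crd c \<circ> cinv d) y) \<le> M * norm (x - y)" by metis
  show ?thesis
  proof (rule loclipI[of "{q \<in> cdom d. crd d q \<in> ball (crd d p) e}" _ _ _ "L * (1 + M)"])
    show "open {q \<in> cdom d. crd d q \<in> ball (crd d p) e}" by (intro open_crd_preimage d(1) open_ball)
    fix x y s t
    assume x: "x \<in> {q \<in> cdom d. crd d q \<in> ball (crd d p) e}"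
      and y: "y \<in> {q \<in> cdom d. crd d q \<in> ball (crd d p) e}" and st: "s \<in> {0..1::real}" "t \<in> {0..1::real}"
    have b: "norm (crd c x - crd c y) \<le> M * norm (crd d x - crd d y)"
      using *[of "crd d x" "crd d y"] x y cinv_crd[OF d(1)] by simp
    have "x \<in> W" "y \<in> W" using x y e(3) by auto
    then have "\<bar>f s x - f t y\<bar> \<le> L * (\<bar>s - t\<bar> + norm (crd c x - crd c y))" using lip_onD[OF L] st by blast
    also have "\<dots> \<le> L * ((1 + M) * (\<bar>s - t\<bar> + norm (crd d x - crd d y)))"
    proof (rule mult_left_mono[OF _ W(4)])
      have "0 \<le> M * \<bar>s - t\<bar>" using M by simp
      then show "\<bar>s - t\<bar> + norm (crd c x - crd c y) \<le> (1 + M) * (\<bar>s - t\<bar> + norm (crd d x - crd d y))"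
        using b norm_ge_zero[of "crd d x - crd d y"] by (simp only: distrib_left distrib_right mult_1)
    qed
    finally show "\<bar>f s x - f t y\<bar> \<le> L * (1 + M) * (\<bar>s - t\<bar> + norm (crd d x - crd d y))"
      by (simp add: mult.assoc)
  qed (use e d in auto)
qed

lemma loclip_Ck:
  assumes c: "c \<in> A" "p \<in> cdom c" and F: "Ck_on (Suc 0) ({0..1} \<times> crange c) F"
  shows "loclip c p (\<lambda>t x. F (t, crd c x))"
proof -
  from crd_ball[OF c(1,2) open_cdom[OF c(1)] order_refl] obtain e
    where e: "e > 0" "cball (crd c p) e \<subseteq> crange c" by (metis crange_def)
  have S: "{0..1::real} \<times> cball (crd c p) e \<subseteq> {0..1} \<times> crange c" using e by auto
  from Ck_one_lipschitz[OF F S] obtain L where L: "L \<ge> 0"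
    "\<And>x y. x \<in> {0..1} \<times> cball (crd c p) e \<Longrightarrow> y \<in> {0..1} \<times> cball (crd c p) e \<Longrightarrow>
      norm (F x - F y) \<le> L * norm (x - y)"
    by (metis compact_Times compact_Icc compact_cball convex_Times convex_real_interval(5) convex_cball)
  show ?thesis
  proof (rule loclipI[of "{q \<in> cdom c. crd c q \<in> ball (crd c p) e}" _ _ _ L])
    show "open {q \<in> cdom c. crd c q \<in> ball (crd c p) e}" by (intro open_crd_preimage c(1) open_ball)
    fix x y s t
    assume x: "x \<in> {q \<in> cdom c. crd c q \<in> ball (crd c p) e}"
      and y: "y \<in> {q \<in> cdom c. crd c q \<in> ball (crd c p) e}" and st: "s \<in> {0..1::real}" "t \<in> {0..1::real}"
    have "\<bar>F (s, crd c x) - F (t, crd c y)\<bar> \<le> L * norm ((s, crd c x) - (t, crd c y))"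
      using L(2)[of "(s, crd c x)" "(t, crd c y)"] x y st by simp
    also have "\<dots> \<le> L * (\<bar>s - t\<bar> + norm (crd c x - crd c y))"
      using L(1) norm_Pair_le[of "s - t" "crd c x - crd c y"] by (intro mult_left_mono) auto
    finally show "\<bar>F (s, crd c x) - F (t, crd c y)\<bar> \<le> L * (\<bar>s - t\<bar> + norm (crd c x - crd c y))" .
  qed (use e c in auto)
qed

lemma loclip_Ck_space:
  assumes c: "c \<in> A" "p \<in> cdom c" and F: "Ck_on (Suc 0) (crange c) F"
  shows "loclip c p (\<lambda>t x. F (crd c x))"
proof -
  from crd_ball[OF c(1,2) open_cdom[OF c(1)] order_refl] obtain e
    where e: "e > 0" "cball (crd c p) e \<subseteq> crange c" by (metis crange_def)
  from Ck_one_lipschitz[OF F e(2) compact_cball convex_cball] obtain L where L: "L \<ge> 0"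
    "\<And>x y. x \<in> cball (crd c p) e \<Longrightarrow> y \<in> cball (crd c p) e \<Longrightarrow>
      norm (F x - F y) \<le> L * norm (x - y)" by metis
  show ?thesis
  proof (rule loclipI[of "{q \<in> cdom c. crd c q \<in> ball (crd c p) e}" _ _ _ L])
    show "open {q \<in> cdom c. crd c q \<in> ball (crd c p) e}" by (intro open_crd_preimage c(1) open_ball)
    fix x y s t
    assume x: "x \<in> {q \<in> cdom c. crd c q \<in> ball (crd c p) e}"
      and y: "y \<in> {q \<in> cdom c. crd c q \<in> ball (crd c p) e}"
    have "\<bar>F (crd c x) - F (crd c y)\<bar> \<le> L * norm (crd c x - crd c y)"
      using L(2)[of "crd c x" "crd c y"] x y by simp
    also have "\<dots> \<le> L * (\<bar>s - t\<bar> + norm (crd c x - crd c y))"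
      using L(1) by (intro mult_left_mono) auto
    finally show "\<bar>F (crd c x) - F (crd c y)\<bar> \<le> L * (\<bar>s - t\<bar> + norm (crd c x - crd c y))" .
  qed (use e c in auto)
qed

lemma loclip_Ck_time:
  assumes c: "c \<in> A" "p \<in> cdom c" and l: "Ck_on (Suc 0) {0..1} l"
  shows "loclip c p (\<lambda>t x. l t)"
proof -
  from Ck_one_lipschitz[OF l order_refl compact_Icc convex_real_interval(5)]
  obtain L where L: "L \<ge> 0" "\<And>x y. x \<in> {0..1} \<Longrightarrow> y \<in> {0..1} \<Longrightarrow> norm (l x - l y) \<le> L * norm (x - y)"
    by metis
  show ?thesis
  proof (rule loclipI[of "cdom c" _ _ _ L])
    fix x y s t assume st: "s \<in> {0..1::real}" "t \<in> {0..1::real}"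
    have "\<bar>l s - l t\<bar> \<le> L * \<bar>s - t\<bar>" using L(2)[OF st] by simp
    also have "\<dots> \<le> L * (\<bar>s - t\<bar> + norm (crd c x - crd c y))"
      using L(1) by (intro mult_left_mono) auto
    finally show "\<bar>l s - l t\<bar> \<le> L * (\<bar>s - t\<bar> + norm (crd c x - crd c y))" .
  qed (use c open_cdom in auto)
qed

section \<open>Uniform bounds by compactness\<close>

definition lip :: "(real \<Rightarrow> 'm \<Rightarrow> real) \<Rightarrow> bool" where
  "lip f \<longleftrightarrow> (\<forall>p. \<exists>c\<in>A. p \<in> cdom c \<and> loclip c p f)"

lemma lip_imp_loclip: "lip f \<Longrightarrow> c \<in> A \<Longrightarrow> p \<in> cdom c \<Longrightarrow> loclip c p f"
  unfolding lip_def using loclip_transition by blast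

lemma lip_bounded:
  assumes "lip f"
  obtains B where "B \<ge> 0" "\<And>t x. t \<in> {0..1} \<Longrightarrow> \<bar>f t x\<bar> \<le> B"
proof -
  have "\<exists>W B. open W \<and> p \<in> W \<and> (\<forall>x\<in>W. \<forall>t\<in>{0..1}. \<bar>f t x\<bar> \<le> B)" for p
  proof -
    obtain c where "c \<in> A" "loclip c p f" using assms unfolding lip_def by blast
    from loclipE[OF this] show ?thesis by metis
  qed
  then obtain W B where W: "\<And>p. open (W p)" "\<And>p. p \<in> W p"
    and B: "\<And>p x t. x \<in> W p \<Longrightarrow> t \<in> {0..1} \<Longrightarrow> \<bar>f t x\<bar> \<le> B p" by metis
  obtain D where D: "finite D" "UNIV \<subseteq> (\<Union>p\<in>D. W p)"
    by (rule compactE_image[OF compact_UNIV, of UNIV W]) (use W in blast)+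
  show thesis
  proof (rule that)
    show "0 \<le> (\<Sum>p\<in>D. \<bar>B p\<bar>)" by (simp add: sum_nonneg)
    fix t x assume t: "t \<in> {0..1::real}"
    obtain p where p: "p \<in> D" "x \<in> W p" using D by blast
    have "\<bar>f t x\<bar> \<le> \<bar>B p\<bar>" using B[OF p(2) t] by linarith
    also have "\<dots> \<le> (\<Sum>p\<in>D. \<bar>B p\<bar>)" using p D by (intro member_le_sum) auto
    finally show "\<bar>f t x\<bar> \<le> (\<Sum>p\<in>D. \<bar>B p\<bar>)" .
  qed
qed

text \<open>Both values are taken at the same point, which lies in one member of a finite cover.
  Comparing two distinct points calls for a global distance; see \<open>lip_sqdist\<close>.\<close>

lemma lip_time:
  assumes "lip f"
  obtains L where "L \<ge> 0" "\<And>s t x. s \<in> {0..1} \<Longrightarrow> t \<in> {0..1} \<Longrightarrow> \<bar>f s x - f t x\<bar> \<le> L * \<bar>s - t\<bar>"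
proof -
  have "\<exists>W L. open W \<and> p \<in> W \<and> (\<forall>x\<in>W. \<forall>s\<in>{0..1}. \<forall>t\<in>{0..1}. \<bar>f s x - f t x\<bar> \<le> L * \<bar>s - t\<bar>)" for p
  proof -
    obtain c where c: "c \<in> A" "loclip c p f" using assms unfolding lip_def by blast
    from loclipE[OF c] obtain W L where W: "open W" "p \<in> W"
      and L: "lip_on c W L f" by metis
    have "\<bar>f s x - f t x\<bar> \<le> L * \<bar>s - t\<bar>" if "x \<in> W" "s \<in> {0..1}" "t \<in> {0..1}" for x s t
      using lip_onD[OF L that(1,1,2,3)] by simp
    then show ?thesis using W by blast
  qed
  then obtain W L where W: "\<And>p. open (W p)" "\<And>p. p \<in> W p"
    and L: "\<And>p x s t. x \<in> W p \<Longrightarrow> s \<in> {0..1} \<Longrightarrow> t \<in> {0..1} \<Longrightarrow> \<bar>f s x - f t x\<bar> \<le> L p * \<bar>s - t\<bar>" by metis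
  obtain D where D: "finite D" "UNIV \<subseteq> (\<Union>p\<in>D. W p)"
    by (rule compactE_image[OF compact_UNIV, of UNIV W]) (use W in blast)+
  show thesis
  proof (rule that)
    show "0 \<le> (\<Sum>p\<in>D. \<bar>L p\<bar>)" by (simp add: sum_nonneg)
    fix s t x assume st: "s \<in> {0..1::real}" "t \<in> {0..1::real}"
    obtain p where p: "p \<in> D" "x \<in> W p" using D by blast
    have "\<bar>f s x - f t x\<bar> \<le> L p * \<bar>s - t\<bar>" using L[OF p(2) st] .
    also have "\<dots> \<le> (\<Sum>p\<in>D. \<bar>L p\<bar>) * \<bar>s - t\<bar>"
      using p D member_le_sum[of p D "\<lambda>p. \<bar>L p\<bar>"] by (intro mult_right_mono) auto
    finally show "\<bar>f s x - f t x\<bar> \<le> (\<Sum>p\<in>D. \<bar>L p\<bar>) * \<bar>s - t\<bar>" .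
  qed
qed

lemma lip_continuous:
  assumes f: "lip f" and t: "t \<in> {0..1}"
  shows "continuous_on UNIV (f t)"
proof -
  have "isCont (f t) p" for p
  proof -
    obtain c where c: "c \<in> A" "p \<in> cdom c" "loclip c p f" using f unfolding lip_def by blast
    from loclipE[OF c(1,3)] obtain W L where W: "open W" "p \<in> W" "W \<subseteq> cdom c"
      and L: "lip_on c W L f" by metis
    have "isCont (crd c) p"
      using continuous_on_crd[OF c(1)] open_cdom[OF c(1)] c(2) by (simp add: continuous_on_eq_continuous_at)
    then have "((\<lambda>x. L * norm (crd c x - crd c p)) \<longlongrightarrow> L * norm (crd c p - crd c p)) (at p)"
      unfolding isCont_def by (intro tendsto_intros)
    then have lim: "((\<lambda>x. L * norm (crd c x - crd c p)) \<longlongrightarrow> 0) (at p)" by simp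
    have "eventually (\<lambda>x. x \<in> W) (at p)" using W by (auto simp: eventually_at_topological)
    then have "eventually (\<lambda>x. norm (f t x - f t p) \<le> L * norm (crd c x - crd c p)) (at p)"
      by eventually_elim (use lip_onD[OF L _ W(2) t t] in simp)
    from Lim_null_comparison[OF this lim] show ?thesis
      by (simp add: isCont_def LIM_zero_iff)
  qed
  then show ?thesis by (simp add: continuous_at_imp_continuous_on)
qed

end

section \<open>An embedding by bump functions\<close>

text \<open>Its square is C^1 with a Lipschitz derivative and vanishes outside the ball of radius
  \<open>r\<close> around \<open>y0\<close>.\<close>

definition cutoff :: "'a::real_inner \<Rightarrow> real \<Rightarrow> 'a \<Rightarrow> real" where
  "cutoff y0 r y = max 0 (r\<^sup>2 - (y - y0) \<bullet> (y - y0))"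

text \<open>Two kinds of function in one formula: \<open>a = 1\<close>, \<open>w = 0\<close> is the
  bump itself, while \<open>a = 0\<close>, \<open>w = axis i 1\<close> is the bump times the
  \<open>i\<close>-th coordinate relative to \<open>y0\<close>.\<close>

definition bump_rep :: "'a::real_inner \<Rightarrow> real \<Rightarrow> real \<Rightarrow> 'a \<Rightarrow> 'a \<Rightarrow> real" where
  "bump_rep y0 r a w y = (cutoff y0 r y)\<^sup>2 * (a + w \<bullet> (y - y0))"

definition bump_rep_deriv :: "'a::real_inner \<Rightarrow> real \<Rightarrow> real \<Rightarrow> 'a \<Rightarrow> 'a \<Rightarrow> 'a \<Rightarrow> real" where
  "bump_rep_deriv y0 r a w y v =
    - 4 * cutoff y0 r y * ((y - y0) \<bullet> v) * (a + w \<bullet> (y - y0)) + (cutoff y0 r y)\<^sup>2 * (w \<bullet> v)"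

lemma cutoff_eq_0:
  assumes "y \<notin> cball y0 r" "r > 0"
  shows "cutoff y0 r y = 0"
proof -
  have "r < norm (y - y0)" using assms by (simp add: dist_norm norm_minus_commute)
  then have "r\<^sup>2 \<le> (norm (y - y0))\<^sup>2" using assms by (intro power_mono) auto
  then show ?thesis by (simp add: cutoff_def power2_norm_eq_inner)
qed

text \<open>The branches 0 and \<open>s\<^sup>2\<close> agree at 0 together with their derivatives,
  so they can be glued along the closures of the two half-lines.\<close>

lemma has_real_derivative_max0_power2:
  "((\<lambda>s::real. (max 0 s)\<^sup>2) has_real_derivative 2 * max 0 s) (at s)"
proof -
  have eq: "(\<lambda>s::real. (max 0 s)\<^sup>2) = (\<lambda>s. if s \<in> {0..} then s\<^sup>2 else 0)"
    by (auto simp: max_def)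
  have cl: "closure {..<0::real} = {..0}" "closure {0..} = {0::real..}"
    by (auto simp: closure_lessThan)
  have "((\<lambda>s. if s \<in> {0..} then s\<^sup>2 else 0) has_vector_derivative
      (if s \<in> {0..} then 2 * s else 0)) (at s within UNIV)"
  proof (rule has_vector_derivative_If_within_closures[where T = "{..<0}"])
    show "((\<lambda>s. s\<^sup>2) has_vector_derivative 2 * s) (at s within {0..} \<union> closure {0..} \<inter> closure {..<0})"
      unfolding has_real_derivative_iff_has_vector_derivative[symmetric]
      by (auto intro!: derivative_eq_intros)
  qed (auto simp: cl)
  moreover have "(if s \<in> {0..} then 2 * s else 0) = 2 * max 0 s" by (auto simp: max_def)
  ultimately show ?thesis
    unfolding eq has_real_derivative_iff_has_vector_derivative by simp
qed

lemma has_derivative_bump_rep: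
  "(bump_rep y0 r a w has_derivative bump_rep_deriv y0 r a w y) (at y)"
proof -
  let ?g = "\<lambda>y. r\<^sup>2 - (y - y0) \<bullet> (y - y0)"
  have g: "(?g has_derivative (\<lambda>v. - (2 * ((y - y0) \<bullet> v)))) (at y)"
    by (auto intro!: derivative_eq_intros simp: inner_commute)
  have "((\<lambda>s::real. (max 0 s)\<^sup>2) has_derivative (*) (2 * max 0 (?g y))) (at (?g y))"
    using has_real_derivative_max0_power2[of "?g y"] by (simp add: has_field_derivative_def)
  from has_derivative_compose[OF g this]
  have 1: "((\<lambda>y. (cutoff y0 r y)\<^sup>2) has_derivative (\<lambda>v. 2 * cutoff y0 r y * (- (2 * ((y - y0) \<bullet> v))))) (at y)"
    by (simp add: cutoff_def)
  have 2: "((\<lambda>y. a + w \<bullet> (y - y0)) has_derivative (\<lambda>v. w \<bullet> v)) (at y)"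
    by (auto intro!: derivative_eq_intros)
  have "((\<lambda>y. (cutoff y0 r y)\<^sup>2 * (a + w \<bullet> (y - y0))) has_derivative bump_rep_deriv y0 r a w y) (at y)"
    by (rule has_derivative_eq_rhs[OF has_derivative_mult[OF 1 2]])
       (auto simp: bump_rep_deriv_def fun_eq_iff algebra_simps)
  moreover have "bump_rep y0 r a w = (\<lambda>y. (cutoff y0 r y)\<^sup>2 * (a + w \<bullet> (y - y0)))"
    by (simp add: fun_eq_iff bump_rep_def)
  ultimately show ?thesis by simp
qed

definition bump :: "('m, 'd::finite) chart \<Rightarrow> real ^ 'd \<Rightarrow> real \<Rightarrow> real \<Rightarrow> real ^ 'd \<Rightarrow> 'm \<Rightarrow> real" where
  "bump c y0 r a w x = (if x \<in> cdom c then bump_rep y0 r a w (crd c x) else 0)"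

definition bump_deriv :: "('m, 'd::finite) chart \<Rightarrow> real ^ 'd \<Rightarrow> real \<Rightarrow> real \<Rightarrow> real ^ 'd \<Rightarrow>
    (real ^ 'd) \<Rightarrow> 'm \<Rightarrow> real" where
  "bump_deriv c y0 r a w v x = (if x \<in> cdom c then bump_rep_deriv y0 r a w (crd c x) v else 0)"

text \<open>
  For the bump functions \<open>J\<close> chosen below the map with components \<open>J\<close> is an embedding, and
  \<open>sqdist J\<close> takes over the role of a squared metric on the manifold.
\<close>

definition sqdist :: "('m \<Rightarrow> real) set \<Rightarrow> 'm \<Rightarrow> 'm \<Rightarrow> real" where
  "sqdist J x y = (\<Sum>k\<in>J. (k x - k y)\<^sup>2)"

lemma sqdist_nonneg: "sqdist J x y \<ge> 0"
  by (simp add: sqdist_def sum_nonneg)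

lemma sqdist_self: "sqdist J x x = 0"
  by (simp add: sqdist_def)

lemma sqdist_ge: "finite J \<Longrightarrow> k \<in> J \<Longrightarrow> (k x - k y)\<^sup>2 \<le> sqdist J x y"
  unfolding sqdist_def by (rule member_le_sum) auto

context compact_manifold
begin

text \<open>Containing the closed ball in the range makes its preimage compact, hence closed in the
  manifold, and so a function supported there extends by zero across the boundary of the
  chart.\<close>

definition coordinate_ball :: "('m, 'd) chart \<Rightarrow> real ^ 'd \<Rightarrow> real \<Rightarrow> bool" where
  "coordinate_ball c y0 r \<longleftrightarrow> c \<in> A \<and> r > 0 \<and> cball y0 r \<subseteq> crange c"

lemma closed_cinv_cball:
  assumes "coordinate_ball c y0 r"
  shows "closed (cinv c ` cball y0 r)"
proof -
  have c: "c \<in> A" "cball y0 r \<subseteq> crange c" using assms by (auto simp: coordinate_ball_def)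
  have "compact (cinv c ` cball y0 r)"
    using c by (intro compact_continuous_image continuous_on_subset[OF continuous_on_cinv]) auto
  then show ?thesis by (rule compact_imp_closed)
qed

lemma bump_eq_0:
  assumes "coordinate_ball c y0 r" "x \<notin> cinv c ` cball y0 r"
  shows "bump c y0 r a w x = 0" "bump_deriv c y0 r a w v x = 0"
proof -
  have "cutoff y0 r (crd c x) = 0" if "x \<in> cdom c"
  proof (rule cutoff_eq_0)
    show "crd c x \<notin> cball y0 r"
      using assms cinv_crd[of c x] that unfolding coordinate_ball_def by (metis imageI)
  qed (use assms in \<open>simp add: coordinate_ball_def\<close>)
  then show "bump c y0 r a w x = 0" "bump_deriv c y0 r a w v x = 0"
    by (auto simp: bump_def bump_deriv_def bump_rep_def bump_rep_deriv_def)
qed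

text \<open>The chart domain and the complement of the closed ball are open and cover the manifold.
  Statements about functions extended by zero are checked on each of them.\<close>

lemma coordinate_ball_cases:
  assumes "coordinate_ball c y0 r"
  obtains "x \<in> cdom c" | "x \<notin> cdom c" "x \<in> - (cinv c ` cball y0 r)"
  using assms cinv_in[of c] unfolding coordinate_ball_def by blast

text \<open>The curve may leave the chart. Inside, this is the chain rule; outside, the curve stays
  for nearby times in the complement of the closed ball, where the bump function is zero.\<close>

lemma bump_along_curve:
  assumes b: "coordinate_ball c y0 r" and \<gamma>: "continuous_on I \<gamma>" and t: "t \<in> I"
    and der: "\<gamma> t \<in> cdom c \<Longrightarrow> ((\<lambda>s. crd c (\<gamma> s)) has_vector_derivative v) (at t within I)"
  shows "((\<lambda>s. bump c y0 r a w (\<gamma> s)) has_vector_derivative bump_deriv c y0 r a w v (\<gamma> t)) (at t within I)"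
proof -
  have c: "c \<in> A" using b by (simp add: coordinate_ball_def)
  have ev: "eventually (\<lambda>s. \<gamma> s \<in> W) (at t within I)" if "open W" "\<gamma> t \<in> W" for W
    using \<gamma> t that unfolding continuous_on_def by (metis topological_tendstoD)
  show ?thesis
  proof (cases rule: coordinate_ball_cases[OF b, of "\<gamma> t"])
    case 1
    have "((\<lambda>s. bump_rep y0 r a w (crd c (\<gamma> s))) has_derivative
        (\<lambda>x. bump_rep_deriv y0 r a w (crd c (\<gamma> t)) (x *\<^sub>R v))) (at t within I)"
      using der[OF 1] unfolding has_vector_derivative_def
      by (rule has_derivative_compose[OF _ has_derivative_bump_rep])
    then have *: "((\<lambda>s. bump_rep y0 r a w (crd c (\<gamma> s))) has_vector_derivative
        bump_rep_deriv y0 r a w (crd c (\<gamma> t)) v) (at t within I)"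
      unfolding has_vector_derivative_def
      by (rule has_derivative_eq_rhs) (auto simp: bump_rep_deriv_def fun_eq_iff algebra_simps)
    have "((\<lambda>s. bump c y0 r a w (\<gamma> s)) has_vector_derivative
        bump_rep_deriv y0 r a w (crd c (\<gamma> t)) v) (at t within I)"
      using * unfolding has_vector_derivative_def
      by (rule has_derivative_transform_eventually)
         (use ev[OF open_cdom[OF c] 1] 1 t in \<open>auto simp: bump_def elim: eventually_mono\<close>)
    then show ?thesis using 1 by (simp add: bump_deriv_def)
  next
    case 2
    have "open (- (cinv c ` cball y0 r))" using closed_cinv_cball[OF b] by (simp add: open_Compl)
    from ev[OF this 2(2)] have "eventually (\<lambda>s. 0 = bump c y0 r a w (\<gamma> s)) (at t within I)"
      by eventually_elim (simp add: bump_eq_0[OF b])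
    then have "((\<lambda>s. bump c y0 r a w (\<gamma> s)) has_vector_derivative 0) (at t within I)"
      unfolding has_vector_derivative_def
      by (rule has_derivative_transform_eventually[rotated]) (use 2 t in \<open>simp_all add: bump_eq_0[OF b]\<close>)
    then show ?thesis using bump_eq_0(2)[OF b] 2 by simp
  qed
qed

lemma loclip_cutoff:
  assumes c: "c \<in> A" "p \<in> cdom c"
  shows "loclip c p (\<lambda>t x. cutoff y0 r (crd c x))"
proof -
  have "cutoff y0 r = (\<lambda>y. max 0 (r\<^sup>2 + (\<Sum>i\<in>UNIV. (-1) * ((y $ i + - y0 $ i) * (y $ i + - y0 $ i)))))"
    by (simp add: fun_eq_iff cutoff_def inner_vec_def sum_negf)
  then show ?thesis
    by (simp only:)
       (intro loclip_max0 loclip_add loclip_const loclip_sum loclip_mult loclip_crd c)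
qed

lemma loclip_inner:
  assumes c: "c \<in> A" "p \<in> cdom c"
    and f: "\<And>i. loclip c p (\<lambda>t x. f t x $ i)" and g: "\<And>i. loclip c p (\<lambda>t x. g t x $ i)"
  shows "loclip c p (\<lambda>t x. f t x \<bullet> g t x)"
  unfolding inner_vec_def inner_real_def by (intro loclip_sum loclip_mult c f g)

lemma loclip_component:
  assumes c: "c \<in> A" "p \<in> cdom c"
  shows "loclip c p (\<lambda>t x. (crd c x + - y0) $ i)"
  unfolding vector_add_component by (intro loclip_add loclip_crd loclip_const c)

lemma loclip_bump_rep:
  assumes c: "c \<in> A" "p \<in> cdom c"
  shows "loclip c p (\<lambda>t x. bump_rep y0 r a w (crd c x))"
proof -
  have "loclip c p (\<lambda>t x. w \<bullet> (crd c x + - y0))"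
    by (intro loclip_inner c loclip_const loclip_component)
  then show ?thesis unfolding bump_rep_def power2_eq_square diff_conv_add_uminus
    by (intro loclip_mult loclip_add loclip_const loclip_cutoff[unfolded diff_conv_add_uminus] c)
qed

lemma loclip_bump_rep_deriv:
  assumes c: "c \<in> A" "p \<in> cdom c" and v: "\<And>i. loclip c p (\<lambda>t x. v t x $ i)"
  shows "loclip c p (\<lambda>t x. bump_rep_deriv y0 r a w (crd c x) (v t x))"
proof -
  have 1: "loclip c p (\<lambda>t x. w \<bullet> (crd c x + - y0))"
    by (intro loclip_inner c loclip_const loclip_component)
  have 2: "loclip c p (\<lambda>t x. (crd c x + - y0) \<bullet> v t x)"
    by (intro loclip_inner c v loclip_component)
  have 3: "loclip c p (\<lambda>t x. w \<bullet> v t x)"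
    by (intro loclip_inner c v loclip_const)
  show ?thesis unfolding bump_rep_deriv_def power2_eq_square diff_conv_add_uminus
    by (intro loclip_mult loclip_add loclip_const loclip_cutoff[unfolded diff_conv_add_uminus] c 1 2 3)
qed

lemma lip_if_cball:
  assumes b: "coordinate_ball c y0 r"
    and f: "\<And>p. p \<in> cdom c \<Longrightarrow> loclip c p f"
    and f0: "\<And>t x. x \<notin> cinv c ` cball y0 r \<Longrightarrow> f t x = 0"
  shows "lip f"
  unfolding lip_def
proof
  fix p
  have c: "c \<in> A" using b by (simp add: coordinate_ball_def)
  show "\<exists>c\<in>A. p \<in> cdom c \<and> loclip c p f"
  proof (cases rule: coordinate_ball_cases[OF b, of p])
    case 1
    then show ?thesis using f c by blast
  next
    case 2
    obtain d where d: "d \<in> A" "p \<in> cdom d" by (rule chart_at)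
    have "open (- (cinv c ` cball y0 r))" using closed_cinv_cball[OF b] by (simp add: open_Compl)
    then have "loclip d p f"
      by (rule loclip_cong[OF d(1) loclip_const[OF d, of 0]]) (use 2 f0 in auto)
    then show ?thesis using d by blast
  qed
qed

lemma lip_bump:
  assumes b: "coordinate_ball c y0 r"
  shows "lip (\<lambda>t. bump c y0 r a w)"
proof (rule lip_if_cball[OF b])
  fix p assume p: "p \<in> cdom c"
  have c: "c \<in> A" using b by (simp add: coordinate_ball_def)
  show "loclip c p (\<lambda>t. bump c y0 r a w)"
    by (rule loclip_cong[OF c loclip_bump_rep[OF c p] open_cdom[OF c] p]) (simp add: bump_def)
qed (simp add: bump_eq_0[OF b])

lemma lip_bump_deriv:
  assumes b: "coordinate_ball c y0 r"
    and v: "\<And>p i. p \<in> cdom c \<Longrightarrow> loclip c p (\<lambda>t x. v t x $ i)"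
  shows "lip (\<lambda>t x. bump_deriv c y0 r a w (v t x) x)"
proof (rule lip_if_cball[OF b])
  fix p assume p: "p \<in> cdom c"
  have c: "c \<in> A" using b by (simp add: coordinate_ball_def)
  show "loclip c p (\<lambda>t x. bump_deriv c y0 r a w (v t x) x)"
    by (rule loclip_cong[OF c loclip_bump_rep_deriv[OF c p v[OF p]] open_cdom[OF c] p]) (simp add: bump_deriv_def)
qed (simp add: bump_eq_0[OF b])

lemma bump_axis: "bump c y0 r 0 (axis i 1) x = bump c y0 r 1 0 x * (crd c x - y0) $ i"
  by (simp add: bump_def bump_rep_def inner_axis')

text \<open>Within half the radius, \<open>cutoff\<close> is at least
  \<open>r\<^sup>2 - (r / 2)\<^sup>2\<close>, that is 3/4 of \<open>r\<^sup>2\<close>. A positive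
  lower bound permits division by the bump.\<close>

lemma bump_ge:
  assumes x: "x \<in> cdom c" "crd c x \<in> ball y0 (r / 2)"
  shows "(3 / 4 * r\<^sup>2)\<^sup>2 \<le> bump c y0 r 1 0 x"
proof -
  have "norm (crd c x - y0) \<le> r / 2" using x by (simp add: dist_norm norm_minus_commute)
  then have "(norm (crd c x - y0))\<^sup>2 \<le> (r / 2)\<^sup>2" by (rule power_mono) simp
  then have "3 / 4 * r\<^sup>2 \<le> cutoff y0 r (crd c x)"
    by (simp add: cutoff_def power2_norm_eq_inner power_divide le_max_iff_disj)
  then show ?thesis using x by (simp add: bump_def bump_rep_def power_mono)
qed

text \<open>The bump is positive at \<open>x\<close>, so its value at \<open>y\<close> forces
  \<open>y\<close>, an arbitrary point, into the same chart; dividing the weighted coordinates by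
  the common value of the bump then gives equal coordinates.\<close>

lemma bump_separates:
  assumes b: "coordinate_ball c y0 r" and x: "x \<in> cdom c" "crd c x \<in> ball y0 (r / 2)"
    and eq: "bump c y0 r 1 0 y = bump c y0 r 1 0 x"
      "\<And>i. bump c y0 r 0 (axis i 1) y = bump c y0 r 0 (axis i 1) x"
  shows "y = x"
proof -
  have c: "c \<in> A" "r > 0" using b by (auto simp: coordinate_ball_def)
  have pos: "bump c y0 r 1 0 x > 0"
    using bump_ge[OF x] c by (intro less_le_trans[OF _ bump_ge[OF x]]) simp
  have y: "y \<in> cdom c" using eq(1) pos by (auto simp: bump_def split: if_splits)
  have "crd c y - y0 = crd c x - y0"
    using eq pos unfolding bump_axis by (simp add: vec_eq_iff)
  then show ?thesis using cinv_crd[OF c(1)] x(1) y by (metis diff_add_cancel)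
qed

text \<open>The quantitative form of \<open>bump_separates\<close>: the inverse of the embedding is
  Lipschitz on the half-radius ball. In the constant, \<open>2 + 2 * r\<^sup>2\<close> comes from
  splitting a square of a difference with coordinates bounded by \<open>r\<close>, the denominator
  is the squared lower bound of the bump, and \<open>CARD('d)\<close> counts the components.\<close>

lemma bump_controls:
  fixes c :: "('m, 'd) chart"
  assumes J: "finite J" "bump c y0 r 1 0 \<in> J" "\<And>i. bump c y0 r 0 (axis i 1) \<in> J"
    and r: "r > 0"
    and x: "x \<in> cdom c" "crd c x \<in> ball y0 (r / 2)" and y: "y \<in> cdom c" "crd c y \<in> ball y0 (r / 2)"
  shows "(norm (crd c x - crd c y))\<^sup>2
    \<le> real CARD('d) * ((2 + 2 * r\<^sup>2) / ((3 / 4 * r\<^sup>2)\<^sup>2)\<^sup>2) * sqdist J x y"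
proof -
  define m where "m = (3 / 4 * r\<^sup>2)\<^sup>2"
  have m: "m > 0" using r by (simp add: m_def)
  let ?k = "bump c y0 r 1 0"
  have comp: "((crd c x - crd c y) $ i)\<^sup>2 \<le> (2 + 2 * r\<^sup>2) / m\<^sup>2 * sqdist J x y" for i
  proof -
    let ?l = "bump c y0 r 0 (axis i 1)"
    define u v where "u = (crd c x - y0) $ i" and "v = (crd c y - y0) $ i"
    have uv: "(crd c x - crd c y) $ i = u - v" by (simp add: u_def v_def)
    have "\<bar>v\<bar> \<le> norm (crd c y - y0)" unfolding v_def by (rule component_le_norm_cart)
    also have "\<dots> \<le> r" using y r by (simp add: dist_norm norm_minus_commute)
    finally have v: "v\<^sup>2 \<le> r\<^sup>2" by (simp add: power2_le_iff_abs_le r less_imp_le)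
    \<comment> \<open>As \<open>?l\<close> is \<open>?k\<close> times the centred coordinate, the
      coordinate difference is expressed by the increments of \<open>?l\<close> and
      \<open>?k\<close> alone.\<close>
    have "?k x * (u - v) = (?l x - ?l y) - v * (?k x - ?k y)"
      unfolding bump_axis u_def v_def by (simp add: algebra_simps)
    then have "(?k x)\<^sup>2 * (u - v)\<^sup>2 = ((?l x - ?l y) - v * (?k x - ?k y))\<^sup>2"
      by (simp add: power_mult_distrib[symmetric])
    also have "\<dots> \<le> 2 * (?l x - ?l y)\<^sup>2 + 2 * (v * (?k x - ?k y))\<^sup>2"
      using zero_le_power2[of "(?l x - ?l y) + v * (?k x - ?k y)"]
      by (simp add: power2_sum power2_diff)
    also have "\<dots> = 2 * (?l x - ?l y)\<^sup>2 + 2 * (v\<^sup>2 * (?k x - ?k y)\<^sup>2)"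
      by (simp add: power_mult_distrib)
    also have "\<dots> \<le> 2 * sqdist J x y + 2 * (r\<^sup>2 * sqdist J x y)"
      using v by (intro add_mono mult_left_mono mult_mono sqdist_ge J) auto
    finally have 1: "(?k x)\<^sup>2 * (u - v)\<^sup>2 \<le> (2 + 2 * r\<^sup>2) * sqdist J x y"
      by (simp add: algebra_simps)
    have "m\<^sup>2 \<le> (?k x)\<^sup>2" using bump_ge[OF x] m unfolding m_def by (intro power_mono) auto
    then have "m\<^sup>2 * (u - v)\<^sup>2 \<le> (2 + 2 * r\<^sup>2) * sqdist J x y"
      using 1 by (meson mult_right_mono order_trans zero_le_power2)
    then show ?thesis unfolding uv using m by (simp add: field_simps)
  qed
  have "(norm (crd c x - crd c y))\<^sup>2 = (\<Sum>i\<in>UNIV. ((crd c x - crd c y) $ i)\<^sup>2)"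
    unfolding power2_norm_eq_inner inner_vec_def by (simp add: power2_eq_square)
  also have "\<dots> \<le> (\<Sum>i\<in>(UNIV::'d set). (2 + 2 * r\<^sup>2) / m\<^sup>2 * sqdist J x y)"
    by (intro sum_mono comp)
  finally show ?thesis by (simp add: m_def)
qed

text \<open>The second clause lets each member be differentiated along curves. The third makes the
  members an embedding: around every point some chart can be recovered from them, on a ball where
  the bump has a positive lower bound.\<close>

definition bump_family :: "('m \<Rightarrow> real) set \<Rightarrow> bool" where
  "bump_family J \<longleftrightarrow> finite J \<and>
    (\<forall>k\<in>J. \<exists>c y0 r a w. coordinate_ball c y0 r \<and> k = bump c y0 r a w) \<and>
    (\<forall>p. \<exists>c y0 r. coordinate_ball c y0 r \<and> p \<in> cdom c \<and> crd c p \<in> ball y0 (r / 2) \<and>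
      bump c y0 r 1 0 \<in> J \<and> (\<forall>i. bump c y0 r 0 (axis i 1) \<in> J))"

lemma ex_bump_family: "\<exists>J. bump_family J"
proof -
  have "\<exists>c r. coordinate_ball c (crd c p) r \<and> p \<in> cdom c" for p
  proof -
    obtain c where c: "c \<in> A" "p \<in> cdom c" by (rule chart_at)
    obtain r where "r > 0" "cball (crd c p) r \<subseteq> crange c"
      using open_crange[OF c(1)] crd_in[OF c] by (meson open_contains_cball)
    then show ?thesis using c unfolding coordinate_ball_def by blast
  qed
  then obtain C R where CR: "\<And>p. coordinate_ball (C p) (crd (C p) p) (R p)" "\<And>p. p \<in> cdom (C p)"
    by metis
  have C: "C p \<in> A" "R p > 0" for p using CR(1)[of p] by (auto simp: coordinate_ball_def)
  define W where "W p = {q \<in> cdom (C p). crd (C p) q \<in> ball (crd (C p) p) (R p / 2)}" for p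
  have W: "open (W p)" "p \<in> W p" for p
    unfolding W_def using C CR(2) by (auto intro: open_crd_preimage simp del: mem_ball simp: centre_in_ball)
  obtain D where D: "finite D" "UNIV \<subseteq> (\<Union>p\<in>D. W p)"
    by (rule compactE_image[OF compact_UNIV, of UNIV W]) (use W in blast)+
  define J where "J = (\<Union>p\<in>D. insert (bump (C p) (crd (C p) p) (R p) 1 0)
    (range (\<lambda>i. bump (C p) (crd (C p) p) (R p) 0 (axis i 1))))"
  have "bump_family J" unfolding bump_family_def
  proof (intro conjI allI ballI)
    show "finite J" using D by (simp add: J_def)
    show "\<exists>c y0 r a w. coordinate_ball c y0 r \<and> k = bump c y0 r a w" if "k \<in> J" for k
      using that CR(1) unfolding J_def by blast
    fix q
    obtain p where p: "p \<in> D" "q \<in> W p" using D by blast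
    then show "\<exists>c y0 r. coordinate_ball c y0 r \<and> q \<in> cdom c \<and> crd c q \<in> ball y0 (r / 2) \<and>
      bump c y0 r 1 0 \<in> J \<and> (\<forall>i. bump c y0 r 0 (axis i 1) \<in> J)"
      using CR(1)[of p] unfolding W_def J_def by blast
  qed
  then show ?thesis by blast
qed

lemma bump_family_separates:
  assumes J: "bump_family J" and eq: "sqdist J x y = 0"
  shows "x = y"
proof -
  obtain c y0 r where c: "coordinate_ball c y0 r" "x \<in> cdom c" "crd c x \<in> ball y0 (r / 2)"
    "bump c y0 r 1 0 \<in> J" "\<And>i. bump c y0 r 0 (axis i 1) \<in> J"
    using J unfolding bump_family_def by metis
  have "finite J" using J by (simp add: bump_family_def)
  then have "k x = k y" if "k \<in> J" for k
    using sqdist_ge[OF _ that, of x y] eq by simp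
  then have "y = x" using bump_separates[OF c(1,2,3), of y] c(4,5) by metis
  then show ?thesis by simp
qed

lemma bump_family_lip: "bump_family J \<Longrightarrow> k \<in> J \<Longrightarrow> lip (\<lambda>t. k)"
  unfolding bump_family_def using lip_bump by metis

lemma continuous_on_sqdist:
  assumes J: "bump_family J" and f: "continuous_on S f" and g: "continuous_on S g"
  shows "continuous_on S (\<lambda>z. sqdist J (f z) (g z))"
proof -
  have "continuous_on UNIV k" if "k \<in> J" for k
    using lip_continuous[OF bump_family_lip[OF J that], of 0] by simp
  then show ?thesis unfolding sqdist_def
    by (intro continuous_on_sum continuous_on_power continuous_on_diff)
       (auto intro: continuous_on_compose2 f g)
qed

lemma bump_family_local:
  assumes J: "bump_family J"
  obtains c W K where "c \<in> A" "open W" "p \<in> W" "W \<subseteq> cdom c" "K \<ge> 0"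
    "\<And>x y. x \<in> W \<Longrightarrow> y \<in> W \<Longrightarrow> (norm (crd c x - crd c y))\<^sup>2 \<le> K * sqdist J x y"
proof -
  obtain c y0 r where c: "coordinate_ball c y0 r" "p \<in> cdom c" "crd c p \<in> ball y0 (r / 2)"
    "bump c y0 r 1 0 \<in> J" "\<And>i. bump c y0 r 0 (axis i 1) \<in> J"
    using J unfolding bump_family_def by metis
  have cA: "c \<in> A" "r > 0" using c(1) by (auto simp: coordinate_ball_def)
  have fin: "finite J" using J by (simp add: bump_family_def)
  show thesis
  proof (rule that[of c "{q \<in> cdom c. crd c q \<in> ball y0 (r / 2)}"])
    show "open {q \<in> cdom c. crd c q \<in> ball y0 (r / 2)}" by (intro open_crd_preimage cA open_ball)
    show "0 \<le> real CARD('d) * ((2 + 2 * r\<^sup>2) / ((3 / 4 * r\<^sup>2)\<^sup>2)\<^sup>2)" by simp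
    show "(norm (crd c x - crd c y))\<^sup>2
      \<le> real CARD('d) * ((2 + 2 * r\<^sup>2) / ((3 / 4 * r\<^sup>2)\<^sup>2)\<^sup>2) * sqdist J x y"
      if "x \<in> {q \<in> cdom c. crd c q \<in> ball y0 (r / 2)}" "y \<in> {q \<in> cdom c. crd c q \<in> ball y0 (r / 2)}" for x y
      by (rule bump_controls[OF fin c(4,5) cA(2)]) (use that in auto)
  qed (use c cA in auto)
qed

text \<open>Compactness of the product of the manifold with itself reduces this to neighbourhoods of
  pairs. Near a diagonal pair both points share a chart, and the coordinate distance is controlled
  by \<open>sqdist\<close>; near any other pair \<open>sqdist\<close> stays away from 0, and
  boundedness of \<open>f\<close> is enough.\<close>

lemma lip_sqdist:
  assumes J: "bump_family J" and f: "lip f"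
  obtains C where "C \<ge> 0" "\<And>t x y. t \<in> {0..1} \<Longrightarrow> (f t x - f t y)\<^sup>2 \<le> C * sqdist J x y"
proof -
  obtain B where B: "B \<ge> 0" "\<And>t x. t \<in> {0..1} \<Longrightarrow> \<bar>f t x\<bar> \<le> B" using lip_bounded[OF f] by blast
  define good where "good V C \<longleftrightarrow> (\<forall>(x, y)\<in>V. \<forall>t\<in>{0..1}. (f t x - f t y)\<^sup>2 \<le> C * sqdist J x y)" for V C
  have "\<exists>V C. open V \<and> z \<in> V \<and> good V C" for z
  proof (cases "fst z = snd z")
    case True
    define p where "p = fst z"
    from bump_family_local[OF J, of p] obtain c W K where c: "c \<in> A" and W: "open W" "p \<in> W" "W \<subseteq> cdom c"
      and K: "K \<ge> 0" "\<And>x y. x \<in> W \<Longrightarrow> y \<in> W \<Longrightarrow> (norm (crd c x - crd c y))\<^sup>2 \<le> K * sqdist J x y" by metis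
    have "loclip c p f" using lip_imp_loclip[OF f c] W by blast
    from loclipE[OF c this] obtain W' L where W': "open W'" "p \<in> W'" "L \<ge> 0" and L: "lip_on c W' L f"
      by metis
    have *: "(f t x - f t y)\<^sup>2 \<le> L\<^sup>2 * K * sqdist J x y" if "x \<in> W \<inter> W'" "y \<in> W \<inter> W'" "t \<in> {0..1}" for x y t
    proof -
      have "\<bar>f t x - f t y\<bar> \<le> L * norm (crd c x - crd c y)"
        using lip_onD[OF L, of x y t t] that by simp
      then have "(f t x - f t y)\<^sup>2 \<le> (L * norm (crd c x - crd c y))\<^sup>2"
        by (rule abs_le_square_iff[THEN iffD1, OF order_trans]) simp
      also have "\<dots> \<le> L\<^sup>2 * (K * sqdist J x y)"
        unfolding power_mult_distrib using that by (intro mult_left_mono K) auto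
      finally show ?thesis by (simp add: mult.assoc)
    qed
    show ?thesis
      by (rule exI[of _ "(W \<inter> W') \<times> (W \<inter> W')"], rule exI[of _ "L\<^sup>2 * K"])
         (use W W' * True in \<open>auto simp: good_def p_def open_Times open_Int mem_Times_iff\<close>)
  next
    case False
    let ?d = "\<lambda>z. sqdist J (fst z) (snd z)"
    have d: "?d z > 0"
      using bump_family_separates[OF J, of "fst z" "snd z"] False sqdist_nonneg[of J "fst z" "snd z"]
      by fastforce
    have "continuous_on UNIV ?d"
      by (intro continuous_on_sqdist[OF J] continuous_on_fst continuous_on_snd continuous_on_id)
    then have "open {y. ?d z / 2 < ?d y}" by (intro open_Collect_less continuous_on_const)
    \<comment> \<open>Where \<open>sqdist\<close> exceeds half its value at \<open>z\<close>, the
      factor \<open>2 / ?d z * sqdist J x y\<close> is at least 1 and may be multiplied onto the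
      crude bound \<open>(2 * B)\<^sup>2\<close>.\<close>
    moreover have "(f t x - f t y)\<^sup>2 \<le> (2 * B)\<^sup>2 * 2 / ?d z * sqdist J x y"
      if "?d z / 2 < sqdist J x y" "t \<in> {0..1}" for x y t
    proof -
      have "\<bar>f t x - f t y\<bar> \<le> \<bar>2 * B\<bar>" using B(2)[OF that(2), of x] B(2)[OF that(2), of y] by linarith
      then have "(f t x - f t y)\<^sup>2 \<le> (2 * B)\<^sup>2" by (rule abs_le_square_iff[THEN iffD1])
      also have "\<dots> \<le> (2 * B)\<^sup>2 * (2 / ?d z * sqdist J x y)"
        using mult_left_mono[of 1 "2 / ?d z * sqdist J x y" "(2 * B)\<^sup>2"] that d by (simp add: field_simps)
      finally show ?thesis by simp
    qed
    ultimately show ?thesis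
      by (intro exI[of _ "{y. ?d z / 2 < ?d y}"] exI[of _ "(2 * B)\<^sup>2 * 2 / ?d z"]) (use d in \<open>auto simp: good_def\<close>)
  qed
  then obtain V C where V: "\<And>z. open (V z)" "\<And>z. z \<in> V z"
    and C: "\<And>z. good (V z) (C z)" by metis
  have "compact (UNIV :: ('m \<times> 'm) set)" using compact_Times[OF compact_UNIV compact_UNIV] by simp
  then obtain D where D: "finite D" "UNIV \<subseteq> (\<Union>z\<in>D. V z)"
    by (rule compactE_image[of _ UNIV V]) (use V in blast)+
  show thesis
  proof (rule that)
    show "0 \<le> (\<Sum>z\<in>D. \<bar>C z\<bar>)" by (simp add: sum_nonneg)
    fix t x y assume t: "t \<in> {0..1::real}"
    obtain z where z: "z \<in> D" "(x, y) \<in> V z" using D by blast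
    have "(f t x - f t y)\<^sup>2 \<le> C z * sqdist J x y" using C[of z] z t by (auto simp: good_def)
    also have "\<dots> \<le> (\<Sum>z\<in>D. \<bar>C z\<bar>) * sqdist J x y"
      using z D member_le_sum[of z D "\<lambda>z. \<bar>C z\<bar>"]
      by (intro mult_right_mono sqdist_nonneg) auto
    finally show "(f t x - f t y)\<^sup>2 \<le> (\<Sum>z\<in>D. \<bar>C z\<bar>) * sqdist J x y" .
  qed
qed

text \<open>On the compact complement of \<open>W\<close> the continuous function
  \<open>sqdist J p\<close> attains a positive minimum, which serves as \<open>e\<close>; an empty
  complement has no minimum and is treated apart. Smallness of \<open>sqdist\<close> thus implies
  nearness in the topology of the manifold.\<close>

lemma sqdist_nhd:
  assumes J: "bump_family J" and W: "open W" "p \<in> W"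
  obtains e where "e > 0" "\<And>q. sqdist J p q < e \<Longrightarrow> q \<in> W"
proof (cases "W = UNIV")
  case True
  then show thesis using that[of 1] by simp
next
  case False
  have "compact (- W)" using compact_UNIV W by (simp add: closed_Compl compact_Int_closed[of UNIV "- W", simplified])
  moreover have "- W \<noteq> {}" using False by auto
  moreover have "continuous_on (- W) (sqdist J p)"
    by (intro continuous_on_sqdist[OF J] continuous_on_const continuous_on_id)
  ultimately obtain q where q: "q \<in> - W" "\<And>y. y \<in> - W \<Longrightarrow> sqdist J p q \<le> sqdist J p y"
    using continuous_attains_inf[of "- W" "sqdist J p"] by blast
  have "sqdist J p q > 0"
    using bump_family_separates[OF J, of p q] q(1) W sqdist_nonneg[of J p q] by fastforce
  then show thesis using q(2) by (intro that) force+
qed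

end

section \<open>Integral curves and the flow\<close>

text \<open>At a point outside one of the closed sets the filter within that set is trivial, so its
  limit holds vacuously. One statement therefore covers interior points and the junction of two
  concatenated curves.\<close>

lemma has_vector_derivative_Un:
  assumes S: "closed S" "t \<in> S \<Longrightarrow> (f has_vector_derivative v) (at t within S)"
    and T: "closed T" "t \<in> T \<Longrightarrow> (f has_vector_derivative v) (at t within T)"
  shows "(f has_vector_derivative v) (at t within S \<union> T)"
proof -
  have *: "((\<lambda>y. (1 / norm (y - t)) *\<^sub>R (f y - (f t + (y - t) *\<^sub>R v))) \<longlongrightarrow> 0) (at t within V)"
    if V: "closed V" "t \<in> V \<Longrightarrow> (f has_vector_derivative v) (at t within V)" for V
  proof (cases "t \<in> V")
    case True
    then show ?thesis using V(2) unfolding has_vector_derivative_def has_derivative_within by blast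
  next
    case False
    then have "at t within V = bot" using V(1) by (simp add: not_in_closure_trivial_limitI)
    then show ?thesis by simp
  qed
  show ?thesis
    unfolding has_vector_derivative_def has_derivative_within
    using *[OF S] *[OF T] by (auto intro: Lim_Un bounded_linear_scaleR_left)
qed

text \<open>Extends a field from times in [0,1] to all times without enlarging its Lipschitz
  constant, so that intervals of existence may stick out of [0,1].\<close>

definition clamp :: "real \<Rightarrow> real" where "clamp t = max 0 (min 1 t)"

lemma clamp_in: "clamp t \<in> {0..1}"
  and clamp_id: "t \<in> {0..1} \<Longrightarrow> clamp t = t"
  and clamp_lipschitz: "\<bar>clamp s - clamp t\<bar> \<le> \<bar>s - t\<bar>"
  by (auto simp: clamp_def)

locale manifold_field = compact_manifold A
  for A :: "('m::t2_space, 'd::finite) chart set" +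
  fixes X :: "real \<Rightarrow> ('m, 'd) vfield"
  assumes X_transition: "\<And>t c d p. t \<in> {0..1} \<Longrightarrow> c \<in> A \<Longrightarrow> d \<in> A \<Longrightarrow> p \<in> cdom c \<Longrightarrow> p \<in> cdom d \<Longrightarrow>
      X t d (crd d p) = trans_deriv c d p (X t c (crd c p))"
    and X_loclip: "\<And>c p i. c \<in> A \<Longrightarrow> p \<in> cdom c \<Longrightarrow> loclip c p (\<lambda>t x. X t c (crd c x) $ i)"
begin

section \<open>Uniqueness and stability of integral curves\<close>

text \<open>Solutions of \<gamma>' = \<zeta>(t) X(\<xi>(t), \<gamma>). The two parameters cover
  every equation that occurs: \<open>\<zeta> = 1\<close> with \<open>\<xi>\<close> the identity is
  the flow, \<open>\<xi> = clamp\<close> its extension in time, and \<open>\<zeta>\<close> the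
  derivative of \<open>\<xi>\<close> a reparametrized isotopy.\<close>

definition icurve :: "real set \<Rightarrow> (real \<Rightarrow> real) \<Rightarrow> (real \<Rightarrow> real) \<Rightarrow> (real \<Rightarrow> 'm) \<Rightarrow> bool" where
  "icurve I \<zeta> \<xi> \<gamma> \<longleftrightarrow> continuous_on I \<gamma> \<and> (\<forall>t\<in>I. \<forall>c\<in>A. \<gamma> t \<in> cdom c \<longrightarrow>
    ((\<lambda>s. crd c (\<gamma> s)) has_vector_derivative \<zeta> t *\<^sub>R X (\<xi> t) c (crd c (\<gamma> t))) (at t within I))"

lemma icurveD:
  "icurve I \<zeta> \<xi> \<gamma> \<Longrightarrow> t \<in> I \<Longrightarrow> c \<in> A \<Longrightarrow> \<gamma> t \<in> cdom c \<Longrightarrow>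
    ((\<lambda>s. crd c (\<gamma> s)) has_vector_derivative \<zeta> t *\<^sub>R X (\<xi> t) c (crd c (\<gamma> t))) (at t within I)"
  by (simp add: icurve_def)

lemma icurve_subset:
  assumes "icurve I \<zeta> \<xi> \<gamma>" "I' \<subseteq> I"
  shows "icurve I' \<zeta> \<xi> \<gamma>"
  using assms unfolding icurve_def
  by (meson continuous_on_subset has_vector_derivative_within_subset subsetD)

lemma bump_deriv_scale: "bump_deriv c y0 r a w (z *\<^sub>R v) x = z * bump_deriv c y0 r a w v x"
  by (simp add: bump_deriv_def bump_rep_deriv_def algebra_simps)

text \<open>\<open>Y\<close> is the derivative of \<open>k\<close> in the direction of the field. It
  depends on time and point but not on the curve, and it is Lipschitz because the derivative of a
  bump function is; this turns the equation on the manifold into scalar equations.\<close>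

lemma bump_family_deriv:
  assumes "bump_family J" "k \<in> J"
  obtains Y where "lip Y"
    "\<And>I \<zeta> \<xi> \<gamma> t. icurve I \<zeta> \<xi> \<gamma> \<Longrightarrow> t \<in> I \<Longrightarrow>
      ((\<lambda>s. k (\<gamma> s)) has_real_derivative \<zeta> t * Y (\<xi> t) (\<gamma> t)) (at t within I)"
proof -
  obtain c y0 r a w where b: "coordinate_ball c y0 r" and k: "k = bump c y0 r a w"
    using assms unfolding bump_family_def by metis
  have c: "c \<in> A" using b by (simp add: coordinate_ball_def)
  show thesis
  proof (rule that[of "\<lambda>t x. bump_deriv c y0 r a w (X t c (crd c x)) x"])
    show "lip (\<lambda>t x. bump_deriv c y0 r a w (X t c (crd c x)) x)"
      by (rule lip_bump_deriv[OF b X_loclip[OF c]])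
    fix I \<zeta> \<xi> \<gamma> t assume \<gamma>: "icurve I \<zeta> \<xi> \<gamma>" and t: "t \<in> I"
    have "continuous_on I \<gamma>" using \<gamma> by (simp add: icurve_def)
    from bump_along_curve[OF b this t icurveD[OF \<gamma> t c]]
    show "((\<lambda>s. k (\<gamma> s)) has_real_derivative
        \<zeta> t * bump_deriv c y0 r a w (X (\<xi> t) c (crd c (\<gamma> t))) (\<gamma> t)) (at t within I)"
      by (simp add: k bump_deriv_scale has_real_derivative_iff_has_vector_derivative)
  qed
qed

text \<open>Differentiating \<open>sqdist\<close> gives products of an increment of \<open>k\<close>
  with an increment of its derivative \<open>Y\<close>. Both are bounded by \<open>sqdist\<close>
  after 2ab \<le> a^2 + b^2. \<open>K\<close> depends on the field and \<open>J\<close> only; a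
  particular speed factor enters through its bound \<open>Z\<close>.\<close>

lemma icurve_gronwall:
  assumes J: "bump_family J"
  obtains K where "K \<ge> 0"
    "\<And>a b \<zeta> \<xi> \<gamma> \<delta> Z s t. icurve {a..b} \<zeta> \<xi> \<gamma> \<Longrightarrow> icurve {a..b} \<zeta> \<xi> \<delta> \<Longrightarrow> \<xi> ` {a..b} \<subseteq> {0..1} \<Longrightarrow>
      (\<And>t. t \<in> {a..b} \<Longrightarrow> \<bar>\<zeta> t\<bar> \<le> Z) \<Longrightarrow> s \<in> {a..b} \<Longrightarrow> t \<in> {a..b} \<Longrightarrow>
      sqdist J (\<gamma> t) (\<delta> t) \<le> exp (K * Z * \<bar>t - s\<bar>) * sqdist J (\<gamma> s) (\<delta> s)"
proof -
  have "\<exists>Y C. lip Y \<and> C \<ge> 0 \<and> (\<forall>t\<in>{0..1}. \<forall>x y. (Y t x - Y t y)\<^sup>2 \<le> C * sqdist J x y) \<and>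
    (\<forall>I \<zeta> \<xi> \<gamma>. \<forall>t\<in>I. icurve I \<zeta> \<xi> \<gamma> \<longrightarrow>
      ((\<lambda>s. k (\<gamma> s)) has_real_derivative \<zeta> t * Y (\<xi> t) (\<gamma> t)) (at t within I))" if k: "k \<in> J" for k
  proof -
    obtain Y where Y: "lip Y"
      "\<And>I \<zeta> \<xi> \<gamma> t. icurve I \<zeta> \<xi> \<gamma> \<Longrightarrow> t \<in> I \<Longrightarrow>
        ((\<lambda>s. k (\<gamma> s)) has_real_derivative \<zeta> t * Y (\<xi> t) (\<gamma> t)) (at t within I)"
      by (rule bump_family_deriv[OF J k]) blast
    obtain C where "C \<ge> 0" "\<And>t x y. t \<in> {0..1} \<Longrightarrow> (Y t x - Y t y)\<^sup>2 \<le> C * sqdist J x y"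
      by (rule lip_sqdist[OF J Y(1)]) blast
    then show ?thesis using Y by blast
  qed
  then obtain Y C where C0: "\<And>k. k \<in> J \<Longrightarrow> C k \<ge> 0"
    and C: "\<And>k t x y. k \<in> J \<Longrightarrow> t \<in> {0..1} \<Longrightarrow> (Y k t x - Y k t y)\<^sup>2 \<le> C k * sqdist J x y"
    and der: "\<And>k I \<zeta> \<xi> \<gamma> t. k \<in> J \<Longrightarrow> icurve I \<zeta> \<xi> \<gamma> \<Longrightarrow> t \<in> I \<Longrightarrow>
      ((\<lambda>s. k (\<gamma> s)) has_real_derivative \<zeta> t * Y k (\<xi> t) (\<gamma> t)) (at t within I)" by metis
  \<comment> \<open>The squares of the increments \<open>dk\<close> sum to one
    \<open>sqdist\<close>; the squares of the increments \<open>dY\<close> contribute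
    \<open>C k\<close> times \<open>sqdist\<close> each.\<close>
  define K where "K = 1 + sum C J"
  show thesis
  proof (rule that)
    show "K \<ge> 0" unfolding K_def using C0 by (simp add: sum_nonneg)
    fix a b \<zeta> \<xi> \<gamma> \<delta> Z s t
    assume \<gamma>: "icurve {a..b} \<zeta> \<xi> \<gamma>" and \<delta>: "icurve {a..b} \<zeta> \<xi> \<delta>" and \<xi>: "\<xi> ` {a..b} \<subseteq> {0..1}"
      and Z: "\<And>t. t \<in> {a..b} \<Longrightarrow> \<bar>\<zeta> t\<bar> \<le> Z" and st: "s \<in> {a..b}" "t \<in> {a..b}"
    define dk dY where "dk k t = k (\<gamma> t) - k (\<delta> t)" and "dY k t = Y k (\<xi> t) (\<gamma> t) - Y k (\<xi> t) (\<delta> t)"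
      for k :: "'m \<Rightarrow> real" and t
    show "sqdist J (\<gamma> t) (\<delta> t) \<le> exp (K * Z * \<bar>t - s\<bar>) * sqdist J (\<gamma> s) (\<delta> s)"
    proof (rule gronwall_abs[OF _ _ st, of "\<lambda>t. sqdist J (\<gamma> t) (\<delta> t)" "\<lambda>t. \<Sum>k\<in>J. 2 * dk k t * (\<zeta> t * dY k t)"])
      fix t assume t: "t \<in> {a..b}"
      show "((\<lambda>t. sqdist J (\<gamma> t) (\<delta> t)) has_real_derivative (\<Sum>k\<in>J. 2 * dk k t * (\<zeta> t * dY k t))) (at t within {a..b})"
        unfolding sqdist_def
      proof (rule DERIV_sum)
        fix k assume k: "k \<in> J"
        have "((\<lambda>s. k (\<gamma> s) - k (\<delta> s)) has_real_derivative \<zeta> t * dY k t) (at t within {a..b})"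
          unfolding dY_def right_diff_distrib by (intro DERIV_diff der k \<gamma> \<delta> t)
        from DERIV_power[OF this, of 2]
        show "((\<lambda>s. (k (\<gamma> s) - k (\<delta> s))\<^sup>2) has_real_derivative 2 * dk k t * (\<zeta> t * dY k t)) (at t within {a..b})"
          by (simp add: dk_def algebra_simps)
      qed
      have "\<bar>\<Sum>k\<in>J. 2 * dk k t * (\<zeta> t * dY k t)\<bar> \<le> (\<Sum>k\<in>J. Z * ((dk k t)\<^sup>2 + C k * sqdist J (\<gamma> t) (\<delta> t)))"
      proof (rule order_trans[OF sum_abs], rule sum_mono)
        fix k assume k: "k \<in> J"
        have "2 * \<bar>dk k t\<bar> * \<bar>dY k t\<bar> \<le> (dk k t)\<^sup>2 + (dY k t)\<^sup>2"
          using zero_le_power2[of "\<bar>dk k t\<bar> - \<bar>dY k t\<bar>"] by (simp add: power2_diff)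
        also have "\<dots> \<le> (dk k t)\<^sup>2 + C k * sqdist J (\<gamma> t) (\<delta> t)"
          unfolding dY_def using \<xi> t by (intro add_left_mono C k) blast
        finally have "\<bar>\<zeta> t\<bar> * (2 * \<bar>dk k t\<bar> * \<bar>dY k t\<bar>) \<le> Z * ((dk k t)\<^sup>2 + C k * sqdist J (\<gamma> t) (\<delta> t))"
          using Z[OF t] by (intro mult_mono) auto
        then show "\<bar>2 * dk k t * (\<zeta> t * dY k t)\<bar> \<le> Z * ((dk k t)\<^sup>2 + C k * sqdist J (\<gamma> t) (\<delta> t))"
          by (simp add: abs_mult algebra_simps)
      qed
      also have "\<dots> = Z * (sqdist J (\<gamma> t) (\<delta> t) + sum C J * sqdist J (\<gamma> t) (\<delta> t))"
        by (simp add: sum_distrib_left[symmetric] sum.distrib sum_distrib_right[symmetric] dk_def sqdist_def)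
      also have "\<dots> = K * Z * sqdist J (\<gamma> t) (\<delta> t)" by (simp add: K_def algebra_simps)
      finally show "\<bar>\<Sum>k\<in>J. 2 * dk k t * (\<zeta> t * dY k t)\<bar> \<le> K * Z * sqdist J (\<gamma> t) (\<delta> t)" .
    qed
  qed
qed

text \<open>All flow lines share one bound on their speed in the embedding, since each derivative
  \<open>Y\<close> is bounded on the compact manifold.\<close>

lemma icurve_speed:
  assumes J: "bump_family J"
  obtains M where "M \<ge> 0"
    "\<And>\<gamma> s t. icurve {0..1} (\<lambda>t. 1) (\<lambda>t. t) \<gamma> \<Longrightarrow> s \<in> {0..1} \<Longrightarrow> t \<in> {0..1} \<Longrightarrow>
      sqdist J (\<gamma> s) (\<gamma> t) \<le> M * (s - t)\<^sup>2"
proof -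
  have "\<exists>B. \<forall>\<gamma>. icurve {0..1} (\<lambda>t. 1) (\<lambda>t. t) \<gamma> \<longrightarrow> (\<forall>s\<in>{0..1}. \<forall>t\<in>{0..1}.
      \<bar>k (\<gamma> s) - k (\<gamma> t)\<bar> \<le> B * \<bar>s - t\<bar>)" if k: "k \<in> J" for k
  proof -
    obtain Y where Y: "lip Y"
      "\<And>I \<zeta> \<xi> \<gamma> t. icurve I \<zeta> \<xi> \<gamma> \<Longrightarrow> t \<in> I \<Longrightarrow>
        ((\<lambda>s. k (\<gamma> s)) has_real_derivative \<zeta> t * Y (\<xi> t) (\<gamma> t)) (at t within I)"
      by (rule bump_family_deriv[OF J k]) blast
    obtain B where B: "\<And>t x. t \<in> {0..1} \<Longrightarrow> \<bar>Y t x\<bar> \<le> B" by (rule lip_bounded[OF Y(1)]) blast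
    have "\<bar>k (\<gamma> s) - k (\<gamma> t)\<bar> \<le> B * \<bar>s - t\<bar>"
      if \<gamma>: "icurve {0..1} (\<lambda>t. 1) (\<lambda>t. t) \<gamma>" and st: "s \<in> {0..1}" "t \<in> {0..1}" for \<gamma> s t
      using field_differentiable_bound[of "{0..1}" "\<lambda>s. k (\<gamma> s)" "\<lambda>t. Y t (\<gamma> t)" B, OF _ _ _ st] Y(2)[OF \<gamma>] B
      by simp
    then show ?thesis by blast
  qed
  then obtain B where B: "\<And>k \<gamma> s t. k \<in> J \<Longrightarrow> icurve {0..1} (\<lambda>t. 1) (\<lambda>t. t) \<gamma> \<Longrightarrow> s \<in> {0..1} \<Longrightarrow> t \<in> {0..1} \<Longrightarrow>
      \<bar>k (\<gamma> s) - k (\<gamma> t)\<bar> \<le> B k * \<bar>s - t\<bar>" by metis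
  show thesis
  proof (rule that)
    show "0 \<le> (\<Sum>k\<in>J. (B k)\<^sup>2)" by (simp add: sum_nonneg)
    fix \<gamma> s t assume a: "icurve {0..1} (\<lambda>t. 1) (\<lambda>t. t) \<gamma>" "s \<in> {0..1::real}" "t \<in> {0..1::real}"
    have "sqdist J (\<gamma> s) (\<gamma> t) \<le> (\<Sum>k\<in>J. (B k)\<^sup>2 * (s - t)\<^sup>2)"
      unfolding sqdist_def
    proof (rule sum_mono)
      fix k assume "k \<in> J"
      from B[OF this a] have "\<bar>k (\<gamma> s) - k (\<gamma> t)\<bar> \<le> \<bar>B k * (s - t)\<bar>"
        using mult_right_mono[OF abs_ge_self[of "B k"], of "\<bar>s - t\<bar>"] by (simp add: abs_mult)
      then show "(k (\<gamma> s) - k (\<gamma> t))\<^sup>2 \<le> (B k)\<^sup>2 * (s - t)\<^sup>2"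
        by (simp add: abs_le_square_iff power_mult_distrib)
    qed
    then show "sqdist J (\<gamma> s) (\<gamma> t) \<le> (\<Sum>k\<in>J. (B k)\<^sup>2) * (s - t)\<^sup>2"
      by (simp add: sum_distrib_right)
  qed
qed

lemma icurve_unique:
  assumes \<gamma>: "icurve {a..b} \<zeta> \<xi> \<gamma>" "icurve {a..b} \<zeta> \<xi> \<delta>" "\<xi> ` {a..b} \<subseteq> {0..1}"
    and Z: "\<And>t. t \<in> {a..b} \<Longrightarrow> \<bar>\<zeta> t\<bar> \<le> Z" and st: "s \<in> {a..b}" "t \<in> {a..b}" and eq: "\<gamma> s = \<delta> s"
  shows "\<gamma> t = \<delta> t"
proof -
  obtain J where J: "bump_family J" using ex_bump_family by blast
  obtain K where "\<And>a b \<zeta> \<xi> \<gamma> \<delta> Z s t. icurve {a..b} \<zeta> \<xi> \<gamma> \<Longrightarrow> icurve {a..b} \<zeta> \<xi> \<delta> \<Longrightarrow> \<xi> ` {a..b} \<subseteq> {0..1} \<Longrightarrow>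
      (\<And>t. t \<in> {a..b} \<Longrightarrow> \<bar>\<zeta> t\<bar> \<le> Z) \<Longrightarrow> s \<in> {a..b} \<Longrightarrow> t \<in> {a..b} \<Longrightarrow>
      sqdist J (\<gamma> t) (\<delta> t) \<le> exp (K * Z * \<bar>t - s\<bar>) * sqdist J (\<gamma> s) (\<delta> s)"
    by (rule icurve_gronwall[OF J]) blast
  from this[OF \<gamma> Z st] have "sqdist J (\<gamma> t) (\<delta> t) \<le> 0" by (simp add: eq sqdist_self)
  then have "sqdist J (\<gamma> t) (\<delta> t) = 0" using sqdist_nonneg[of J] by (intro antisym)
  then show ?thesis by (rule bump_family_separates[OF J])
qed

section \<open>Existence of integral curves on the unit interval\<close>

lemma X_lipschitz:
  assumes c: "c \<in> A" "p \<in> cdom c"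
  obtains V L where "open V" "p \<in> V" "V \<subseteq> cdom c" "L \<ge> 0"
    "\<And>x y s t. x \<in> V \<Longrightarrow> y \<in> V \<Longrightarrow> s \<in> {0..1} \<Longrightarrow> t \<in> {0..1} \<Longrightarrow>
      norm (X s c (crd c x) - X t c (crd c y)) \<le> L * (\<bar>s - t\<bar> + norm (crd c x - crd c y))"
proof -
  have "\<exists>W L. open W \<and> p \<in> W \<and> W \<subseteq> cdom c \<and> L \<ge> 0 \<and> lip_on c W L (\<lambda>t x. X t c (crd c x) $ i)" for i
    using loclipE[OF c(1) X_loclip[OF c, of i]] by metis
  then obtain W L where W: "\<And>i. open (W i)" "\<And>i. p \<in> W i" "\<And>i. W i \<subseteq> cdom c" "\<And>i. L i \<ge> 0"
    and L: "\<And>i. lip_on c (W i) (L i) (\<lambda>t x. X t c (crd c x) $ i)" by metis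
  show thesis
  proof (rule that[of "\<Inter>i. W i" "\<Sum>i\<in>UNIV. L i"])
    fix x y s t assume a: "x \<in> (\<Inter>i. W i)" "y \<in> (\<Inter>i. W i)" "s \<in> {0..1::real}" "t \<in> {0..1::real}"
    have "norm (X s c (crd c x) - X t c (crd c y)) \<le> (\<Sum>i\<in>UNIV. \<bar>(X s c (crd c x) - X t c (crd c y)) $ i\<bar>)"
      by (rule norm_le_l1_cart)
    also have "\<dots> \<le> (\<Sum>i\<in>UNIV. L i * (\<bar>s - t\<bar> + norm (crd c x - crd c y)))"
      unfolding vector_minus_component using a by (intro sum_mono lip_onD[OF L]) auto
    finally show "norm (X s c (crd c x) - X t c (crd c y)) \<le> (\<Sum>i\<in>UNIV. L i) * (\<bar>s - t\<bar> + norm (crd c x - crd c y))"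
      by (simp add: sum_distrib_right)
  next
    show "(\<Inter>i. W i) \<subseteq> cdom c" using W(3) by blast
  qed (use W in \<open>auto intro!: open_INT sum_nonneg\<close>)
qed

text \<open>\<open>icurve\<close> demands the equation in every chart the curve meets. The chain
  rule for transition maps and the transformation law of \<open>X\<close> carry it over from the
  chart in which it was solved.\<close>

lemma icurve_from_chart:
  assumes c: "c \<in> A" and zc: "z ` I \<subseteq> crange c" and \<xi>: "\<xi> ` I \<subseteq> {0..1}"
    and z: "\<And>t. t \<in> I \<Longrightarrow> (z has_vector_derivative \<zeta> t *\<^sub>R X (\<xi> t) c (z t)) (at t within I)"
  shows "icurve I \<zeta> \<xi> (\<lambda>t. cinv c (z t))"
  unfolding icurve_def
proof (intro conjI ballI impI)
  have "continuous_on I z"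
    using z by (rule continuous_on_vector_derivative)
  then show "continuous_on I (\<lambda>t. cinv c (z t))"
    by (rule continuous_on_compose2[OF continuous_on_cinv[OF c] _ zc])
  fix t d assume t: "t \<in> I" and d: "d \<in> A" "cinv c (z t) \<in> cdom d"
  let ?p = "cinv c (z t)"
  have p: "?p \<in> cdom c" "crd c ?p = z t" using cinv_in[OF c] crd_cinv[OF c] zc t by auto
  have lin: "linear (trans_deriv c d ?p)"
    using has_derivative_transition[OF c d(1) p(1) d(2)] by (rule has_derivative_linear)
  have "((\<lambda>s. (crd d \<circ> cinv c) (z s)) has_derivative (\<lambda>h. trans_deriv c d ?p (h *\<^sub>R (\<zeta> t *\<^sub>R X (\<xi> t) c (z t)))))
      (at t within I)"
    using z[OF t] has_derivative_transition[OF c d(1) p(1) d(2)] unfolding has_vector_derivative_def p(2)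
    by (rule has_derivative_compose)
  moreover have "X (\<xi> t) d (crd d ?p) = trans_deriv c d ?p (X (\<xi> t) c (z t))"
    using X_transition[OF _ c d(1) p(1) d(2), of "\<xi> t"] \<xi> t p(2) by auto
  ultimately show "((\<lambda>s. crd d (cinv c (z s))) has_vector_derivative \<zeta> t *\<^sub>R X (\<xi> t) d (crd d ?p)) (at t within I)"
    unfolding has_vector_derivative_def by (simp add: linear_cmul[OF lin])
qed

text \<open>The field in a chart is extended to all of space by projecting onto a closed ball, which
  does not increase distances, and to all times by \<open>clamp\<close>. A solution of the extended
  equation that stays in the ball solves the original one. \<open>\<tau>\<close> serves for all
  initial times and all points near \<open>p\<close>.\<close>

lemma ex_icurve_local:
  obtains W \<tau> where "open W" "p \<in> W" "\<tau> > 0"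
    "\<And>x t0. x \<in> W \<Longrightarrow> \<exists>\<gamma>. \<gamma> t0 = x \<and> icurve {t0 - \<tau>..t0 + \<tau>} (\<lambda>t. 1) clamp \<gamma>"
proof -
  obtain c where c: "c \<in> A" "p \<in> cdom c" by (rule chart_at)
  obtain V L where V: "open V" "p \<in> V" "V \<subseteq> cdom c" and L: "L \<ge> 0"
    "\<And>x y s t. x \<in> V \<Longrightarrow> y \<in> V \<Longrightarrow> s \<in> {0..1} \<Longrightarrow> t \<in> {0..1} \<Longrightarrow>
      norm (X s c (crd c x) - X t c (crd c y)) \<le> L * (\<bar>s - t\<bar> + norm (crd c x - crd c y))"
    by (rule X_lipschitz[OF c]) blast
  obtain e where e: "e > 0" "cball (crd c p) e \<subseteq> crd c ` V"
    by (rule crd_ball[OF c(1) V(2,1,3)])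
  define S where "S = cball (crd c p) e"
  have S: "convex S" "closed S" "S \<noteq> {}" using e by (auto simp: S_def)
  have Sc: "S \<subseteq> crange c" using e V by (auto simp: S_def crange_def)
  define f where "f t y = X (clamp t) c (closest_point S y)" for t y
  have X_S: "norm (X s c y - X t c y') \<le> L * (\<bar>s - t\<bar> + norm (y - y'))"
    if S': "y \<in> S" "y' \<in> S" "s \<in> {0..1}" "t \<in> {0..1}" for s t y y'
  proof -
    obtain x x' where "x \<in> V" "x' \<in> V" "y = crd c x" "y' = crd c x'" using S'(1,2) e(2) unfolding S_def by blast
    then show ?thesis using L(2) S' by auto
  qed
  have cp: "closest_point S y \<in> S" for y using S by (intro closest_point_in_set)
  have f_lip: "norm (f s y - f t y') \<le> L * (\<bar>s - t\<bar> + norm (y - y'))" for s t y y'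
  proof -
    have "norm (f s y - f t y') \<le> L * (\<bar>clamp s - clamp t\<bar> + norm (closest_point S y - closest_point S y'))"
      unfolding f_def by (intro X_S cp clamp_in)
    also have "\<dots> \<le> L * (\<bar>s - t\<bar> + norm (y - y'))"
      using closest_point_lipschitz[OF S, of y y'] L(1)
      by (intro mult_left_mono add_mono clamp_lipschitz) (auto simp: dist_norm)
    finally show ?thesis .
  qed
  \<comment> \<open>Compare with time 0 and the centre: clamped times differ by at most 1, points of
    the ball by at most \<open>e\<close>.\<close>
  define B where "B = norm (X 0 c (crd c p)) + L * (1 + e)"
  have B0: "B \<ge> 0" using L(1) e(1) by (simp add: B_def)
  have f_bound: "norm (f t y) \<le> B" for t y
  proof -
    have "norm (f t y - X 0 c (crd c p)) \<le> L * (\<bar>clamp t - 0\<bar> + norm (closest_point S y - crd c p))"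
      unfolding f_def using e by (intro X_S cp clamp_in) (auto simp: S_def)
    also have "\<dots> \<le> L * (1 + e)"
      using clamp_in[of t] cp[of y] L(1)
      by (intro mult_left_mono add_mono) (auto simp: S_def dist_norm norm_minus_commute)
    finally show ?thesis unfolding B_def
      using norm_triangle_ineq2[of "f t y" "X 0 c (crd c p)"] by linarith
  qed
  have f_cont: "continuous_on UNIV (\<lambda>(t, y). f t y)"
  proof (rule lipschitz_on_continuous_on[of "2 * L"], rule lipschitz_onI)
    fix a b :: "real \<times> (real ^ 'd)"
    obtain s :: real and y t y' where ab: "a = (s, y)" "b = (t, y')" by (cases a, cases b)
    have "\<bar>s - t\<bar> \<le> dist a b" "norm (y - y') \<le> dist a b"
      using dist_fst_le[of a b] dist_snd_le[of a b] by (auto simp: ab dist_norm)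
    then have "L * (\<bar>s - t\<bar> + norm (y - y')) \<le> L * (dist a b + dist a b)"
      using L(1) by (intro mult_left_mono add_mono)
    then show "dist (case a of (t, y) \<Rightarrow> f t y) (case b of (t, y) \<Rightarrow> f t y) \<le> 2 * L * dist a b"
      using f_lip[of s y t y'] by (simp add: ab dist_norm)
  qed (use L in simp)
  \<comment> \<open>The first entry makes the Picard operator contract, the second keeps a solution
    that starts within \<open>e / 2\<close> of the centre inside the ball of radius
    \<open>e\<close>. Adding 1 avoids zero denominators.\<close>
  define \<tau> where "\<tau> = min (1 / (6 * (L + 1))) (e / (6 * (B + 1)))"
  have \<tau>: "\<tau> > 0" using L(1) B0 e by (simp add: \<tau>_def)
  have \<tau>L: "6 * L * \<tau> \<le> 1"
  proof -
    have "6 * L * \<tau> \<le> 6 * L * (1 / (6 * (L + 1)))"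
      using L(1) by (intro mult_left_mono) (auto simp: \<tau>_def)
    also have "\<dots> \<le> 1" using L(1) by (simp add: divide_simps)
    finally show ?thesis .
  qed
  have \<tau>B: "3 * \<tau> * B \<le> e / 2"
  proof -
    have "3 * \<tau> * B \<le> 3 * (e / (6 * (B + 1))) * B"
      using B0 by (intro mult_right_mono mult_left_mono) (auto simp: \<tau>_def)
    also have "\<dots> \<le> e / 2" using B0 e by (simp add: divide_simps)
    finally show ?thesis .
  qed
  show thesis
  proof (rule that[of "{q \<in> cdom c. crd c q \<in> ball (crd c p) (e / 2)}" \<tau>])
    show "open {q \<in> cdom c. crd c q \<in> ball (crd c p) (e / 2)}" by (intro open_crd_preimage c open_ball)
    show "p \<in> {q \<in> cdom c. crd c q \<in> ball (crd c p) (e / 2)}" using c e by simp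
    show "\<tau> > 0" by (rule \<tau>)
    fix x t0 assume x: "x \<in> {q \<in> cdom c. crd c q \<in> ball (crd c p) (e / 2)}"
    have lip_y: "norm (f t y - f t y') \<le> L * norm (y - y')" for t y y' using f_lip[of t y t y'] by simp
    obtain z where z0: "z t0 = crd c x"
      and zb: "\<And>t. t \<in> {t0 - \<tau>..t0 + \<tau>} \<Longrightarrow> norm (z t - crd c x) \<le> 3 * \<tau> * B"
      and zd: "\<And>t. t \<in> {t0 - \<tau>..t0 + \<tau>} \<Longrightarrow>
        (z has_vector_derivative f t (z t)) (at t within {t0 - \<tau>..t0 + \<tau>})"
      using picard_lindeloef[OF f_cont lip_y f_bound \<tau> \<tau>L, of t0 "crd c x"] by blast
    have zS: "z t \<in> S" if "t \<in> {t0 - \<tau>..t0 + \<tau>}" for t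
    proof -
      have "dist (crd c x) (z t) \<le> e / 2" using zb[OF that] \<tau>B by (simp add: dist_norm norm_minus_commute)
      moreover have "dist (crd c p) (crd c x) \<le> e / 2" using x by simp
      ultimately show ?thesis
        using dist_triangle[of "crd c p" "z t" "crd c x"] by (simp add: S_def)
    qed
    have "icurve {t0 - \<tau>..t0 + \<tau>} (\<lambda>t. 1) clamp (\<lambda>t. cinv c (z t))"
    proof (rule icurve_from_chart[OF c(1)])
      show "z ` {t0 - \<tau>..t0 + \<tau>} \<subseteq> crange c" using zS Sc by auto
      show "clamp ` {t0 - \<tau>..t0 + \<tau>} \<subseteq> {0..1}" using clamp_in by auto
      show "(z has_vector_derivative 1 *\<^sub>R X (clamp t) c (z t)) (at t within {t0 - \<tau>..t0 + \<tau>})"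
        if "t \<in> {t0 - \<tau>..t0 + \<tau>}" for t
        using zd[OF that] zS[OF that] by (simp add: f_def closest_point_self)
    qed
    then show "\<exists>\<gamma>. \<gamma> t0 = x \<and> icurve {t0 - \<tau>..t0 + \<tau>} (\<lambda>t. 1) clamp \<gamma>"
      using z0 x cinv_crd[OF c(1)] by (intro exI[of _ "\<lambda>t. cinv c (z t)"]) auto
  qed
qed

lemma ex_icurve_uniform:
  obtains \<tau> where "\<tau> > 0"
    "\<And>x t0. \<exists>\<gamma>. \<gamma> t0 = x \<and> icurve {t0 - \<tau>..t0 + \<tau>} (\<lambda>t. 1) clamp \<gamma>"
proof -
  have "\<exists>W \<tau>. open W \<and> p \<in> W \<and> \<tau> > 0 \<and>
    (\<forall>x t0. x \<in> W \<longrightarrow> (\<exists>\<gamma>. \<gamma> t0 = x \<and> icurve {t0 - \<tau>..t0 + \<tau>} (\<lambda>t. 1) clamp \<gamma>))" for p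
    using ex_icurve_local[of p] by metis
  then obtain W T where W: "\<And>p. open (W p)" "\<And>p. p \<in> W p" "\<And>p. T p > 0"
    and T: "\<And>p x t0. x \<in> W p \<Longrightarrow> \<exists>\<gamma>. \<gamma> t0 = x \<and> icurve {t0 - T p..t0 + T p} (\<lambda>t. 1) clamp \<gamma>" by metis
  obtain D where D: "finite D" "UNIV \<subseteq> (\<Union>p\<in>D. W p)"
    by (rule compactE_image[OF compact_UNIV, of UNIV W]) (use W in blast)+
  then have D0: "D \<noteq> {}" by auto
  show thesis
  proof (rule that)
    show "Min (T ` D) > 0" using D D0 W by simp
    fix x t0
    obtain p where p: "p \<in> D" "x \<in> W p" using D by blast
    have "Min (T ` D) \<le> T p" using D p by simp
    then have "{t0 - Min (T ` D)..t0 + Min (T ` D)} \<subseteq> {t0 - T p..t0 + T p}" by auto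
    then show "\<exists>\<gamma>. \<gamma> t0 = x \<and> icurve {t0 - Min (T ` D)..t0 + Min (T ` D)} (\<lambda>t. 1) clamp \<gamma>"
      using T[OF p(2), of t0] icurve_subset by metis
  qed
qed

lemma icurve_concat:
  assumes ab: "a \<le> b" "b \<le> c" and \<gamma>: "icurve {a..b} \<zeta> \<xi> \<gamma>" and \<delta>: "icurve {b..c} \<zeta> \<xi> \<delta>"
    and eq: "\<gamma> b = \<delta> b"
  shows "icurve {a..c} \<zeta> \<xi> (\<lambda>t. if t \<le> b then \<gamma> t else \<delta> t)"
proof -
  let ?\<eta> = "\<lambda>t. if t \<le> b then \<gamma> t else \<delta> t"
  have un: "{a..c} = {a..b} \<union> {b..c}" using ab by auto
  have \<eta>: "?\<eta> t = \<gamma> t" if "t \<in> {a..b}" for t using that by simp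
  have \<eta>': "?\<eta> t = \<delta> t" if "t \<in> {b..c}" for t using that eq by (cases "t = b") auto
  show ?thesis unfolding icurve_def
  proof (intro conjI ballI impI)
    have "continuous_on {a..b} ?\<eta>" using \<gamma> \<eta> by (simp add: icurve_def cong: continuous_on_cong_simp)
    moreover have "continuous_on {b..c} ?\<eta>"
      by (rule continuous_on_eq[of "{b..c}" \<delta>]) (use \<delta> \<eta>' in \<open>simp_all only: icurve_def\<close>)
    ultimately show "continuous_on {a..c} ?\<eta>" unfolding un by (intro continuous_on_closed_Un) auto
    fix t d assume t: "t \<in> {a..c}" and d: "d \<in> A" "?\<eta> t \<in> cdom d"
    let ?v = "\<zeta> t *\<^sub>R X (\<xi> t) d (crd d (?\<eta> t))"
    show "((\<lambda>s. crd d (?\<eta> s)) has_vector_derivative ?v) (at t within {a..c})"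
      unfolding un
    proof (rule has_vector_derivative_Un)
      assume t: "t \<in> {a..b}"
      show "((\<lambda>s. crd d (?\<eta> s)) has_vector_derivative ?v) (at t within {a..b})"
      proof (rule has_vector_derivative_transform[OF t])
        show "((\<lambda>s. crd d (\<gamma> s)) has_vector_derivative ?v) (at t within {a..b})"
          using icurveD[OF \<gamma> t d(1)] d(2) by (simp only: \<eta>[OF t])
      qed (simp only: \<eta>)
    next
      assume t: "t \<in> {b..c}"
      show "((\<lambda>s. crd d (?\<eta> s)) has_vector_derivative ?v) (at t within {b..c})"
      proof (rule has_vector_derivative_transform[OF t])
        show "((\<lambda>s. crd d (\<delta> s)) has_vector_derivative ?v) (at t within {b..c})"
          using icurveD[OF \<delta> t d(1)] d(2) by (simp only: \<eta>'[OF t])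
      qed (simp only: \<eta>')
    qed auto
  qed
qed

text \<open>The length \<open>\<tau>\<close> of local existence does not shrink along the curve, so
  \<open>k\<close> extensions by \<open>\<tau>\<close> at both ends cover [0,1] for large
  \<open>k\<close>. The overshoot is harmless: the field is clamped in time, and on [0,1]
  \<open>clamp\<close> is the identity.\<close>

lemma ex_icurve:
  assumes t0: "t0 \<in> {0..1}"
  shows "\<exists>\<gamma>. \<gamma> t0 = x \<and> icurve {0..1} (\<lambda>t. 1) (\<lambda>t. t) \<gamma>"
proof -
  obtain \<tau> where \<tau>: "\<tau> > 0"
    "\<And>x t0. \<exists>\<gamma>. \<gamma> t0 = x \<and> icurve {t0 - \<tau>..t0 + \<tau>} (\<lambda>t. 1) clamp \<gamma>"
    by (rule ex_icurve_uniform) blast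
  have "\<exists>\<gamma>. \<gamma> t0 = x \<and> icurve {t0 - real k * \<tau>..t0 + real k * \<tau>} (\<lambda>t. 1) clamp \<gamma>" for k
  proof (induction k)
    case 0
    obtain \<gamma> where "\<gamma> t0 = x" "icurve {t0 - \<tau>..t0 + \<tau>} (\<lambda>t. 1) clamp \<gamma>" using \<tau>(2) by blast
    then show ?case using \<tau>(1) by (intro exI[of _ \<gamma>]) (auto intro: icurve_subset)
  next
    case (Suc k)
    define a b where "a = t0 - real k * \<tau>" and "b = t0 + real k * \<tau>"
    have ab: "a \<le> t0" "t0 \<le> b" using \<tau>(1) by (auto simp: a_def b_def)
    have eq: "t0 - real (Suc k) * \<tau> = a - \<tau>" "t0 + real (Suc k) * \<tau> = b + \<tau>"
      by (auto simp: a_def b_def algebra_simps)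
    obtain \<gamma> where \<gamma>: "\<gamma> t0 = x" "icurve {a..b} (\<lambda>t. 1) clamp \<gamma>"
      using Suc unfolding a_def b_def by blast
    obtain \<delta> where \<delta>: "\<delta> b = \<gamma> b" "icurve {b - \<tau>..b + \<tau>} (\<lambda>t. 1) clamp \<delta>" using \<tau>(2) by blast
    obtain \<epsilon> where \<epsilon>: "\<epsilon> a = \<gamma> a" "icurve {a - \<tau>..a + \<tau>} (\<lambda>t. 1) clamp \<epsilon>" using \<tau>(2) by blast
    have \<delta>': "icurve {b..b + \<tau>} (\<lambda>t. 1) clamp \<delta>" using \<delta>(2) by (rule icurve_subset) (use \<tau> in auto)
    have \<epsilon>': "icurve {a - \<tau>..a} (\<lambda>t. 1) clamp \<epsilon>" using \<epsilon>(2) by (rule icurve_subset) (use \<tau> in auto)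
    define \<eta> where "\<eta> = (\<lambda>t. if t \<le> b then \<gamma> t else \<delta> t)"
    have \<eta>: "icurve {a..b + \<tau>} (\<lambda>t. 1) clamp \<eta>" unfolding \<eta>_def
      by (rule icurve_concat[OF _ _ \<gamma>(2) \<delta>']) (use \<tau> ab \<delta> in auto)
    have "icurve {a - \<tau>..b + \<tau>} (\<lambda>t. 1) clamp (\<lambda>t. if t \<le> a then \<epsilon> t else \<eta> t)"
      by (rule icurve_concat[OF _ _ \<epsilon>' \<eta>]) (use \<tau> ab \<epsilon> in \<open>auto simp: \<eta>_def\<close>)
    moreover have "(if t0 \<le> a then \<epsilon> t0 else \<eta> t0) = x"
      using ab \<gamma>(1) \<epsilon>(1) by (auto simp: \<eta>_def)
    ultimately show ?case unfolding eq by (intro exI[of _ "\<lambda>t. if t \<le> a then \<epsilon> t else \<eta> t"]) simp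
  qed
  moreover obtain k where "1 \<le> real k * \<tau>" using reals_Archimedean3[OF \<tau>(1)] less_imp_le by meson
  ultimately obtain \<gamma> where \<gamma>: "\<gamma> t0 = x" "icurve {t0 - real k * \<tau>..t0 + real k * \<tau>} (\<lambda>t. 1) clamp \<gamma>"
    by blast
  have "icurve {0..1} (\<lambda>t. 1) clamp \<gamma>"
    using \<gamma>(2) by (rule icurve_subset) (use t0 \<open>1 \<le> real k * \<tau>\<close> in auto)
  then show ?thesis using \<gamma>(1) clamp_id by (auto simp: icurve_def)
qed

section \<open>The flow between two times\<close>

text \<open>The position at time \<open>s\<close> of the flow line that is at \<open>x\<close> at
  time \<open>s0\<close>. Both times are kept because a reparametrized isotopy starts at
  \<open>\<xi> 0\<close>, which may be any time in [0,1].\<close>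

definition flow :: "real \<Rightarrow> real \<Rightarrow> 'm \<Rightarrow> 'm" where
  "flow s s0 x = (SOME \<gamma>. \<gamma> s0 = x \<and> icurve {0..1} (\<lambda>t. 1) (\<lambda>t. t) \<gamma>) s"

lemma flow_self: "s0 \<in> {0..1} \<Longrightarrow> flow s0 s0 x = x"
  and icurve_flow: "s0 \<in> {0..1} \<Longrightarrow> icurve {0..1} (\<lambda>t. 1) (\<lambda>t. t) (\<lambda>s. flow s s0 x)"
  unfolding flow_def using someI_ex[OF ex_icurve[of s0 x]] by auto

lemma flow_flow:
  assumes "s \<in> {0..1}" "s1 \<in> {0..1}" "s0 \<in> {0..1}"
  shows "flow s s1 (flow s1 s0 x) = flow s s0 x"
  by (rule icurve_unique[OF icurve_flow icurve_flow, of s1 s0 1 s1 s "flow s1 s0 x" x])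
     (use assms in \<open>auto simp: flow_self\<close>)

text \<open>Three increments are added: the explicit time in \<open>f\<close> (\<open>L\<close>),
  the motion along one flow line (\<open>D\<close>), and the change of initial time
  (\<open>E\<close>). For the last, the two flow lines are compared at time \<open>s0\<close> and
  Gronwall's inequality carries the gap to time \<open>t\<close>.\<close>

lemma lip_flow:
  assumes f: "lip f"
  obtains C where "C \<ge> 0" "\<And>s t s0 t0 x. s \<in> {0..1} \<Longrightarrow> t \<in> {0..1} \<Longrightarrow> s0 \<in> {0..1} \<Longrightarrow> t0 \<in> {0..1} \<Longrightarrow>
    \<bar>f s (flow s s0 x) - f t (flow t t0 x)\<bar> \<le> C * (\<bar>s - t\<bar> + \<bar>s0 - t0\<bar>)"
proof -
  obtain J where J: "bump_family J" using ex_bump_family by blast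
  obtain K where K: "K \<ge> 0" "\<And>a b \<zeta> \<xi> \<gamma> \<delta> Z s t. icurve {a..b} \<zeta> \<xi> \<gamma> \<Longrightarrow> icurve {a..b} \<zeta> \<xi> \<delta> \<Longrightarrow> \<xi> ` {a..b} \<subseteq> {0..1} \<Longrightarrow>
      (\<And>t. t \<in> {a..b} \<Longrightarrow> \<bar>\<zeta> t\<bar> \<le> Z) \<Longrightarrow> s \<in> {a..b} \<Longrightarrow> t \<in> {a..b} \<Longrightarrow>
      sqdist J (\<gamma> t) (\<delta> t) \<le> exp (K * Z * \<bar>t - s\<bar>) * sqdist J (\<gamma> s) (\<delta> s)"
    by (rule icurve_gronwall[OF J]) blast
  obtain M where M: "M \<ge> 0" "\<And>\<gamma> s t. icurve {0..1} (\<lambda>t. 1) (\<lambda>t. t) \<gamma> \<Longrightarrow> s \<in> {0..1} \<Longrightarrow> t \<in> {0..1} \<Longrightarrow>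
      sqdist J (\<gamma> s) (\<gamma> t) \<le> M * (s - t)\<^sup>2"
    by (rule icurve_speed[OF J]) blast
  obtain C where C: "C \<ge> 0" "\<And>t x y. t \<in> {0..1} \<Longrightarrow> (f t x - f t y)\<^sup>2 \<le> C * sqdist J x y"
    by (rule lip_sqdist[OF J f]) blast
  obtain L where L: "L \<ge> 0" "\<And>s t x. s \<in> {0..1} \<Longrightarrow> t \<in> {0..1} \<Longrightarrow> \<bar>f s x - f t x\<bar> \<le> L * \<bar>s - t\<bar>"
    using lip_time[OF f] by blast
  define D E where "D = sqrt (C * M)" and "E = sqrt (C * (exp K * M))"
  have sq: "\<bar>f t x - f t y\<bar> \<le> sqrt (C * N) * \<bar>u\<bar>"
    if "t \<in> {0..1}" "sqdist J x y \<le> N * u\<^sup>2" for t x y N u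
  proof -
    have "(f t x - f t y)\<^sup>2 \<le> C * sqdist J x y" by (rule C(2)[OF that(1)])
    also have "\<dots> \<le> C * N * u\<^sup>2" using mult_left_mono[OF that(2) C(1)] by (simp add: mult.assoc)
    finally have "sqrt ((f t x - f t y)\<^sup>2) \<le> sqrt (C * N * u\<^sup>2)" by (rule real_sqrt_le_mono)
    then show ?thesis by (simp add: real_sqrt_mult)
  qed
  show thesis
  proof (rule that)
    show "0 \<le> L + D + E" using C(1) M(1) L(1) by (simp add: D_def E_def)
    fix s t s0 t0 x assume I: "s \<in> {0..1::real}" "t \<in> {0..1::real}" "s0 \<in> {0..1::real}" "t0 \<in> {0..1::real}"
    have 1: "\<bar>f s (flow s s0 x) - f t (flow s s0 x)\<bar> \<le> L * \<bar>s - t\<bar>" using L(2) I by blast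
    have 2: "\<bar>f t (flow s s0 x) - f t (flow t s0 x)\<bar> \<le> D * \<bar>s - t\<bar>"
      unfolding D_def by (rule sq[OF I(2) M(2)[OF icurve_flow[OF I(3)] I(1,2)]])
    have "sqdist J (flow t s0 x) (flow t t0 x) \<le> exp (K * 1 * \<bar>t - s0\<bar>) * sqdist J (flow s0 s0 x) (flow s0 t0 x)"
      by (rule K(2)[OF icurve_flow icurve_flow]) (use I in auto)
    \<comment> \<open>Both \<open>flow s0 s0 x\<close> and \<open>flow t0 t0 x\<close> are
      \<open>x\<close>. Written in the second way, the gap at time \<open>s0\<close> is the
      displacement along a single flow line between the times \<open>t0\<close> and
      \<open>s0\<close>.\<close>
    also have "\<dots> \<le> exp K * sqdist J (flow t0 t0 x) (flow s0 t0 x)"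
      using I K(1) by (intro mult_mono sqdist_nonneg) (auto simp: flow_self mult_left_le)
    also have "\<dots> \<le> exp K * (M * (t0 - s0)\<^sup>2)"
      by (intro mult_left_mono M(2)[OF icurve_flow[OF I(4)] I(4,3)]) simp
    finally have "sqdist J (flow t s0 x) (flow t t0 x) \<le> exp K * M * (s0 - t0)\<^sup>2"
      by (simp add: power2_commute mult.assoc)
    then have 3: "\<bar>f t (flow t s0 x) - f t (flow t t0 x)\<bar> \<le> E * \<bar>s0 - t0\<bar>"
      unfolding E_def by (rule sq[OF I(2)])
    have "0 \<le> L * \<bar>s0 - t0\<bar>" "0 \<le> D * \<bar>s0 - t0\<bar>" "0 \<le> E * \<bar>s - t\<bar>"
      using L(1) C(1) M(1) by (auto simp: D_def E_def)
    then show "\<bar>f s (flow s s0 x) - f t (flow t t0 x)\<bar> \<le> (L + D + E) * (\<bar>s - t\<bar> + \<bar>s0 - t0\<bar>)"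
      using 1 2 3 unfolding distrib_left distrib_right by linarith
  qed
qed

text \<open>The manifold carries a topology only, so continuity is obtained from
  \<open>sqdist_nhd\<close>: the explicit continuous function \<open>R\<close> dominates the squared
  distance to \<open>flow t s0 p\<close> and vanishes at the point in question.\<close>

lemma continuous_on_flow:
  assumes s0: "s0 \<in> {0..1}"
  shows "continuous_on ({0..1} \<times> UNIV) (\<lambda>(s, x). flow s s0 x)"
  unfolding continuous_on_def
proof
  fix z :: "real \<times> 'm" assume z: "z \<in> {0..1} \<times> UNIV"
  obtain t p where tp: "z = (t, p)" "t \<in> {0..1}" using z by auto
  obtain J where J: "bump_family J" using ex_bump_family by blast
  obtain K where K: "\<And>a b \<zeta> \<xi> \<gamma> \<delta> Z s t. icurve {a..b} \<zeta> \<xi> \<gamma> \<Longrightarrow> icurve {a..b} \<zeta> \<xi> \<delta> \<Longrightarrow> \<xi> ` {a..b} \<subseteq> {0..1} \<Longrightarrow>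
      (\<And>t. t \<in> {a..b} \<Longrightarrow> \<bar>\<zeta> t\<bar> \<le> Z) \<Longrightarrow> s \<in> {a..b} \<Longrightarrow> t \<in> {a..b} \<Longrightarrow>
      sqdist J (\<gamma> t) (\<delta> t) \<le> exp (K * Z * \<bar>t - s\<bar>) * sqdist J (\<gamma> s) (\<delta> s)"
    by (rule icurve_gronwall[OF J]) blast
  obtain M where M: "M \<ge> 0" "\<And>\<gamma> s t. icurve {0..1} (\<lambda>t. 1) (\<lambda>t. t) \<gamma> \<Longrightarrow> s \<in> {0..1} \<Longrightarrow> t \<in> {0..1} \<Longrightarrow>
      sqdist J (\<gamma> s) (\<gamma> t) \<le> M * (s - t)\<^sup>2"
    by (rule icurve_speed[OF J]) blast
  let ?F = "at z within {0..1} \<times> UNIV"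
  define R where "R w = 2 * (M * (t - fst w)\<^sup>2) + 2 * (exp (K * 1 * \<bar>fst w - s0\<bar>) * sqdist J p (snd w))"
    for w :: "real \<times> 'm"
  \<comment> \<open>\<open>sqdist\<close> is a squared distance, so its triangle inequality holds
    with a factor 2.\<close>
  have tri: "sqdist J x y \<le> 2 * sqdist J x w + 2 * sqdist J w y" for x y w
    unfolding sqdist_def sum_distrib_left sum.distrib[symmetric]
  proof (rule sum_mono)
    fix k show "(k x - k y)\<^sup>2 \<le> 2 * (k x - k w)\<^sup>2 + 2 * (k w - k y)\<^sup>2" for k :: "'m \<Rightarrow> real"
      using zero_le_power2[of "(k x - k w) - (k w - k y)"] by (simp add: power2_eq_square algebra_simps)
  qed
  have R: "sqdist J (flow t s0 p) (flow (fst w) s0 (snd w)) \<le> R w" if "w \<in> {0..1} \<times> UNIV" for w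
  proof -
    have w: "fst w \<in> {0..1}" using that by auto
    have "sqdist J (flow (fst w) s0 p) (flow (fst w) s0 (snd w))
        \<le> exp (K * 1 * \<bar>fst w - s0\<bar>) * sqdist J (flow s0 s0 p) (flow s0 s0 (snd w))"
      by (rule K[OF icurve_flow icurve_flow]) (use s0 w in auto)
    then show ?thesis
      using tri[of "flow t s0 p" "flow (fst w) s0 (snd w)" "flow (fst w) s0 p"]
        M(2)[OF icurve_flow[OF s0] tp(2) w, of p]
      by (simp add: R_def flow_self[OF s0])
  qed
  have cont: "continuous_on UNIV R" unfolding R_def
    by (intro continuous_intros continuous_on_sqdist[OF J])
  then have "(R \<longlongrightarrow> R z) ?F"
    unfolding continuous_on_def by (blast intro: Lim_at_imp_Lim_at_within)
  then have lim: "(R \<longlongrightarrow> 0) ?F" by (simp add: R_def tp sqdist_self)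
  show "((\<lambda>(s, x). flow s s0 x) \<longlongrightarrow> (case z of (s, x) \<Rightarrow> flow s s0 x)) ?F"
  proof (rule topological_tendstoI)
    fix W assume W: "open W" "(case z of (s, x) \<Rightarrow> flow s s0 x) \<in> W"
    then obtain e where e: "e > 0" "\<And>q. sqdist J (flow t s0 p) q < e \<Longrightarrow> q \<in> W"
      using sqdist_nhd[OF J W(1), of "flow t s0 p"] by (auto simp: tp)
    have "eventually (\<lambda>w. R w < e) ?F" using order_tendstoD(2)[OF lim e(1)] .
    moreover have "eventually (\<lambda>w. w \<in> {0..1} \<times> UNIV) ?F" by (simp add: eventually_at_filter)
    ultimately show "eventually (\<lambda>w. (case w of (s, x) \<Rightarrow> flow s s0 x) \<in> W) ?F"
      by eventually_elim (use R e(2) in \<open>fastforce simp: case_prod_beta\<close>)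
  qed
qed

lemma icurve_reparam:
  assumes \<xi>: "\<xi> ` {0..1} \<subseteq> {0..1}" and s0: "s0 \<in> {0..1}"
    and der: "\<And>t. t \<in> {0..1} \<Longrightarrow> (\<xi> has_vector_derivative \<zeta> t) (at t within {0..1})"
  shows "icurve {0..1} \<zeta> \<xi> (\<lambda>t. flow (\<xi> t) s0 x)"
  unfolding icurve_def
proof (intro conjI ballI impI)
  note fl = icurve_flow[OF s0, of x]
  have "continuous_on {0..1} \<xi>"
    using der by (rule continuous_on_vector_derivative)
  then show "continuous_on {0..1} (\<lambda>t. flow (\<xi> t) s0 x)"
    using fl \<xi> unfolding icurve_def by (auto intro: continuous_on_compose2)
  fix t c assume t: "t \<in> {0..1::real}" and c: "c \<in> A" "flow (\<xi> t) s0 x \<in> cdom c"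
  have \<xi>t: "\<xi> t \<in> {0..1}" using \<xi> t by blast
  have "((\<lambda>s. crd c (flow s s0 x)) has_vector_derivative X (\<xi> t) c (crd c (flow (\<xi> t) s0 x))) (at (\<xi> t) within \<xi> ` {0..1})"
    using icurveD[OF fl \<xi>t c] \<xi> by (simp add: has_vector_derivative_within_subset)
  from vector_diff_chain_within[OF der[OF t] this]
  show "((\<lambda>t. crd c (flow (\<xi> t) s0 x)) has_vector_derivative \<zeta> t *\<^sub>R X (\<xi> t) c (crd c (flow (\<xi> t) s0 x))) (at t within {0..1})"
    by (simp add: o_def)
qed

end

section \<open>The vector field of a generator\<close>

lemma linear_eq_on_axes:
  fixes f f' :: "real ^ 'd::finite \<Rightarrow> real"
  assumes "linear f" "linear f'" "\<And>i. f (axis i 1) = f' (axis i 1)"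
  shows "f = f'"
proof (rule linear_eq_stdbasis[OF assms(1,2)])
  fix b :: "real ^ 'd" assume "b \<in> Basis"
  then show "f b = f' b" using assms(3) by (auto simp: Basis_vec_def)
qed

lemma linear_axis_expansion:
  fixes f :: "real ^ 'd::finite \<Rightarrow> real"
  assumes "linear f"
  shows "f v = (\<Sum>i\<in>UNIV. v $ i * f (axis i 1))"
proof -
  have "f = (\<lambda>v. \<Sum>i\<in>UNIV. v $ i * f (axis i 1))"
  proof (rule linear_eq_on_axes[OF assms])
    show "linear (\<lambda>v. \<Sum>i\<in>UNIV. v $ i * f (axis i 1))"
      by (rule linearI) (auto simp: algebra_simps sum.distrib sum_distrib_left)
    fix i
    have "(\<Sum>j\<in>UNIV. (axis i 1 :: real ^ 'd) $ j * f (axis j 1)) = (\<Sum>j\<in>UNIV. if j = i then f (axis j 1) else 0)"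
      by (intro sum.cong) (auto simp: axis_def)
    then show "f (axis i 1) = (\<Sum>j\<in>UNIV. (axis i 1 :: real ^ 'd) $ j * f (axis j 1))" by simp
  qed
  then show ?thesis by meson
qed

text \<open>Row and column are exchanged relative to the arguments of \<omega>, so that applying the
  matrix to \<open>v\<close> lists the numbers \<omega>(v, e_j).\<close>

definition form_matrix :: "('m, 'd::finite) form2 \<Rightarrow> ('m, 'd) chart \<Rightarrow> real ^ 'd \<Rightarrow> real ^ 'd ^ 'd" where
  "form_matrix \<omega> c y = (\<chi> j i. \<omega> c y (axis i 1) (axis j 1))"

lemma form_matrix_mult:
  assumes "bilinear (\<omega> c y)"
  shows "(form_matrix \<omega> c y *v v) $ j = \<omega> c y v (axis j 1)"
proof -
  have "linear (\<lambda>v. \<omega> c y v (axis j 1))" using assms by (simp add: bilinear_def)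
  from linear_axis_expansion[OF this, of v] show ?thesis
    by (simp add: form_matrix_def matrix_vector_mult_def mult.commute)
qed

context compact_manifold
begin

lemma loclip_prod:
  assumes "c \<in> A" "p \<in> cdom c" "\<And>i. i \<in> I \<Longrightarrow> loclip c p (f i)"
  shows "loclip c p (\<lambda>t x. \<Prod>i\<in>I. f i t x)"
  using assms(3)
  by (induction I rule: infinite_finite_induct) (auto intro: loclip_const loclip_mult assms(1,2))

lemma loclip_det:
  fixes M :: "real \<Rightarrow> 'm \<Rightarrow> real ^ 'k::finite ^ 'k"
  assumes c: "c \<in> A" "p \<in> cdom c" and M: "\<And>i j. loclip c p (\<lambda>t x. M t x $ i $ j)"
  shows "loclip c p (\<lambda>t x. det (M t x))"
  unfolding det_def by (intro loclip_sum loclip_mult loclip_prod loclip_const c M)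

lemma loclip_inverse:
  assumes c: "c \<in> A" "p \<in> cdom c" and f: "loclip c p (\<lambda>t. f)" and fp: "f p \<noteq> 0"
  shows "loclip c p (\<lambda>t x. inverse (f x))"
proof -
  from loclipE[OF c(1) f] obtain W L where W: "open W" "p \<in> W" "W \<subseteq> cdom c" "L \<ge> 0"
    and L: "lip_on c W L (\<lambda>t. f)" by metis
  \<comment> \<open>Near \<open>p\<close> the function keeps at least half of its absolute value:
    over coordinate distance \<open>e\<close> it changes by at most \<open>L * e\<close>, hence by
    at most \<open>m\<close>. The 1 in the denominator allows \<open>L = 0\<close>.\<close>
  define m e where "m = \<bar>f p\<bar> / 2" and "e = m / (L + 1)"
  have m: "m > 0" "e > 0" using fp W(4) by (auto simp: m_def e_def)
  have diff: "\<bar>f x - f y\<bar> \<le> L * norm (crd c x - crd c y)" if "x \<in> W" "y \<in> W" for x y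
    using lip_onD[OF L that, of 0 0] by simp
  define V where "V = W \<inter> {q \<in> cdom c. crd c q \<in> ball (crd c p) e}"
  have low: "m \<le> \<bar>f x\<bar>" if "x \<in> V" for x
  proof -
    have "\<bar>f x - f p\<bar> \<le> L * norm (crd c x - crd c p)" using that W by (intro diff) (auto simp: V_def)
    also have "\<dots> \<le> L * e"
      using that W(4) by (intro mult_left_mono) (auto simp: V_def dist_norm norm_minus_commute)
    also have "\<dots> \<le> m" using W(4) m by (simp add: e_def divide_simps algebra_simps)
    finally show ?thesis unfolding m_def by linarith
  qed
  show ?thesis
  proof (rule loclipI[of V _ _ _ "L / m\<^sup>2"])
    show "open V" unfolding V_def by (intro open_Int W open_crd_preimage c open_ball)
    show "p \<in> V" "V \<subseteq> cdom c" using W c m by (auto simp: V_def)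
    fix x y s t assume xy: "x \<in> V" "y \<in> V"
    have nz: "f x \<noteq> 0" "f y \<noteq> 0" using low[OF xy(1)] low[OF xy(2)] m by auto
    have "inverse (f x) - inverse (f y) = - ((f x - f y) / (f x * f y))"
      using nz by (simp add: field_simps)
    then have "\<bar>inverse (f x) - inverse (f y)\<bar> = \<bar>f x - f y\<bar> / (\<bar>f x\<bar> * \<bar>f y\<bar>)"
      by (simp add: abs_mult)
    also have "\<dots> \<le> (L * norm (crd c x - crd c y)) / (m * m)"
      using low[OF xy(1)] low[OF xy(2)] m xy W(4)
      by (intro frac_le mult_mono diff) (auto simp: V_def)
    also have "\<dots> \<le> L / m\<^sup>2 * (\<bar>s - t\<bar> + norm (crd c x - crd c y))"
      using W(4) m by (simp add: power2_eq_square divide_simps algebra_simps)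
    finally show "\<bar>inverse (f x) - inverse (f y)\<bar> \<le> L / m\<^sup>2 * (\<bar>s - t\<bar> + norm (crd c x - crd c y))" .
  qed
qed

lemma one_form_loclip:
  assumes "one_form A \<alpha>" "c \<in> A" "p \<in> cdom c"
  shows "loclip c p (\<lambda>t x. \<alpha> c (crd c x) v)"
  using assms loclip_Ck_space[of c p "\<lambda>y. \<alpha> c y v"] unfolding one_form_def smooth_on_def by blast

lemma two_tensor_loclip:
  assumes "two_tensor A \<beta>" "c \<in> A" "p \<in> cdom c"
  shows "loclip c p (\<lambda>t x. \<beta> c (crd c x) v w)"
  using assms loclip_Ck_space[of c p "\<lambda>y. \<beta> c y v w"] unfolding two_tensor_def smooth_on_def by blast

lemma d0_transition:
  assumes c: "c \<in> A" "d \<in> A" "p \<in> cdom c" "p \<in> cdom d"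
    and f: "((f \<circ> cinv d) has_derivative d0 f d (crd d p)) (at (crd d p))"
  shows "d0 f c (crd c p) v = d0 f d (crd d p) (trans_deriv c d p v)"
proof -
  let ?y = "crd c p"
  have *: "(crd d \<circ> cinv c) ?y = crd d p" using cinv_crd[OF c(1,3)] by simp
  have "((\<lambda>y. (f \<circ> cinv d) ((crd d \<circ> cinv c) y)) has_derivative (\<lambda>v. d0 f d (crd d p) (trans_deriv c d p v))) (at ?y)"
    by (rule has_derivative_compose[OF has_derivative_transition[OF c]]) (use f in \<open>simp only: *\<close>)
  moreover have "open (crd c ` (cdom c \<inter> cdom d))"
    using c by (intro open_crd_image open_Int open_cdom) auto
  moreover have "?y \<in> crd c ` (cdom c \<inter> cdom d)" using c by blast
  ultimately have "((f \<circ> cinv c) has_derivative (\<lambda>v. d0 f d (crd d p) (trans_deriv c d p v))) (at ?y)"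
    by (rule has_derivative_transform_within_open) (auto simp: cinv_crd c)
  from frechet_derivative_at[OF this] show ?thesis
    unfolding d0_def by (metis)
qed

end

section \<open>The Hamiltonian vector field in coordinates\<close>

text \<open>\<open>H\<close> enters as a finite combination of fixed 1-forms \<open>h i\<close> with
  coefficients \<open>l i\<close> that are smooth in time. This separates time from space and yields
  joint Lipschitz regularity from that of the factors.\<close>

locale symplectic_generator = compact_manifold A
  for A :: "('m::t2_space, 'd::finite) chart set" +
  fixes \<omega> :: "('m, 'd) form2" and U :: "real \<Rightarrow> 'm \<Rightarrow> real" and H :: "real \<Rightarrow> ('m, 'd) form1"
    and b :: nat and h :: "nat \<Rightarrow> ('m, 'd) form1" and l :: "nat \<Rightarrow> real \<Rightarrow> real"
  assumes symplectic: "symplectic_form A \<omega>"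
    and U_smooth: "\<And>c. c \<in> A \<Longrightarrow> smooth_on ({0..1} \<times> crange c) (\<lambda>(t, y). U t (cinv c y))"
    and H_form: "\<And>t. t \<in> {0..1} \<Longrightarrow> one_form A (H t)"
    and h_form: "\<And>i. i < b \<Longrightarrow> one_form A (h i)"
    and l_smooth: "\<And>i. i < b \<Longrightarrow> smooth_on {0..1} (l i)"
    and H_eq: "\<And>t c y v. t \<in> {0..1} \<Longrightarrow> c \<in> A \<Longrightarrow> y \<in> crange c \<Longrightarrow>
      H t c y v = (\<Sum>i<b. l i t * h i c y v)"
begin

lemma bilinear_\<omega>: "c \<in> A \<Longrightarrow> y \<in> crange c \<Longrightarrow> bilinear (\<omega> c y)"
  and \<omega>_transition: "c \<in> A \<Longrightarrow> d \<in> A \<Longrightarrow> p \<in> cdom c \<Longrightarrow> p \<in> cdom d \<Longrightarrow>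
    \<omega> c (crd c p) v w = \<omega> d (crd d p) (trans_deriv c d p v) (trans_deriv c d p w)"
  and \<omega>_nondegenerate: "c \<in> A \<Longrightarrow> y \<in> crange c \<Longrightarrow> (\<And>w. \<omega> c y v w = 0) \<Longrightarrow> v = 0"
  using symplectic unfolding symplectic_form_def two_tensor_def by blast+

lemma \<omega>_inject:
  assumes "c \<in> A" "y \<in> crange c" "\<And>w. \<omega> c y v w = \<omega> c y v' w"
  shows "v = v'"
proof -
  have "\<omega> c y (v - v') w = 0" for w
    using assms(3)[of w] bilinear_lsub[OF bilinear_\<omega>[OF assms(1,2)], of v v' w] by simp
  then show ?thesis using \<omega>_nondegenerate[OF assms(1,2), of "v - v'"] by simp
qed

definition field_form :: "real \<Rightarrow> ('m, 'd) form1" where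
  "field_form t c y v = d0 (U t) c y v + H t c y v"

text \<open>Cramer's rule for the coordinates of the solution \<open>X\<close> of \<open>\<iota>(X) \<omega> = dU\<^sub>t + H\<^sub>t\<close>.\<close>

definition ham_field :: "real \<Rightarrow> ('m, 'd) vfield" where
  "ham_field t c y = (\<chi> k. det (\<chi> i j. if j = k then field_form t c y (axis i 1)
      else form_matrix \<omega> c y $ i $ j) / det (form_matrix \<omega> c y))"

lemma det_form_matrix:
  assumes "c \<in> A" "y \<in> crange c"
  shows "det (form_matrix \<omega> c y) \<noteq> 0"
proof -
  have "v = 0" if "form_matrix \<omega> c y *v v = 0" for v
  proof (rule \<omega>_nondegenerate[OF assms])
    note bi = bilinear_\<omega>[OF assms]
    have "(\<lambda>w. \<omega> c y v w) = (\<lambda>w. 0)"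
      using form_matrix_mult[of \<omega> c y v, OF bi] that bi
      by (intro linear_eq_on_axes) (auto simp: bilinear_def linear_iff)
    then show "\<omega> c y v w = 0" for w by meson
  qed
  then show ?thesis
    using matrix_left_invertible_ker[of "form_matrix \<omega> c y"] by (auto simp: invertible_left_inverse invertible_det_nz[symmetric])
qed

text \<open>\<open>U\<close> is differentiable jointly within
  \<open>{0..1} \<times> crange c\<close>. Restricting that derivative to the slice at time
  \<open>t\<close>, which is open in the space variable, gives the differential of
  \<open>U t\<close> at the end points of the interval as well. The second formula exhibits it as a
  function to which \<open>loclip_Ck\<close> applies.\<close>

lemma d0_U:
  assumes t: "t \<in> {0..1}" and c: "c \<in> A" and y: "y \<in> crange c"
  shows "((U t \<circ> cinv c) has_derivative d0 (U t) c y) (at y)"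
    and "d0 (U t) c y v = frechet_derivative (\<lambda>(t, y). U t (cinv c y)) (at (t, y) within {0..1} \<times> crange c) (0, v)"
proof -
  let ?V = "\<lambda>(t, y). U t (cinv c y)" and ?T = "{0..1} \<times> crange c"
  have "Ck_on (Suc 0) ?T ?V" using U_smooth[OF c] by (simp add: smooth_on_def)
  then have "(?V has_derivative frechet_derivative ?V (at (t, y) within ?T)) (at (t, y) within ?T)"
    by (rule Ck_on_differentiable) (use t y in simp)
  then have V: "(?V has_derivative frechet_derivative ?V (at (t, y) within ?T))
      (at (t, y) within (\<lambda>y. (t, y)) ` crange c)"
    by (rule has_derivative_subset) (use t in auto)
  have P: "((\<lambda>y. (t, y)) has_derivative (\<lambda>v. (0, v))) (at y within crange c)"
    by (auto intro!: derivative_eq_intros)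
  have "((?V \<circ> (\<lambda>y. (t, y))) has_derivative
      (frechet_derivative ?V (at (t, y) within ?T) \<circ> (\<lambda>v. (0, v)))) (at y within crange c)"
    by (rule diff_chain_within[OF P V])
  then have D: "((U t \<circ> cinv c) has_derivative
      (\<lambda>v. frechet_derivative ?V (at (t, y) within ?T) (0, v))) (at y)"
    unfolding o_def at_within_open[OF y open_crange[OF c]] by simp
  from frechet_derivative_at[OF this]
  have eq: "d0 (U t) c y = (\<lambda>v. frechet_derivative ?V (at (t, y) within ?T) (0, v))"
    by (simp add: d0_def fun_eq_iff)
  show "((U t \<circ> cinv c) has_derivative d0 (U t) c y) (at y)" unfolding eq by (rule D)
  show "d0 (U t) c y v = frechet_derivative ?V (at (t, y) within ?T) (0, v)" by (simp add: eq)
qed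

lemma linear_field_form:
  assumes "t \<in> {0..1}" "c \<in> A" "y \<in> crange c"
  shows "linear (field_form t c y)"
proof -
  have "linear (H t c y)" using H_form[OF assms(1)] assms unfolding one_form_def by blast
  then show ?thesis
    using has_derivative_linear[OF d0_U(1)[OF assms]] unfolding field_form_def by (rule linear_compose_add[rotated])
qed

lemma ham_field_eq:
  assumes "t \<in> {0..1}" "c \<in> A" "y \<in> crange c"
  shows "\<omega> c y (ham_field t c y) w = field_form t c y w"
proof -
  note bi = bilinear_\<omega>[OF assms(2,3)]
  have "form_matrix \<omega> c y *v ham_field t c y = (\<chi> j. field_form t c y (axis j 1))"
    using cramer[OF det_form_matrix[OF assms(2,3)], of "ham_field t c y" "\<chi> j. field_form t c y (axis j 1)"]
    unfolding ham_field_def vec_lambda_beta by blast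
  then have "\<omega> c y (ham_field t c y) (axis j 1) = field_form t c y (axis j 1)" for j
    using form_matrix_mult[of \<omega> c y "ham_field t c y" j, OF bi] by simp
  then have "\<omega> c y (ham_field t c y) = field_form t c y"
    using bi by (intro linear_eq_on_axes linear_field_form assms) (auto simp: bilinear_def)
  then show ?thesis by simp
qed

lemma loclip_U:
  assumes "c \<in> A" "p \<in> cdom c"
  shows "loclip c p U"
  by (rule loclip_cong[OF assms(1) loclip_Ck[OF assms, of "\<lambda>(t, y). U t (cinv c y)"] open_cdom[OF assms(1)] assms(2)])
     (use U_smooth[OF assms(1)] cinv_crd[OF assms(1)] in \<open>auto simp: smooth_on_def\<close>)

lemma lip_U: "lip U"
  unfolding lip_def using loclip_U chart_at by metis

lemma loclip_field_form:
  assumes c: "c \<in> A" "p \<in> cdom c"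
  shows "loclip c p (\<lambda>t x. field_form t c (crd c x) v)"
proof -
  let ?V = "\<lambda>(t, y). U t (cinv c y)" and ?T = "{0..1} \<times> crange c"
  \<comment> \<open>One derivative is spent on the differential of \<open>U\<close>, the other on
    its Lipschitz bound.\<close>
  have "Ck_on (Suc (Suc 0)) ?T ?V" using U_smooth[OF c(1)] unfolding smooth_on_def by blast
  then have Ck: "Ck_on (Suc 0) ?T (\<lambda>z. frechet_derivative ?V (at z within ?T) (0, v))"
    unfolding Ck_on.simps(2)[of "Suc 0"] by blast
  have 1: "loclip c p (\<lambda>t x. d0 (U t) c (crd c x) v)"
    by (rule loclip_cong[OF c(1) loclip_Ck[OF c Ck] open_cdom[OF c(1)] c(2)])
       (simp add: d0_U(2)[OF _ c(1) crd_in[OF c(1)]])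
  have 2: "loclip c p (\<lambda>t x. \<Sum>i<b. l i t * h i c (crd c x) v)"
    using l_smooth h_form
    by (intro loclip_sum loclip_mult c loclip_Ck_time one_form_loclip) (auto simp: smooth_on_def simp del: Ck_on.simps)
  have "loclip c p (\<lambda>t x. d0 (U t) c (crd c x) v + (\<Sum>i<b. l i t * h i c (crd c x) v))"
    by (rule loclip_add[OF c(1) 1 2])
  then show ?thesis
    by (rule loclip_cong[OF c(1) _ open_cdom[OF c(1)] c(2)])
       (simp add: field_form_def H_eq c crd_in)
qed

text \<open>The field is characterized by the equation \<iota>(X)\<omega> = dU + H, whose two sides
  transform as forms. Nondegeneracy makes the derivative of the transition map injective, hence
  surjective, so testing against transported vectors is enough.\<close>

lemma ham_field_transition:
  assumes t: "t \<in> {0..1}" and c: "c \<in> A" "d \<in> A" "p \<in> cdom c" "p \<in> cdom d"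
  shows "ham_field t d (crd d p) = trans_deriv c d p (ham_field t c (crd c p))"
proof -
  let ?T = "trans_deriv c d p"
  note cp = crd_in[OF c(1,3)] and dp = crd_in[OF c(2,4)]
  have lin: "linear ?T" by (rule has_derivative_linear[OF has_derivative_transition[OF c]])
  have "inj ?T"
    unfolding linear_injective_0[OF lin]
  proof (intro allI impI)
    fix u assume "?T u = 0"
    then have "\<omega> c (crd c p) u w = 0" for w
      using \<omega>_transition[OF c, of u w] bilinear_lzero[OF bilinear_\<omega>[OF c(2) dp]] by simp
    then show "u = 0" by (rule \<omega>_nondegenerate[OF c(1) cp])
  qed
  then have surj: "surj ?T" using linear_injective_imp_surjective[OF lin] by blast
  show ?thesis
  proof (rule \<omega>_inject[OF c(2) dp])
    fix w
    obtain u where u: "w = ?T u" using surj by (metis surjD)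
    have "H t c (crd c p) u = H t d (crd d p) (?T u)"
      using H_form[OF t] c unfolding one_form_def by blast
    moreover have "d0 (U t) c (crd c p) u = d0 (U t) d (crd d p) (?T u)"
      by (rule d0_transition[OF c d0_U(1)[OF t c(2) dp]])
    ultimately have "field_form t d (crd d p) w = field_form t c (crd c p) u"
      by (simp add: field_form_def u)
    then show "\<omega> d (crd d p) (ham_field t d (crd d p)) w = \<omega> d (crd d p) (?T (ham_field t c (crd c p))) w"
      using ham_field_eq[OF t c(2) dp] ham_field_eq[OF t c(1) cp] \<omega>_transition[OF c] by (simp add: u)
  qed
qed

text \<open>The reason for Cramer's rule: a quotient of determinants arises from the matrix entries
  by sums, products and one inverse, all of which preserve \<open>loclip\<close>, and nondegeneracy
  keeps the denominator away from 0.\<close>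

lemma loclip_ham_field:
  assumes c: "c \<in> A" "p \<in> cdom c"
  shows "loclip c p (\<lambda>t x. ham_field t c (crd c x) $ k)"
proof -
  have tt: "two_tensor A \<omega>" using symplectic by (simp add: symplectic_form_def)
  have M: "loclip c p (\<lambda>t x. form_matrix \<omega> c (crd c x) $ i $ j)" for i j
    by (simp add: form_matrix_def two_tensor_loclip[OF tt c])
  have N: "loclip c p (\<lambda>t x. (\<chi> i j. if j = k then field_form t c (crd c x) (axis i 1)
      else form_matrix \<omega> c (crd c x) $ i $ j) $ i $ j)" for i j
    by (cases "j = k") (simp_all add: loclip_field_form[OF c] M)
  show ?thesis
    unfolding ham_field_def divide_inverse vec_lambda_beta
    by (intro loclip_mult loclip_det loclip_inverse c M N det_form_matrix crd_in)
qed

sublocale manifold_field A ham_field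
  using ham_field_transition loclip_ham_field by unfold_locales

end

section \<open>Reparametrized generators\<close>

abbreviation speed :: "(real \<Rightarrow> real) \<Rightarrow> real \<Rightarrow> real" where
  "speed \<xi> t \<equiv> vector_derivative \<xi> (at t within {0..1})"

definition parameter_change :: "(real \<Rightarrow> real) \<Rightarrow> bool" where
  "parameter_change \<xi> \<longleftrightarrow> smooth_on {0..1} \<xi> \<and> \<xi> ` {0..1} \<subseteq> {0..1}"

lemma parameter_change_in: "parameter_change \<xi> \<Longrightarrow> t \<in> {0..1} \<Longrightarrow> \<xi> t \<in> {0..1}"
  unfolding parameter_change_def by blast

lemma has_vector_derivative_speed:
  assumes "smooth_on {0..1} \<xi>" "t \<in> {0..1}"
  shows "(\<xi> has_vector_derivative speed \<xi> t) (at t within {0..1})"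
proof -
  have "\<xi> differentiable (at t within {0..1})"
    using assms unfolding smooth_on_def differentiable_on_def by (metis Ck_on.simps(2) differentiable_on_def)
  then show ?thesis by (simp add: vector_derivative_works)
qed

lemma continuous_on_speed:
  assumes "smooth_on {0..1} \<xi>"
  shows "continuous_on {0..1} (speed \<xi>)"
proof -
  have Ck: "Ck_on (Suc 0) {0..1} \<xi>" using assms by (simp only: smooth_on_def)
  have "frechet_derivative \<xi> (at t within {0..1}) 1 = speed \<xi> t" if t: "t \<in> {0..1}" for t
  proof -
    let ?D = "frechet_derivative \<xi> (at t within {0..1})"
    have D: "(\<xi> has_derivative ?D) (at t within {0..1})" by (rule Ck_on_differentiable[OF Ck t])
    have "?D = (\<lambda>x. x *\<^sub>R ?D 1)"
    proof
      fix x
      show "?D x = x *\<^sub>R ?D 1"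
        using linear_cmul[OF has_derivative_linear[OF D], of x 1] by (simp only: real_scaleR_def mult_1_right)
    qed
    then have "(\<xi> has_vector_derivative ?D 1) (at t within {0..1})"
      using D unfolding has_vector_derivative_def by metis
    then show ?thesis using t by (simp add: vector_derivative_within_closed_interval)
  qed
  moreover have "continuous_on {0..1} (\<lambda>t. frechet_derivative \<xi> (at t within {0..1}) 1)"
    using Ck by simp
  ultimately show ?thesis by (rule continuous_on_eq[rotated])
qed

lemma speed_nonneg:
  assumes \<xi>: "smooth_on {0..1} \<xi>" "mono_on {0..1} \<xi>" and t: "t \<in> {0..1}"
  shows "0 \<le> speed \<xi> t"
proof -
  have "((\<lambda>s. (\<xi> s - \<xi> t) / (s - t)) \<longlongrightarrow> speed \<xi> t) (at t within {0..1})"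
    using has_vector_derivative_speed[OF \<xi>(1) t]
    unfolding has_real_derivative_iff_has_vector_derivative[symmetric] has_field_derivative_iff .
  moreover have "eventually (\<lambda>s. 0 \<le> (\<xi> s - \<xi> t) / (s - t)) (at t within {0..1})"
  proof -
    have "0 \<le> (\<xi> s - \<xi> t) / (s - t)" if "s \<in> {0..1}" for s
      using mono_onD[OF \<xi>(2), of s t] mono_onD[OF \<xi>(2), of t s] that t
      by (cases "s \<le> t") (auto simp: zero_le_divide_iff)
    then show ?thesis by (simp add: eventually_at_filter)
  qed
  moreover have "at t within {0..1} \<noteq> bot"
    using t by (simp add: trivial_limit_within islimpt_Icc)
  ultimately show ?thesis by (rule tendsto_lowerbound)
qed

text \<open>The derivative of a monotone function has one sign, so the fundamental theorem evaluates
  the integral as the distance between two numbers in [0,1].\<close>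

lemma integral_abs_speed_le:
  assumes \<xi>: "smooth_on {0..1} \<xi>" "\<xi> ` {0..1} \<subseteq> {0..1}" and mono: "mono_on {0..1} \<xi> \<or> antimono_on {0..1} \<xi>"
  shows "integral {0..1} (\<lambda>t. \<bar>speed \<xi> t\<bar>) \<le> 1"
proof -
  have ftc: "(speed \<xi> has_integral (\<xi> 1 - \<xi> 0)) {0..1}"
    by (rule fundamental_theorem_of_calculus) (use has_vector_derivative_speed[OF \<xi>(1)] in auto)
  have "\<xi> 0 \<in> {0..1}" "\<xi> 1 \<in> {0..1}" using \<xi>(2) by (auto simp: image_subset_iff)
  then have *: "\<bar>\<xi> 1 - \<xi> 0\<bar> \<le> 1" by auto
  show ?thesis using mono
  proof
    assume "mono_on {0..1} \<xi>"
    then have "((\<lambda>t. \<bar>speed \<xi> t\<bar>) has_integral (\<xi> 1 - \<xi> 0)) {0..1}"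
      using ftc by (subst has_integral_cong[where g = "speed \<xi>"]) (auto simp: speed_nonneg[OF \<xi>(1)])
    then show ?thesis using * by (simp add: integral_unique)
  next
    assume anti: "antimono_on {0..1} \<xi>"
    have "speed \<xi> t \<le> 0" if t: "t \<in> {0..1}" for t
    proof -
      have "((\<lambda>s. (\<xi> s - \<xi> t) / (s - t)) \<longlongrightarrow> speed \<xi> t) (at t within {0..1})"
        using has_vector_derivative_speed[OF \<xi>(1) t]
        unfolding has_real_derivative_iff_has_vector_derivative[symmetric] has_field_derivative_iff .
      moreover have "eventually (\<lambda>s. (\<xi> s - \<xi> t) / (s - t) \<le> 0) (at t within {0..1})"
      proof -
        have "(\<xi> s - \<xi> t) / (s - t) \<le> 0" if "s \<in> {0..1}" for s
          using monotone_onD[OF anti, of s t] monotone_onD[OF anti, of t s] that t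
          by (cases "s \<le> t") (auto simp: divide_le_0_iff)
        then show ?thesis by (simp add: eventually_at_filter)
      qed
      moreover have "at t within {0..1} \<noteq> bot"
        using t by (simp add: trivial_limit_within islimpt_Icc)
      ultimately show ?thesis by (rule tendsto_upperbound)
    qed
    then have "((\<lambda>t. \<bar>speed \<xi> t\<bar>) has_integral - (\<xi> 1 - \<xi> 0)) {0..1}"
      using has_integral_neg[OF ftc] by (subst has_integral_cong[where g = "\<lambda>t. - speed \<xi> t"]) auto
    then show ?thesis using * by (simp add: integral_unique)
  qed
qed

section \<open>Functions that are Lipschitz in two times\<close>

text \<open>The two times will be \<open>\<xi> t\<close> and \<open>\<xi> 0\<close>. In the point
  only uniformity is required, since the generators are compared at equal points.\<close>

definition bounded_lipschitz :: "(real \<Rightarrow> real \<Rightarrow> 'm \<Rightarrow> real) \<Rightarrow> bool" where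
  "bounded_lipschitz G \<longleftrightarrow> (\<exists>B C. B \<ge> 0 \<and> C \<ge> 0 \<and>
    (\<forall>s\<in>{0..1}. \<forall>s0\<in>{0..1}. \<forall>x. \<bar>G s s0 x\<bar> \<le> B) \<and>
    (\<forall>s\<in>{0..1}. \<forall>s0\<in>{0..1}. \<forall>t\<in>{0..1}. \<forall>t0\<in>{0..1}. \<forall>x.
      \<bar>G s s0 x - G t t0 x\<bar> \<le> C * (\<bar>s - t\<bar> + \<bar>s0 - t0\<bar>)))"

lemma bounded_lipschitzI:
  assumes "B \<ge> 0" "C \<ge> 0" "\<And>s s0 x. s \<in> {0..1} \<Longrightarrow> s0 \<in> {0..1} \<Longrightarrow> \<bar>G s s0 x\<bar> \<le> B"
    "\<And>s s0 t t0 x. s \<in> {0..1} \<Longrightarrow> s0 \<in> {0..1} \<Longrightarrow> t \<in> {0..1} \<Longrightarrow> t0 \<in> {0..1} \<Longrightarrow>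
      \<bar>G s s0 x - G t t0 x\<bar> \<le> C * (\<bar>s - t\<bar> + \<bar>s0 - t0\<bar>)"
  shows "bounded_lipschitz G"
  unfolding bounded_lipschitz_def by (intro exI[of _ B] exI[of _ C] conjI ballI allI assms)

lemma bounded_lipschitzE:
  assumes "bounded_lipschitz G"
  obtains B C where "B \<ge> 0" "C \<ge> 0" "\<And>s s0 x. s \<in> {0..1} \<Longrightarrow> s0 \<in> {0..1} \<Longrightarrow> \<bar>G s s0 x\<bar> \<le> B"
    "\<And>s s0 t t0 x. s \<in> {0..1} \<Longrightarrow> s0 \<in> {0..1} \<Longrightarrow> t \<in> {0..1} \<Longrightarrow> t0 \<in> {0..1} \<Longrightarrow>
      \<bar>G s s0 x - G t t0 x\<bar> \<le> C * (\<bar>s - t\<bar> + \<bar>s0 - t0\<bar>)"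
  using assms unfolding bounded_lipschitz_def by (elim exE conjE) (rule that; blast)

lemma bounded_lipschitz_const: "bounded_lipschitz (\<lambda>s s0 x. a)"
  by (rule bounded_lipschitzI[of "\<bar>a\<bar>" 0]) auto

lemma bounded_lipschitz_add:
  assumes "bounded_lipschitz F" "bounded_lipschitz G"
  shows "bounded_lipschitz (\<lambda>s s0 x. F s s0 x + G s s0 x)"
proof -
  obtain B C where F: "B \<ge> 0" "C \<ge> 0" "\<And>s s0 x. s \<in> {0..1} \<Longrightarrow> s0 \<in> {0..1} \<Longrightarrow> \<bar>F s s0 x\<bar> \<le> B"
    "\<And>s s0 t t0 x. s \<in> {0..1} \<Longrightarrow> s0 \<in> {0..1} \<Longrightarrow> t \<in> {0..1} \<Longrightarrow> t0 \<in> {0..1} \<Longrightarrow>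
      \<bar>F s s0 x - F t t0 x\<bar> \<le> C * (\<bar>s - t\<bar> + \<bar>s0 - t0\<bar>)"
    by (rule bounded_lipschitzE[OF assms(1)]) blast
  obtain B' C' where G: "B' \<ge> 0" "C' \<ge> 0" "\<And>s s0 x. s \<in> {0..1} \<Longrightarrow> s0 \<in> {0..1} \<Longrightarrow> \<bar>G s s0 x\<bar> \<le> B'"
    "\<And>s s0 t t0 x. s \<in> {0..1} \<Longrightarrow> s0 \<in> {0..1} \<Longrightarrow> t \<in> {0..1} \<Longrightarrow> t0 \<in> {0..1} \<Longrightarrow>
      \<bar>G s s0 x - G t t0 x\<bar> \<le> C' * (\<bar>s - t\<bar> + \<bar>s0 - t0\<bar>)"
    by (rule bounded_lipschitzE[OF assms(2)]) blast
  show ?thesis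
  proof (rule bounded_lipschitzI[of "B + B'" "C + C'"])
    fix s s0 t t0 x assume I: "s \<in> {0..1::real}" "s0 \<in> {0..1::real}"
    show "\<bar>F s s0 x + G s s0 x\<bar> \<le> B + B'" using F(3)[OF I, of x] G(3)[OF I, of x] by linarith
    assume I': "t \<in> {0..1::real}" "t0 \<in> {0..1::real}"
    show "\<bar>F s s0 x + G s s0 x - (F t t0 x + G t t0 x)\<bar> \<le> (C + C') * (\<bar>s - t\<bar> + \<bar>s0 - t0\<bar>)"
      using F(4)[OF I I', of x] G(4)[OF I I', of x] unfolding distrib_right[of C] by linarith
  qed (use F G in auto)
qed

lemma bounded_lipschitz_mult:
  assumes "bounded_lipschitz F" "bounded_lipschitz G"
  shows "bounded_lipschitz (\<lambda>s s0 x. F s s0 x * G s s0 x)"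
proof -
  obtain B C where F: "B \<ge> 0" "C \<ge> 0" "\<And>s s0 x. s \<in> {0..1} \<Longrightarrow> s0 \<in> {0..1} \<Longrightarrow> \<bar>F s s0 x\<bar> \<le> B"
    "\<And>s s0 t t0 x. s \<in> {0..1} \<Longrightarrow> s0 \<in> {0..1} \<Longrightarrow> t \<in> {0..1} \<Longrightarrow> t0 \<in> {0..1} \<Longrightarrow>
      \<bar>F s s0 x - F t t0 x\<bar> \<le> C * (\<bar>s - t\<bar> + \<bar>s0 - t0\<bar>)"
    by (rule bounded_lipschitzE[OF assms(1)]) blast
  obtain B' C' where G: "B' \<ge> 0" "C' \<ge> 0" "\<And>s s0 x. s \<in> {0..1} \<Longrightarrow> s0 \<in> {0..1} \<Longrightarrow> \<bar>G s s0 x\<bar> \<le> B'"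
    "\<And>s s0 t t0 x. s \<in> {0..1} \<Longrightarrow> s0 \<in> {0..1} \<Longrightarrow> t \<in> {0..1} \<Longrightarrow> t0 \<in> {0..1} \<Longrightarrow>
      \<bar>G s s0 x - G t t0 x\<bar> \<le> C' * (\<bar>s - t\<bar> + \<bar>s0 - t0\<bar>)"
    by (rule bounded_lipschitzE[OF assms(2)]) blast
  show ?thesis
  proof (rule bounded_lipschitzI[of "B * B'" "B * C' + B' * C"])
    fix s s0 t t0 x assume I: "s \<in> {0..1::real}" "s0 \<in> {0..1::real}"
    show "\<bar>F s s0 x * G s s0 x\<bar> \<le> B * B'"
      unfolding abs_mult by (intro mult_mono F(3) G(3) I F(1)) simp
    assume I': "t \<in> {0..1::real}" "t0 \<in> {0..1::real}"
    have "\<bar>F s s0 x * G s s0 x - F t t0 x * G t t0 x\<bar>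
        = \<bar>F s s0 x * (G s s0 x - G t t0 x) + G t t0 x * (F s s0 x - F t t0 x)\<bar>"
      by (simp add: algebra_simps)
    also have "\<dots> \<le> \<bar>F s s0 x\<bar> * \<bar>G s s0 x - G t t0 x\<bar> + \<bar>G t t0 x\<bar> * \<bar>F s s0 x - F t t0 x\<bar>"
      by (rule order_trans[OF abs_triangle_ineq]) (simp add: abs_mult)
    also have "\<dots> \<le> B * (C' * (\<bar>s - t\<bar> + \<bar>s0 - t0\<bar>)) + B' * (C * (\<bar>s - t\<bar> + \<bar>s0 - t0\<bar>))"
      by (intro add_mono mult_mono F(1,3,4) G(1,3,4) I I') auto
    finally show "\<bar>F s s0 x * G s s0 x - F t t0 x * G t t0 x\<bar> \<le> (B * C' + B' * C) * (\<bar>s - t\<bar> + \<bar>s0 - t0\<bar>)"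
      by (simp add: algebra_simps)
  qed (use F G in auto)
qed

lemma bounded_lipschitz_sum:
  assumes "\<And>i. i \<in> I \<Longrightarrow> bounded_lipschitz (F i)"
  shows "bounded_lipschitz (\<lambda>s s0 x. \<Sum>i\<in>I. F i s s0 x)"
  using assms
  by (induction I rule: infinite_finite_induct) (auto intro: bounded_lipschitz_const bounded_lipschitz_add)

text \<open>Covers the base point term of an integral that starts at the initial time; the increment
  of \<open>s0\<close> then counts in both slots.\<close>

lemma bounded_lipschitz_diag:
  assumes "bounded_lipschitz G"
  shows "bounded_lipschitz (\<lambda>s s0 x. G s0 s0 x)"
proof -
  obtain B C where G: "B \<ge> 0" "C \<ge> 0" "\<And>s s0 x. s \<in> {0..1} \<Longrightarrow> s0 \<in> {0..1} \<Longrightarrow> \<bar>G s s0 x\<bar> \<le> B"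
    "\<And>s s0 t t0 x. s \<in> {0..1} \<Longrightarrow> s0 \<in> {0..1} \<Longrightarrow> t \<in> {0..1} \<Longrightarrow> t0 \<in> {0..1} \<Longrightarrow>
      \<bar>G s s0 x - G t t0 x\<bar> \<le> C * (\<bar>s - t\<bar> + \<bar>s0 - t0\<bar>)"
    by (rule bounded_lipschitzE[OF assms]) blast
  show ?thesis
  proof (rule bounded_lipschitzI[of B "2 * C"])
    fix s s0 t t0 x assume I: "s0 \<in> {0..1::real}" "t0 \<in> {0..1::real}"
    have "\<bar>G s0 s0 x - G t0 t0 x\<bar> \<le> C * (\<bar>s0 - t0\<bar> + \<bar>s0 - t0\<bar>)" using G(4)[OF I(1,1,2,2)] .
    moreover have "0 \<le> C * \<bar>s - t\<bar>" using G(2) by simp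
    ultimately show "\<bar>G s0 s0 x - G t0 t0 x\<bar> \<le> 2 * C * (\<bar>s - t\<bar> + \<bar>s0 - t0\<bar>)"
      by (simp add: algebra_simps)
  qed (use G in auto)
qed

lemma bounded_lipschitz_time:
  assumes "smooth_on {0..1} l"
  shows "bounded_lipschitz (\<lambda>s s0 x. l s)"
proof -
  have Ck: "Ck_on (Suc 0) {0..1} l" using assms by (simp only: smooth_on_def)
  from Ck_one_lipschitz[OF Ck order_refl compact_Icc convex_real_interval(5)]
  obtain L where L: "L \<ge> 0" "\<And>x y. x \<in> {0..1} \<Longrightarrow> y \<in> {0..1} \<Longrightarrow> norm (l x - l y) \<le> L * norm (x - y)"
    by metis
  show ?thesis
  proof (rule bounded_lipschitzI[of "\<bar>l 0\<bar> + L" L])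
    fix s s0 t t0 x assume I: "s \<in> {0..1::real}"
    have "L * \<bar>s\<bar> \<le> L" using I L(1) by (simp add: mult_left_le)
    then show "\<bar>l s\<bar> \<le> \<bar>l 0\<bar> + L" using L(2)[OF I, of 0] by simp
    assume "t \<in> {0..1::real}"
    from L(2)[OF I this] show "\<bar>l s - l t\<bar> \<le> L * (\<bar>s - t\<bar> + \<bar>s0 - t0\<bar>)"
      using mult_nonneg_nonneg[OF L(1) abs_ge_zero[of "s0 - t0"]] by (simp add: algebra_simps)
  qed (use L in auto)
qed

text \<open>The difference is split so that the increment of \<open>G\<close> is weighted by
  \<open>p\<close> and never by \<open>q\<close>. With \<open>p\<close> and \<open>q\<close> the two
  speeds, this is why monotonicity of the first parameter change suffices. The factor 2 accounts for
  the two times.\<close>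

lemma bounded_lipschitz_diff:
  assumes "bounded_lipschitz G"
  obtains B C where "B \<ge> 0" "C \<ge> 0"
    "\<And>p q s s0 t t0 N x. s \<in> {0..1} \<Longrightarrow> s0 \<in> {0..1} \<Longrightarrow> t \<in> {0..1} \<Longrightarrow> t0 \<in> {0..1} \<Longrightarrow>
      \<bar>s - t\<bar> \<le> N \<Longrightarrow> \<bar>s0 - t0\<bar> \<le> N \<Longrightarrow>
      \<bar>p * G s s0 x - q * G t t0 x\<bar> \<le> B * \<bar>p - q\<bar> + C * (\<bar>p\<bar> * N)"
proof -
  obtain B C where G: "B \<ge> 0" "C \<ge> 0" "\<And>s s0 x. s \<in> {0..1} \<Longrightarrow> s0 \<in> {0..1} \<Longrightarrow> \<bar>G s s0 x\<bar> \<le> B"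
    "\<And>s s0 t t0 x. s \<in> {0..1} \<Longrightarrow> s0 \<in> {0..1} \<Longrightarrow> t \<in> {0..1} \<Longrightarrow> t0 \<in> {0..1} \<Longrightarrow>
      \<bar>G s s0 x - G t t0 x\<bar> \<le> C * (\<bar>s - t\<bar> + \<bar>s0 - t0\<bar>)"
    by (rule bounded_lipschitzE[OF assms]) blast
  show thesis
  proof (rule that[of B "2 * C"])
    fix p q s s0 t t0 N x
    assume I: "s \<in> {0..1::real}" "s0 \<in> {0..1::real}" "t \<in> {0..1::real}" "t0 \<in> {0..1::real}"
      and N: "\<bar>s - t\<bar> \<le> N" "\<bar>s0 - t0\<bar> \<le> N"
    have "\<bar>p * G s s0 x - q * G t t0 x\<bar> = \<bar>G t t0 x * (p - q) + p * (G s s0 x - G t t0 x)\<bar>"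
      by (simp add: algebra_simps)
    also have "\<dots> \<le> \<bar>G t t0 x\<bar> * \<bar>p - q\<bar> + \<bar>p\<bar> * \<bar>G s s0 x - G t t0 x\<bar>"
      by (rule order_trans[OF abs_triangle_ineq]) (simp add: abs_mult)
    also have "\<dots> \<le> B * \<bar>p - q\<bar> + \<bar>p\<bar> * (C * (N + N))"
      by (intro add_mono mult_right_mono mult_left_mono G(3) I order_trans[OF G(4)[OF I]] N G(2)) auto
    finally show "\<bar>p * G s s0 x - q * G t t0 x\<bar> \<le> B * \<bar>p - q\<bar> + 2 * C * (\<bar>p\<bar> * N)"
      by (simp add: algebra_simps)
  qed (use G in auto)
qed

section \<open>Estimates of the distance integrand\<close>

text \<open>The centre \<open>a\<close> is free, so a summand that depends on time alone, such as a
  mean value, costs nothing.\<close>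

lemma osc_le:
  assumes "\<And>x. \<bar>f x - a\<bar> \<le> r"
  shows "osc f \<le> 2 * r"
proof -
  have "f x \<le> a + r" "a - r \<le> f x" for x using assms[of x] by (auto simp: abs_le_iff)
  then have "(SUP x. f x) \<le> a + r" "a - r \<le> (INF x. f x)"
    by (auto intro: cSUP_least cINF_greatest)
  then show ?thesis by (simp add: osc_def)
qed

text \<open>If \<open>f\<close> is not integrable, then its integral is \<open>0\<close>.\<close>

lemma integral_le_variation:
  fixes p q :: "real \<Rightarrow> real"
  assumes f: "\<And>t. t \<in> {0..1} \<Longrightarrow> f t \<le> B * \<bar>p t - q t\<bar> + C * (\<bar>p t\<bar> * N)"
    and p: "continuous_on {0..1} p" and q: "continuous_on {0..1} q"
    and p1: "integral {0..1} (\<lambda>t. \<bar>p t\<bar>) \<le> 1" and nonneg: "B \<ge> 0" "C \<ge> 0" "N \<ge> 0"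
  shows "integral {0..1} f \<le> (B + C) * (N + integral {0..1} (\<lambda>t. \<bar>p t - q t\<bar>))"
proof -
  let ?I = "integral {0..1} (\<lambda>t. \<bar>p t - q t\<bar>)"
  have int: "(\<lambda>t. \<bar>p t - q t\<bar>) integrable_on {0..1}" "(\<lambda>t. \<bar>p t\<bar>) integrable_on {0..1}"
    by (intro integrable_continuous_real continuous_intros p q)+
  have I: "?I \<ge> 0" by (rule integral_nonneg[OF int(1)]) simp
  have "integral {0..1} f \<le> B * ?I + C * N"
  proof (cases "f integrable_on {0..1}")
    case True
    have "integral {0..1} f \<le> integral {0..1} (\<lambda>t. B * \<bar>p t - q t\<bar> + C * (\<bar>p t\<bar> * N))"
      by (rule integral_le[OF True]) (use f p q in \<open>auto intro!: integrable_continuous_real continuous_intros\<close>)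
    also have "\<dots> = B * ?I + C * (integral {0..1} (\<lambda>t. \<bar>p t\<bar>) * N)"
      using int by (subst integral_add) (auto intro!: integrable_on_mult_right integrable_on_mult_left)
    also have "\<dots> \<le> B * ?I + C * (1 * N)"
      by (intro add_left_mono mult_left_mono mult_right_mono p1 nonneg)
    finally show ?thesis by simp
  next
    case False
    then have "integral {0..1} f = 0" by (rule not_integrable_integral)
    then show ?thesis using I nonneg by simp
  qed
  also have "\<dots> \<le> (B + C) * (N + ?I)"
    using I nonneg by (simp add: algebra_simps)
  finally show ?thesis .
qed

text \<open>\<open>coords\<close> is a choice, but two coefficient sequences of the same form differ
  by one that represents 0, so independence makes them agree below \<open>b\<close>.\<close>

lemma hnorm_eq:
  assumes indep: "\<And>k. lin_comb_of A b h k (\<lambda>c y v. 0) \<Longrightarrow> \<forall>i<b. k i = 0"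
    and k: "lin_comb_of A b h k \<alpha>"
  shows "hnorm A b h \<alpha> = (\<Sum>i<b. \<bar>k i\<bar>)"
proof -
  have "lin_comb_of A b h (coords A b h \<alpha>) \<alpha>" unfolding coords_def by (rule someI[of _ k]) (rule k)
  then have "lin_comb_of A b h (\<lambda>i. coords A b h \<alpha> i - k i) (\<lambda>c y v. 0)"
    using k by (simp add: lin_comb_of_def left_diff_distrib sum_subtractf)
  then have "\<forall>i<b. coords A b h \<alpha> i - k i = 0" by (rule indep)
  then show ?thesis by (simp add: hnorm_def)
qed

lemma d0_scale:
  assumes "((f \<circ> cinv c) has_derivative d0 f c y) (at y)"
  shows "d0 (\<lambda>x. a * f x) c y v = a * d0 f c y v"
proof -
  have "(((\<lambda>x. a * f x) \<circ> cinv c) has_derivative (\<lambda>v. a * d0 f c y v)) (at y)"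
    using has_derivative_mult_right[OF assms, of a] by (simp add: o_def)
  from frechet_derivative_at[OF this] show ?thesis unfolding d0_def by metis
qed

context symplectic_generator
begin

section \<open>Isotopies of reparametrized generators\<close>

text \<open>\<open>contract\<close> evaluates in a chart picked by \<open>SOME\<close>; the
  transformation laws of the form and of the field cancel, so any chart around the point may be
  substituted.\<close>

lemma contract_ham_field:
  assumes \<alpha>: "one_form A \<alpha>" and c: "c \<in> A" "p \<in> cdom c" and u: "u \<in> {0..1}"
  shows "contract A \<alpha> (ham_field u) p = \<alpha> c (crd c p) (ham_field u c (crd c p))"
proof -
  define c' where "c' = (SOME c. c \<in> A \<and> p \<in> cdom c)"
  have c': "c' \<in> A" "p \<in> cdom c'" unfolding c'_def using someI[of "\<lambda>c. c \<in> A \<and> p \<in> cdom c" c] c by auto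
  have "contract A \<alpha> (ham_field u) p = \<alpha> c' (crd c' p) (ham_field u c' (crd c' p))"
    by (simp add: contract_def c'_def Let_def)
  also have "\<dots> = \<alpha> c (crd c p) (trans_deriv c' c p (ham_field u c' (crd c' p)))"
    using \<alpha> c c' unfolding one_form_def by blast
  also have "\<dots> = \<alpha> c (crd c p) (ham_field u c (crd c p))"
    by (simp add: ham_field_transition[OF u c'(1) c(1) c'(2) c(2)])
  finally show ?thesis .
qed

lemma lip_contract:
  assumes \<alpha>: "one_form A \<alpha>"
  shows "lip (\<lambda>u. contract A \<alpha> (ham_field u))"
  unfolding lip_def
proof
  fix p
  obtain c where c: "c \<in> A" "p \<in> cdom c" by (rule chart_at)
  have "loclip c p (\<lambda>u x. \<Sum>j\<in>UNIV. ham_field u c (crd c x) $ j * \<alpha> c (crd c x) (axis j 1))"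
    by (intro loclip_sum loclip_mult c loclip_ham_field one_form_loclip \<alpha>)
  then have "loclip c p (\<lambda>u. contract A \<alpha> (ham_field u))"
  proof (rule loclip_cong[OF c(1) _ open_cdom[OF c(1)] c(2)])
    fix x u assume x: "x \<in> cdom c" and u: "u \<in> {0..1::real}"
    have "linear (\<alpha> c (crd c x))" using \<alpha> c(1) crd_in[OF c(1) x] by (simp add: one_form_def)
    from linear_axis_expansion[OF this, of "ham_field u c (crd c x)"]
    show "(\<Sum>j\<in>UNIV. ham_field u c (crd c x) $ j * \<alpha> c (crd c x) (axis j 1)) = contract A \<alpha> (ham_field u) x"
      by (simp only: contract_ham_field[OF \<alpha> c(1) x u])
  qed
  then show "\<exists>c\<in>A. p \<in> cdom c \<and> loclip c p (\<lambda>u. contract A \<alpha> (ham_field u))" using c by blast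
qed

lemma generatesD:
  assumes "generates A \<omega> (reparam \<xi> (U, H)) \<phi>"
  shows "continuous_on ({0..1} \<times> UNIV) (\<lambda>(t, x). \<phi> t x)"
    and "\<And>t. t \<in> {0..1} \<Longrightarrow> bij (\<phi> t)"
    and "\<phi> 0 = id"
    and "\<And>t c x. t \<in> {0..1} \<Longrightarrow> c \<in> A \<Longrightarrow> \<phi> t x \<in> cdom c \<Longrightarrow>
      (\<lambda>s. crd c (\<phi> s x)) differentiable (at t within {0..1})"
    and "\<And>t c y v. t \<in> {0..1} \<Longrightarrow> c \<in> A \<Longrightarrow> y \<in> crange c \<Longrightarrow>
      \<omega> c y (velocity \<phi> t c y) v = d0 (\<lambda>x. speed \<xi> t * U (\<xi> t) x) c y v + speed \<xi> t * H (\<xi> t) c y v"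
  using assms unfolding generates_def reparam_def prod.case by blast+

lemma scaled_ham_field_eq:
  assumes "t \<in> {0..1}" "c \<in> A" "y \<in> crange c"
  shows "\<omega> c y (a *\<^sub>R ham_field t c y) v = d0 (\<lambda>x. a * U t x) c y v + a * H t c y v"
  using bilinear_lmul[OF bilinear_\<omega>[OF assms(2,3)], of a "ham_field t c y" v]
    ham_field_eq[OF assms, of v] d0_scale[OF d0_U(1)[OF assms], of a v]
  by (simp add: field_form_def algebra_simps)

lemma velocity_eq:
  assumes \<phi>: "generates A \<omega> (reparam \<xi> (U, H)) \<phi>" and \<xi>: "parameter_change \<xi>"
    and t: "t \<in> {0..1}" and c: "c \<in> A" "y \<in> crange c"
  shows "velocity \<phi> t c y = speed \<xi> t *\<^sub>R ham_field (\<xi> t) c y"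
  by (rule \<omega>_inject[OF c])
     (simp add: generatesD(5)[OF \<phi> t c] scaled_ham_field_eq[OF parameter_change_in[OF \<xi> t] c])

text \<open>\<open>velocity\<close> is defined through the inverse map; at a point of the curve of
  \<open>x\<close>, bijectivity makes it the derivative of that curve. Every solution of
  \<open>generates\<close> thus falls under the uniqueness theorem.\<close>

lemma generates_icurve:
  assumes \<phi>: "generates A \<omega> (reparam \<xi> (U, H)) \<phi>" and \<xi>: "parameter_change \<xi>"
  shows "icurve {0..1} (speed \<xi>) \<xi> (\<lambda>t. \<phi> t x)"
  unfolding icurve_def
proof (intro conjI ballI impI)
  have "continuous_on {0..1} (\<lambda>t. (\<lambda>(t, x). \<phi> t x) (t, x))"
    by (rule continuous_on_compose2[OF generatesD(1)[OF \<phi>]]) (auto intro!: continuous_intros)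
  then show "continuous_on {0..1} (\<lambda>t. \<phi> t x)" by simp
  fix t c assume t: "t \<in> {0..1::real}" and c: "c \<in> A" "\<phi> t x \<in> cdom c"
  have "inv (\<phi> t) (cinv c (crd c (\<phi> t x))) = x"
    using generatesD(2)[OF \<phi> t] by (simp add: cinv_crd[OF c] bij_is_inj)
  then have "velocity \<phi> t c (crd c (\<phi> t x)) = vector_derivative (\<lambda>s. crd c (\<phi> s x)) (at t within {0..1})"
    by (simp add: velocity_def)
  then show "((\<lambda>s. crd c (\<phi> s x)) has_vector_derivative
      speed \<xi> t *\<^sub>R ham_field (\<xi> t) c (crd c (\<phi> t x))) (at t within {0..1})"
    using generatesD(4)[OF \<phi> t c] velocity_eq[OF \<phi> \<xi> t c(1) crd_in[OF c]]
    by (simp add: vector_derivative_works)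
qed

text \<open>Supplies a witness for the choice made in \<open>isotopy\<close>. Exchanging the two
  times of the flow gives the inverse map.\<close>

lemma generates_flow:
  assumes \<xi>: "parameter_change \<xi>"
  shows "generates A \<omega> (reparam \<xi> (U, H)) (\<lambda>t x. flow (\<xi> t) (\<xi> 0) x)"
proof -
  have sm: "smooth_on {0..1} \<xi>" "\<xi> ` {0..1} \<subseteq> {0..1}" using \<xi> by (auto simp: parameter_change_def)
  have \<xi>0: "\<xi> 0 \<in> {0..1}" using parameter_change_in[OF \<xi>] by simp
  have cont\<xi>: "continuous_on {0..1} \<xi>"
    using has_vector_derivative_speed[OF sm(1)] by (rule continuous_on_vector_derivative)
  have "continuous_on ({0..1} \<times> UNIV) (\<lambda>z. (\<lambda>(s, x). flow s (\<xi> 0) x) (\<xi> (fst z), snd z :: 'm))"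
    by (rule continuous_on_compose2[OF continuous_on_flow[OF \<xi>0]])
       (use sm in \<open>auto intro!: continuous_on_Pair continuous_on_compose2[OF cont\<xi>] continuous_on_fst continuous_on_snd continuous_on_id\<close>)
  then have 1: "continuous_on ({0..1} \<times> UNIV) (\<lambda>(t, x). flow (\<xi> t) (\<xi> 0) x)"
    by (simp add: case_prod_beta)
  have bij: "bij (flow (\<xi> t) (\<xi> 0))" if t: "t \<in> {0..1}" for t
    by (rule bij_betw_byWitness[where f' = "flow (\<xi> 0) (\<xi> t)"])
       (use parameter_change_in[OF \<xi> t] \<xi>0 in \<open>simp_all add: flow_flow flow_self\<close>)
  have 3: "(\<lambda>x. flow (\<xi> 0) (\<xi> 0) x) = id" by (simp add: fun_eq_iff flow_self[OF \<xi>0])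
  have curve: "icurve {0..1} (speed \<xi>) \<xi> (\<lambda>t. flow (\<xi> t) (\<xi> 0) x)" for x
    by (rule icurve_reparam[OF sm(2) \<xi>0 has_vector_derivative_speed[OF sm(1)]])
  have 4: "(\<lambda>s. crd c (flow (\<xi> s) (\<xi> 0) x)) differentiable (at t within {0..1})"
    if "t \<in> {0..1}" "c \<in> A" "flow (\<xi> t) (\<xi> 0) x \<in> cdom c" for t c x
    using icurveD[OF curve that] by (rule differentiableI_vector)
  have vel: "velocity (\<lambda>t x. flow (\<xi> t) (\<xi> 0) x) t c y = speed \<xi> t *\<^sub>R ham_field (\<xi> t) c y"
    if t: "t \<in> {0..1}" and c: "c \<in> A" "y \<in> crange c" for t c y
  proof -
    define x where "x = inv (flow (\<xi> t) (\<xi> 0)) (cinv c y)"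
    have x: "flow (\<xi> t) (\<xi> 0) x = cinv c y"
      unfolding x_def using bij[OF t] by (simp add: bij_is_surj surj_f_inv_f)
    have "((\<lambda>s. crd c (flow (\<xi> s) (\<xi> 0) x)) has_vector_derivative speed \<xi> t *\<^sub>R ham_field (\<xi> t) c y) (at t within {0..1})"
      using icurveD[OF curve t c(1), of x] unfolding x by (simp add: cinv_in[OF c] crd_cinv[OF c])
    from vector_derivative_within_closed_interval[OF _ t this]
    show ?thesis unfolding velocity_def x_def[symmetric] by simp
  qed
  show ?thesis
    unfolding generates_def reparam_def prod.case
    using 1 bij 3 4 scaled_ham_field_eq[OF parameter_change_in[OF \<xi>]]
    by (auto simp: vel)
qed

text \<open>The chosen isotopy and the explicit one are integral curves of the same equation, agree
  at time 0, and have a speed factor that is continuous, hence bounded, on [0,1].\<close>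

lemma isotopy_reparam:
  assumes \<xi>: "parameter_change \<xi>"
  shows "generates A \<omega> (reparam \<xi> (U, H)) (isotopy A \<omega> (reparam \<xi> (U, H)))"
    and "t \<in> {0..1} \<Longrightarrow> isotopy A \<omega> (reparam \<xi> (U, H)) t x = flow (\<xi> t) (\<xi> 0) x"
proof -
  let ?\<phi> = "isotopy A \<omega> (reparam \<xi> (U, H))"
  show gen: "generates A \<omega> (reparam \<xi> (U, H)) ?\<phi>"
    unfolding isotopy_def
    by (rule someI[of "generates A \<omega> (reparam \<xi> (U, H))"]) (rule generates_flow[OF \<xi>])
  assume t: "t \<in> {0..1}"
  have sm: "smooth_on {0..1} \<xi>" "\<xi> ` {0..1} \<subseteq> {0..1}" using \<xi> by (auto simp: parameter_change_def)
  have \<xi>0: "\<xi> 0 \<in> {0..1}" using parameter_change_in[OF \<xi>] by simp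
  have "compact (speed \<xi> ` {0..1})"
    by (intro compact_continuous_image continuous_on_speed sm compact_Icc)
  then have "bounded (speed \<xi> ` {0..1})" by (rule compact_imp_bounded)
  then obtain Z where "\<forall>t\<in>{0..1}. \<bar>speed \<xi> t\<bar> \<le> Z" unfolding bounded_iff by auto
  then have Z: "\<bar>speed \<xi> t\<bar> \<le> Z" if "t \<in> {0..1}" for t using that by blast
  show "?\<phi> t x = flow (\<xi> t) (\<xi> 0) x"
  proof (rule icurve_unique[OF generates_icurve[OF gen \<xi>] generates_icurve[OF generates_flow[OF \<xi>] \<xi>] sm(2) Z])
    show "?\<phi> 0 x = flow (\<xi> 0) (\<xi> 0) x" by (simp add: generatesD(3)[OF gen] flow_self[OF \<xi>0])
  qed (use t in auto)
qed

section \<open>The generator of the inverse isotopy\<close>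

text \<open>The integral of \<open>h i\<close> along the flow line that is at \<open>x\<close> at
  time \<open>s0\<close>, taken from time 0. With this base the oriented integral from
  \<open>s0\<close> to \<open>s\<close> is \<open>work i s s0 x - work i s0 s0 x\<close>, whichever
  of the two times is larger.\<close>

definition work :: "nat \<Rightarrow> real \<Rightarrow> real \<Rightarrow> 'm \<Rightarrow> real" where
  "work i s s0 x = integral {0..s} (\<lambda>u. contract A (h i) (ham_field u) (flow u s0 x))"

text \<open>The function \<open>F\<close> of the overview. The coefficients are taken at the final
  time \<open>s\<close> because \<Delta> integrates a form that is frozen at that time.\<close>

definition pullback_potential :: "real \<Rightarrow> real \<Rightarrow> 'm \<Rightarrow> real" where
  "pullback_potential s s0 x = U s (flow s s0 x) + (\<Sum>i<b. l i s * (work i s s0 x - work i s0 s0 x))"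

lemma bounded_lipschitz_flow:
  assumes "lip f"
  shows "bounded_lipschitz (\<lambda>s s0 x. f s (flow s s0 x))"
proof -
  obtain B where B: "B \<ge> 0" "\<And>t x. t \<in> {0..1} \<Longrightarrow> \<bar>f t x\<bar> \<le> B" using lip_bounded[OF assms] by blast
  obtain C where C: "C \<ge> 0" "\<And>s t s0 t0 x. s \<in> {0..1} \<Longrightarrow> t \<in> {0..1} \<Longrightarrow> s0 \<in> {0..1} \<Longrightarrow> t0 \<in> {0..1} \<Longrightarrow>
    \<bar>f s (flow s s0 x) - f t (flow t t0 x)\<bar> \<le> C * (\<bar>s - t\<bar> + \<bar>s0 - t0\<bar>)"
    by (rule lip_flow[OF assms]) blast
  show ?thesis by (rule bounded_lipschitzI[OF B(1) C(1)]) (use B C in blast)+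
qed

lemma bounded_lipschitz_space:
  assumes "lip f"
  shows "bounded_lipschitz (\<lambda>s s0 x. f s x)"
proof -
  obtain B where B: "B \<ge> 0" "\<And>t x. t \<in> {0..1} \<Longrightarrow> \<bar>f t x\<bar> \<le> B" using lip_bounded[OF assms] by blast
  obtain L where L: "L \<ge> 0" "\<And>s t x. s \<in> {0..1} \<Longrightarrow> t \<in> {0..1} \<Longrightarrow> \<bar>f s x - f t x\<bar> \<le> L * \<bar>s - t\<bar>"
    using lip_time[OF assms] by blast
  show ?thesis
  proof (rule bounded_lipschitzI[OF B(1) L(1)])
    fix s s0 t t0 x assume "s \<in> {0..1::real}" "t \<in> {0..1::real}"
    from L(2)[OF this, of x] show "\<bar>f s x - f t x\<bar> \<le> L * (\<bar>s - t\<bar> + \<bar>s0 - t0\<bar>)"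
      using mult_nonneg_nonneg[OF L(1) abs_ge_zero[of "s0 - t0"]] by (simp add: distrib_left)
  qed (use B in blast)
qed

lemma continuous_on_contract_flow:
  assumes "i < b" "s0 \<in> {0..1}"
  shows "continuous_on {0..1} (\<lambda>u. contract A (h i) (ham_field u) (flow u s0 x))"
proof -
  obtain C where C: "C \<ge> 0" "\<And>s t s0 t0 x. s \<in> {0..1} \<Longrightarrow> t \<in> {0..1} \<Longrightarrow> s0 \<in> {0..1} \<Longrightarrow> t0 \<in> {0..1} \<Longrightarrow>
    \<bar>contract A (h i) (ham_field s) (flow s s0 x) - contract A (h i) (ham_field t) (flow t t0 x)\<bar>
      \<le> C * (\<bar>s - t\<bar> + \<bar>s0 - t0\<bar>)"
    by (rule lip_flow[OF lip_contract[OF h_form[OF assms(1)]]]) blast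
  show ?thesis
    by (rule lipschitz_on_continuous_on[of C], rule lipschitz_onI)
       (use C(1) C(2)[of _ _ s0 s0 x] assms(2) in \<open>auto simp: dist_real_def\<close>)
qed

text \<open>A change of the upper limit costs the bound \<open>B\<close> of the integrand, a change
  of the initial time its Lipschitz constant \<open>C\<close>, each over an interval of length at
  most 1.\<close>

lemma bounded_lipschitz_work:
  assumes i: "i < b"
  shows "bounded_lipschitz (work i)"
proof -
  let ?q = "\<lambda>s0 x u. contract A (h i) (ham_field u) (flow u s0 x)"
  obtain B C where q: "B \<ge> 0" "C \<ge> 0" "\<And>s s0 x. s \<in> {0..1} \<Longrightarrow> s0 \<in> {0..1} \<Longrightarrow> \<bar>?q s0 x s\<bar> \<le> B"
    "\<And>s s0 t t0 x. s \<in> {0..1} \<Longrightarrow> s0 \<in> {0..1} \<Longrightarrow> t \<in> {0..1} \<Longrightarrow> t0 \<in> {0..1} \<Longrightarrow>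
      \<bar>?q s0 x s - ?q t0 x t\<bar> \<le> C * (\<bar>s - t\<bar> + \<bar>s0 - t0\<bar>)"
    by (rule bounded_lipschitzE[OF bounded_lipschitz_flow[OF lip_contract[OF h_form[OF i]]]]) blast
  have cont: "continuous_on {a..s} (?q s0 x)" if "s0 \<in> {0..1}" "s \<in> {0..1}" "a \<in> {0..1}" for a s s0 x
    by (rule continuous_on_subset[OF continuous_on_contract_flow[OF i that(1)]]) (use that in auto)
  have time: "\<bar>work i s s0 x - work i t s0 x\<bar> \<le> B * (s - t)"
    if I: "s \<in> {0..1}" "t \<in> {0..1}" "s0 \<in> {0..1}" and le: "t \<le> s" for s t s0 x
  proof -
    have "work i t s0 x + integral {t..s} (?q s0 x) = work i s s0 x"
      unfolding work_def using I le cont[OF I(3,1), of 0 x]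
      by (intro Henstock_Kurzweil_Integration.integral_combine integrable_continuous_real) auto
    moreover have "norm (integral {t..s} (?q s0 x)) \<le> B * (s - t)"
      by (rule integral_bound[OF le cont[OF I(3,1,2)]]) (use q(3) I in auto)
    ultimately show ?thesis by auto
  qed
  have init: "\<bar>work i t s0 x - work i t t0 x\<bar> \<le> C * \<bar>s0 - t0\<bar>"
    if I: "t \<in> {0..1}" "s0 \<in> {0..1}" "t0 \<in> {0..1}" for t s0 t0 x
  proof -
    have c: "continuous_on {0..t} (?q s0 x)" "continuous_on {0..t} (?q t0 x)"
      using I by (auto intro: cont)
    have "norm (integral {0..t} (\<lambda>u. ?q s0 x u - ?q t0 x u)) \<le> C * \<bar>s0 - t0\<bar> * (t - 0)"
    proof (rule integral_bound)
      show "norm (?q s0 x u - ?q t0 x u) \<le> C * \<bar>s0 - t0\<bar>" if "u \<in> {0..t}" for u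
        using q(4)[of u s0 u t0 x] that I by simp
    qed (use I c in \<open>auto intro: continuous_on_diff\<close>)
    also have "\<dots> \<le> C * \<bar>s0 - t0\<bar>" using I q(2) by (simp add: mult_left_le)
    finally show ?thesis
      unfolding work_def using c by (subst (asm) integral_diff) (auto intro: integrable_continuous_real)
  qed
  have lip: "\<bar>work i s s0 x - work i t t0 x\<bar> \<le> (B + C) * (\<bar>s - t\<bar> + \<bar>s0 - t0\<bar>)"
    if I: "s \<in> {0..1}" "s0 \<in> {0..1}" "t \<in> {0..1}" "t0 \<in> {0..1}" for s s0 t t0 x
  proof -
    have "\<bar>work i s s0 x - work i t s0 x\<bar> \<le> B * \<bar>s - t\<bar>"
      using time[OF I(1,3,2), of x] time[OF I(3,1,2), of x] by (cases "t \<le> s") (auto simp: abs_minus_commute)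
    moreover have "0 \<le> B * \<bar>s0 - t0\<bar>" "0 \<le> C * \<bar>s - t\<bar>" using q by auto
    ultimately show ?thesis using init[OF I(3,2,4), of x] unfolding distrib_left distrib_right by linarith
  qed
  show ?thesis
  proof (rule bounded_lipschitzI[of "B" "B + C"])
    fix s s0 x assume I: "s \<in> {0..1::real}" "s0 \<in> {0..1::real}"
    have "\<bar>work i s s0 x\<bar> \<le> B * s" using time[OF I(1) _ I(2), of 0 x] I by (simp add: work_def)
    also have "\<dots> \<le> B" using I q(1) by (simp add: mult_left_le)
    finally show "\<bar>work i s s0 x\<bar> \<le> B" .
  qed (use q lip in auto)
qed

lemma bounded_lipschitz_pullback_potential: "bounded_lipschitz pullback_potential"
proof -
  have "bounded_lipschitz (\<lambda>s s0 x. l i s * (work i s s0 x + (-1) * work i s0 s0 x))" if i: "i < b" for i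
    by (intro bounded_lipschitz_mult[OF bounded_lipschitz_time[OF l_smooth[OF i]]]
        bounded_lipschitz_add[OF bounded_lipschitz_work[OF i]]
        bounded_lipschitz_mult[OF bounded_lipschitz_const bounded_lipschitz_diag[OF bounded_lipschitz_work[OF i]]])
  then have "bounded_lipschitz (\<lambda>s s0 x. U s (flow s s0 x) + (\<Sum>i<b. l i s * (work i s s0 x + (-1) * work i s0 s0 x)))"
    by (intro bounded_lipschitz_add[OF bounded_lipschitz_flow[OF lip_U]] bounded_lipschitz_sum) simp
  moreover have "pullback_potential = (\<lambda>s s0 x. U s (flow s s0 x) + (\<Sum>i<b. l i s * (work i s s0 x + (-1) * work i s0 s0 x)))"
    by (simp add: fun_eq_iff pullback_potential_def)
  ultimately show ?thesis by simp
qed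

text \<open>The substitution u = \<xi>(s) is carried out as the fundamental theorem for
  \<open>work\<close> composed with \<open>\<xi>\<close>. It therefore holds for parameter changes
  that run back and forth, as the second one may.\<close>

lemma integral_speed_contract:
  assumes \<xi>: "parameter_change \<xi>" and t: "t \<in> {0..1}" and i: "i < b" and s0: "s0 \<in> {0..1}"
  shows "((\<lambda>s. speed \<xi> s * contract A (h i) (ham_field (\<xi> s)) (flow (\<xi> s) s0 x)) has_integral
    work i (\<xi> t) s0 x - work i (\<xi> 0) s0 x) {0..t}"
proof (rule fundamental_theorem_of_calculus)
  fix s assume s: "s \<in> {0..t}"
  then have s1: "s \<in> {0..1}" using t by auto
  have sm: "smooth_on {0..1} \<xi>" "\<xi> ` {0..1} \<subseteq> {0..1}" using \<xi> by (auto simp: parameter_change_def)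
  have 1: "(\<xi> has_vector_derivative speed \<xi> s) (at s within {0..t})"
    using has_vector_derivative_speed[OF sm(1) s1]
    by (rule has_vector_derivative_within_subset) (use t in auto)
  have "((\<lambda>u. work i u s0 x) has_vector_derivative contract A (h i) (ham_field (\<xi> s)) (flow (\<xi> s) s0 x))
      (at (\<xi> s) within {0..1})"
    unfolding work_def
    by (rule integral_has_vector_derivative[OF continuous_on_contract_flow[OF i s0] parameter_change_in[OF \<xi> s1]])
  then have 2: "((\<lambda>u. work i u s0 x) has_vector_derivative contract A (h i) (ham_field (\<xi> s)) (flow (\<xi> s) s0 x))
      (at (\<xi> s) within \<xi> ` {0..t})"
    by (rule has_vector_derivative_within_subset) (use t sm in auto)
  from vector_diff_chain_within[OF 1 2]
  show "((\<lambda>s. work i (\<xi> s) s0 x) has_vector_derivative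
      speed \<xi> s * contract A (h i) (ham_field (\<xi> s)) (flow (\<xi> s) s0 x)) (at s within {0..t})"
    by (simp add: o_def)
qed (use t in auto)

text \<open>The form is taken at the fixed time \<open>t\<close> and the velocity at the running
  time \<open>s\<close>. Expanding the form moves \<open>speed \<xi> t\<close> and its coefficients
  out of the integral, while the factor \<open>speed \<xi> s\<close> of the velocity is absorbed by
  the substitution.\<close>

lemma Delta_reparam:
  assumes \<xi>: "parameter_change \<xi>" and t: "t \<in> {0..1}"
  shows "Delta A (\<lambda>t c y v. speed \<xi> t * H (\<xi> t) c y v) (isotopy A \<omega> (reparam \<xi> (U, H))) t x =
    speed \<xi> t * (\<Sum>i<b. l i (\<xi> t) * (work i (\<xi> t) (\<xi> 0) x - work i (\<xi> 0) (\<xi> 0) x))"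
proof -
  let ?\<phi> = "isotopy A \<omega> (reparam \<xi> (U, H))"
  have \<xi>0: "\<xi> 0 \<in> {0..1}" and \<xi>t: "\<xi> t \<in> {0..1}" using parameter_change_in[OF \<xi>] t by auto
  have eq: "contract A (\<lambda>c y v. speed \<xi> t * H (\<xi> t) c y v) (velocity ?\<phi> s) (?\<phi> s x) =
      (\<Sum>i<b. (speed \<xi> t * l i (\<xi> t)) * (speed \<xi> s * contract A (h i) (ham_field (\<xi> s)) (flow (\<xi> s) (\<xi> 0) x)))"
    if "s \<in> {0..t}" for s
  proof -
    have s: "s \<in> {0..1}" using that t by auto
    define p where "p = flow (\<xi> s) (\<xi> 0) x"
    have p: "?\<phi> s x = p" unfolding p_def by (rule isotopy_reparam(2)[OF \<xi> s])
    define c where "c = (SOME c. c \<in> A \<and> p \<in> cdom c)"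
    obtain c0 where "c0 \<in> A" "p \<in> cdom c0" by (rule chart_at)
    then have c: "c \<in> A" "p \<in> cdom c"
      unfolding c_def using someI[of "\<lambda>c. c \<in> A \<and> p \<in> cdom c" c0] by auto
    note cp = crd_in[OF c]
    have "contract A (\<lambda>c y v. speed \<xi> t * H (\<xi> t) c y v) (velocity ?\<phi> s) (?\<phi> s x) =
        speed \<xi> t * H (\<xi> t) c (crd c p) (velocity ?\<phi> s c (crd c p))"
      by (simp add: contract_def p c_def Let_def)
    also have "velocity ?\<phi> s c (crd c p) = speed \<xi> s *\<^sub>R ham_field (\<xi> s) c (crd c p)"
      by (rule velocity_eq[OF isotopy_reparam(1)[OF \<xi>] \<xi> s c(1) cp])
    also have "H (\<xi> t) c (crd c p) \<dots> = speed \<xi> s * H (\<xi> t) c (crd c p) (ham_field (\<xi> s) c (crd c p))"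
      using H_form[OF \<xi>t] c(1) cp linear_cmul[of "H (\<xi> t) c (crd c p)"] by (simp add: one_form_def)
    also have "H (\<xi> t) c (crd c p) (ham_field (\<xi> s) c (crd c p)) =
        (\<Sum>i<b. l i (\<xi> t) * contract A (h i) (ham_field (\<xi> s)) p)"
      unfolding H_eq[OF \<xi>t c(1) cp]
      by (intro sum.cong refl) (simp add: contract_ham_field[OF h_form c parameter_change_in[OF \<xi> s]])
    finally show ?thesis by (simp add: p_def sum_distrib_left mult_ac)
  qed
  have "((\<lambda>s. \<Sum>i<b. (speed \<xi> t * l i (\<xi> t)) * (speed \<xi> s * contract A (h i) (ham_field (\<xi> s)) (flow (\<xi> s) (\<xi> 0) x)))
      has_integral (\<Sum>i<b. (speed \<xi> t * l i (\<xi> t)) * (work i (\<xi> t) (\<xi> 0) x - work i (\<xi> 0) (\<xi> 0) x))) {0..t}"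
    by (intro has_integral_sum has_integral_mult_right integral_speed_contract[OF \<xi> t _ \<xi>0]) auto
  then have "((\<lambda>s. contract A (\<lambda>c y v. speed \<xi> t * H (\<xi> t) c y v) (velocity ?\<phi> s) (?\<phi> s x))
      has_integral (\<Sum>i<b. (speed \<xi> t * l i (\<xi> t)) * (work i (\<xi> t) (\<xi> 0) x - work i (\<xi> 0) (\<xi> 0) x))) {0..t}"
    by (rule has_integral_eq[rotated]) (simp add: eq)
  then show ?thesis unfolding Delta_def by (simp add: integral_unique sum_distrib_left mult.assoc)
qed

text \<open>\<open>a\<close> is the mean value subtracted in \<open>Delta_normalized\<close>; only
  its independence of the point is recorded.\<close>

lemma gen_inverse_reparam:
  assumes \<xi>: "parameter_change \<xi>"
  obtains V a where
    "gen_inverse A \<omega> n (reparam \<xi> (U, H)) = (V, \<lambda>t c y v. - (speed \<xi> t * H (\<xi> t) c y v))"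
    "\<And>t x. t \<in> {0..1} \<Longrightarrow> V t x = a t - speed \<xi> t * pullback_potential (\<xi> t) (\<xi> 0) x"
proof -
  let ?\<phi> = "isotopy A \<omega> (reparam \<xi> (U, H))" and ?K = "\<lambda>t c y v. speed \<xi> t * H (\<xi> t) c y v"
  define V where "V t x = - (speed \<xi> t * U (\<xi> t) (?\<phi> t x)) - Delta_normalized A \<omega> n ?K ?\<phi> t x" for t x
  have rep: "reparam \<xi> (U, H) = (\<lambda>t x. speed \<xi> t * U (\<xi> t) x, ?K)" by (simp add: reparam_def)
  show thesis
  proof (rule that)
    show "gen_inverse A \<omega> n (reparam \<xi> (U, H)) = (V, \<lambda>t c y v. - (speed \<xi> t * H (\<xi> t) c y v))"
      by (simp add: gen_inverse_def rep Let_def V_def fun_eq_iff)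
    fix t x assume t: "t \<in> {0..1::real}"
    show "V t x = integral\<^sup>L (liouville A \<omega> n) (Delta A ?K ?\<phi> t) / measure (liouville A \<omega> n) UNIV
        - speed \<xi> t * pullback_potential (\<xi> t) (\<xi> 0) x"
      unfolding V_def Delta_normalized_def Delta_reparam[OF \<xi> t] isotopy_reparam(2)[OF \<xi> t]
        pullback_potential_def distrib_left by simp
  qed
qed

section \<open>The two halves of the distance\<close>

text \<open>Stated for both summands of \<open>D1\<close> at once: \<open>\<sigma> = 1\<close> with
  \<open>G\<close> given by \<open>U\<close> for the generators, and \<open>\<sigma> = -1\<close>
  with \<open>G = pullback_potential\<close> and \<open>a\<close> a difference of mean values for
  their inverses. The constant is fixed before the parameter changes.\<close>

lemma D0_reparam_le:
  assumes indep: "\<And>k. lin_comb_of A b h k (\<lambda>c y v. 0) \<Longrightarrow> \<forall>i<b. k i = 0"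
    and G: "bounded_lipschitz G"
  obtains C where "C \<ge> 0" "\<And>\<xi>\<^sub>1 \<xi>\<^sub>2 V\<^sub>1 V\<^sub>2 K\<^sub>1 K\<^sub>2 a \<sigma>. parameter_change \<xi>\<^sub>1 \<Longrightarrow> parameter_change \<xi>\<^sub>2 \<Longrightarrow>
    mono_on {0..1} \<xi>\<^sub>1 \<or> antimono_on {0..1} \<xi>\<^sub>1 \<Longrightarrow> \<bar>\<sigma>\<bar> = 1 \<Longrightarrow>
    (\<And>t x. t \<in> {0..1} \<Longrightarrow> V\<^sub>1 t x - V\<^sub>2 t x = a t + \<sigma> *
      (speed \<xi>\<^sub>1 t * G (\<xi>\<^sub>1 t) (\<xi>\<^sub>1 0) x - speed \<xi>\<^sub>2 t * G (\<xi>\<^sub>2 t) (\<xi>\<^sub>2 0) x)) \<Longrightarrow>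
    (\<And>t c y v. K\<^sub>1 t c y v - K\<^sub>2 t c y v = \<sigma> * (speed \<xi>\<^sub>1 t * H (\<xi>\<^sub>1 t) c y v - speed \<xi>\<^sub>2 t * H (\<xi>\<^sub>2 t) c y v)) \<Longrightarrow>
    D0 A b h (V\<^sub>1, K\<^sub>1) (V\<^sub>2, K\<^sub>2) \<le> C * ham_norm (\<lambda>t. \<xi>\<^sub>1 t - \<xi>\<^sub>2 t)"
proof -
  obtain B C where BC: "B \<ge> 0" "C \<ge> 0"
    "\<And>p q s s0 t t0 N x. s \<in> {0..1} \<Longrightarrow> s0 \<in> {0..1} \<Longrightarrow> t \<in> {0..1} \<Longrightarrow> t0 \<in> {0..1} \<Longrightarrow>
      \<bar>s - t\<bar> \<le> N \<Longrightarrow> \<bar>s0 - t0\<bar> \<le> N \<Longrightarrow>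
      \<bar>p * G s s0 x - q * G t t0 x\<bar> \<le> B * \<bar>p - q\<bar> + C * (\<bar>p\<bar> * N)"
    by (rule bounded_lipschitz_diff[OF G]) blast
  have "\<exists>B C. B \<ge> 0 \<and> C \<ge> 0 \<and> (\<forall>p q N. \<forall>s\<in>{0..1}. \<forall>t\<in>{0..1}. \<bar>s - t\<bar> \<le> N \<longrightarrow>
      \<bar>p * l i s - q * l i t\<bar> \<le> B * \<bar>p - q\<bar> + C * (\<bar>p\<bar> * N))" if i: "i < b" for i
  proof -
    obtain B C where *: "B \<ge> 0" "C \<ge> 0"
      "\<And>p q s s0 t t0 N x. s \<in> {0..1} \<Longrightarrow> s0 \<in> {0..1} \<Longrightarrow> t \<in> {0..1} \<Longrightarrow> t0 \<in> {0..1} \<Longrightarrow>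
        \<bar>s - t\<bar> \<le> N \<Longrightarrow> \<bar>s0 - t0\<bar> \<le> N \<Longrightarrow>
        \<bar>p * l i s - q * l i t\<bar> \<le> B * \<bar>p - q\<bar> + C * (\<bar>p\<bar> * N)"
      by (rule bounded_lipschitz_diff[OF bounded_lipschitz_time[OF l_smooth[OF i]]]) blast
    have "\<bar>p * l i s - q * l i t\<bar> \<le> B * \<bar>p - q\<bar> + C * (\<bar>p\<bar> * N)"
      if "s \<in> {0..1}" "t \<in> {0..1}" "\<bar>s - t\<bar> \<le> N" for p q N s t
      by (rule *(3)[OF that(1,1,2,2,3,3)])
    then show ?thesis using *(1,2) by blast
  qed
  then obtain B' C' where BC': "\<And>i. i < b \<Longrightarrow> B' i \<ge> 0" "\<And>i. i < b \<Longrightarrow> C' i \<ge> 0"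
    "\<And>i p q s t N. i < b \<Longrightarrow> s \<in> {0..1} \<Longrightarrow> t \<in> {0..1} \<Longrightarrow> \<bar>s - t\<bar> \<le> N \<Longrightarrow>
      \<bar>p * l i s - q * l i t\<bar> \<le> B' i * \<bar>p - q\<bar> + C' i * (\<bar>p\<bar> * N)" by metis
  \<comment> \<open>The factor 2 is the loss in \<open>osc_le\<close>; the sums collect the
    coordinates in \<open>hnorm\<close>.\<close>
  define B'' C'' where "B'' = 2 * B + (\<Sum>i<b. B' i)" and "C'' = 2 * C + (\<Sum>i<b. C' i)"
  have nonneg: "B'' \<ge> 0" "C'' \<ge> 0"
    using BC(1,2) BC'(1,2) by (auto simp: B''_def C''_def intro!: add_nonneg_nonneg sum_nonneg)
  show thesis
  proof (rule that[of "B'' + C''"])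
    show "B'' + C'' \<ge> 0" using nonneg by simp
    fix \<xi>\<^sub>1 \<xi>\<^sub>2 V\<^sub>1 V\<^sub>2 K\<^sub>1 K\<^sub>2 a \<sigma>
    assume \<xi>: "parameter_change \<xi>\<^sub>1" "parameter_change \<xi>\<^sub>2"
      and mono: "mono_on {0..1} \<xi>\<^sub>1 \<or> antimono_on {0..1} \<xi>\<^sub>1" and \<sigma>: "\<bar>\<sigma>\<bar> = (1::real)"
      and V: "\<And>t x. t \<in> {0..1} \<Longrightarrow> V\<^sub>1 t x - V\<^sub>2 t x = a t + \<sigma> *
        (speed \<xi>\<^sub>1 t * G (\<xi>\<^sub>1 t) (\<xi>\<^sub>1 0) x - speed \<xi>\<^sub>2 t * G (\<xi>\<^sub>2 t) (\<xi>\<^sub>2 0) x)"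
      and K: "\<And>t c y v. K\<^sub>1 t c y v - K\<^sub>2 t c y v =
        \<sigma> * (speed \<xi>\<^sub>1 t * H (\<xi>\<^sub>1 t) c y v - speed \<xi>\<^sub>2 t * H (\<xi>\<^sub>2 t) c y v)"
    have sm: "smooth_on {0..1} \<xi>\<^sub>1" "smooth_on {0..1} \<xi>\<^sub>2" "\<xi>\<^sub>1 ` {0..1} \<subseteq> {0..1}"
      using \<xi> by (auto simp: parameter_change_def)
    define N where "N = (SUP t\<in>{0..1}. \<bar>\<xi>\<^sub>1 t - \<xi>\<^sub>2 t\<bar>)"
    \<comment> \<open>A supremum of reals dominates the values only for a bounded set; here both
      functions take values in [0,1].\<close>
    have "\<bar>\<xi>\<^sub>1 t - \<xi>\<^sub>2 t\<bar> \<le> 1" if "t \<in> {0..1}" for t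
      using parameter_change_in[OF \<xi>(1) that] parameter_change_in[OF \<xi>(2) that] by auto
    then have "bdd_above ((\<lambda>t. \<bar>\<xi>\<^sub>1 t - \<xi>\<^sub>2 t\<bar>) ` {0..1})" by (auto intro!: bdd_aboveI[of _ 1])
    then have N: "\<bar>\<xi>\<^sub>1 t - \<xi>\<^sub>2 t\<bar> \<le> N" if "t \<in> {0..1}" for t
      unfolding N_def using that by (rule cSUP_upper2[OF _ _ order_refl])
    have N0: "N \<ge> 0" using N[of 0] by (rule order_trans[OF abs_ge_zero]) simp
    have "speed (\<lambda>t. \<xi>\<^sub>1 t - \<xi>\<^sub>2 t) t = speed \<xi>\<^sub>1 t - speed \<xi>\<^sub>2 t" if t: "t \<in> {0..1}" for t
      by (rule vector_derivative_within_closed_interval[OF zero_less_one t])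
         (intro has_vector_derivative_diff has_vector_derivative_speed sm t)
    then have ham: "ham_norm (\<lambda>t. \<xi>\<^sub>1 t - \<xi>\<^sub>2 t) = N + integral {0..1} (\<lambda>t. \<bar>speed \<xi>\<^sub>1 t - speed \<xi>\<^sub>2 t\<bar>)"
      unfolding ham_norm_def N_def by (intro arg_cong2[of _ _ _ _ "(+)"] integral_cong) simp_all
    have "D0 A b h (V\<^sub>1, K\<^sub>1) (V\<^sub>2, K\<^sub>2) =
      integral {0..1} (\<lambda>t. osc (\<lambda>x. V\<^sub>1 t x - V\<^sub>2 t x) + hnorm A b h (\<lambda>c y v. K\<^sub>1 t c y v - K\<^sub>2 t c y v))"
      by (simp add: D0_def)
    also have "\<dots> \<le> (B'' + C'') * (N + integral {0..1} (\<lambda>t. \<bar>speed \<xi>\<^sub>1 t - speed \<xi>\<^sub>2 t\<bar>))"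
    proof (rule integral_le_variation)
      fix t assume t: "t \<in> {0..1::real}"
      let ?p = "speed \<xi>\<^sub>1 t" and ?q = "speed \<xi>\<^sub>2 t"
      note I = parameter_change_in[OF \<xi>(1)] parameter_change_in[OF \<xi>(2)]
      have "\<bar>V\<^sub>1 t x - V\<^sub>2 t x - a t\<bar> \<le> B * \<bar>?p - ?q\<bar> + C * (\<bar>?p\<bar> * N)" for x
      proof -
        have "\<bar>V\<^sub>1 t x - V\<^sub>2 t x - a t\<bar> = \<bar>?p * G (\<xi>\<^sub>1 t) (\<xi>\<^sub>1 0) x - ?q * G (\<xi>\<^sub>2 t) (\<xi>\<^sub>2 0) x\<bar>"
          by (simp add: V[OF t] abs_mult \<sigma>)
        also have "\<dots> \<le> B * \<bar>?p - ?q\<bar> + C * (\<bar>?p\<bar> * N)"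
          using t by (intro BC(3) I N) auto
        finally show ?thesis .
      qed
      then have 1: "osc (\<lambda>x. V\<^sub>1 t x - V\<^sub>2 t x) \<le> 2 * (B * \<bar>?p - ?q\<bar> + C * (\<bar>?p\<bar> * N))"
        by (rule osc_le)
      have "lin_comb_of A b h (\<lambda>i. \<sigma> * (?p * l i (\<xi>\<^sub>1 t) - ?q * l i (\<xi>\<^sub>2 t)))
          (\<lambda>c y v. K\<^sub>1 t c y v - K\<^sub>2 t c y v)"
        unfolding lin_comb_of_def K using H_eq I t
        by (simp add: sum_distrib_left sum_subtractf[symmetric] algebra_simps)
      from hnorm_eq[OF indep this]
      have "hnorm A b h (\<lambda>c y v. K\<^sub>1 t c y v - K\<^sub>2 t c y v) = (\<Sum>i<b. \<bar>?p * l i (\<xi>\<^sub>1 t) - ?q * l i (\<xi>\<^sub>2 t)\<bar>)"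
        by (simp add: abs_mult \<sigma>)
      also have "\<dots> \<le> (\<Sum>i<b. B' i * \<bar>?p - ?q\<bar> + C' i * (\<bar>?p\<bar> * N))"
        using t by (intro sum_mono BC'(3) I N) auto
      also have "\<dots> = (\<Sum>i<b. B' i) * \<bar>?p - ?q\<bar> + (\<Sum>i<b. C' i) * (\<bar>?p\<bar> * N)"
        by (simp add: sum.distrib sum_distrib_right)
      finally show "osc (\<lambda>x. V\<^sub>1 t x - V\<^sub>2 t x) + hnorm A b h (\<lambda>c y v. K\<^sub>1 t c y v - K\<^sub>2 t c y v)
          \<le> B'' * \<bar>?p - ?q\<bar> + C'' * (\<bar>?p\<bar> * N)"
        using 1 unfolding B''_def C''_def distrib_right by simp
    qed (intro continuous_on_speed sm integral_abs_speed_le mono nonneg N0)+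
    finally show "D0 A b h (V\<^sub>1, K\<^sub>1) (V\<^sub>2, K\<^sub>2) \<le> (B'' + C'') * ham_norm (\<lambda>t. \<xi>\<^sub>1 t - \<xi>\<^sub>2 t)"
      unfolding ham .
  qed
qed

lemma D1_reparam_le:
  assumes indep: "\<And>k. lin_comb_of A b h k (\<lambda>c y v. 0) \<Longrightarrow> \<forall>i<b. k i = 0"
  obtains C where "\<And>\<xi>\<^sub>1 \<xi>\<^sub>2. parameter_change \<xi>\<^sub>1 \<Longrightarrow> parameter_change \<xi>\<^sub>2 \<Longrightarrow>
    mono_on {0..1} \<xi>\<^sub>1 \<or> antimono_on {0..1} \<xi>\<^sub>1 \<Longrightarrow>
    D1 A \<omega> n b h (reparam \<xi>\<^sub>1 (U, H)) (reparam \<xi>\<^sub>2 (U, H)) \<le> C * ham_norm (\<lambda>t. \<xi>\<^sub>1 t - \<xi>\<^sub>2 t)"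
proof -
  obtain C where C: "\<And>\<xi>\<^sub>1 \<xi>\<^sub>2 V\<^sub>1 V\<^sub>2 K\<^sub>1 K\<^sub>2 a \<sigma>. parameter_change \<xi>\<^sub>1 \<Longrightarrow> parameter_change \<xi>\<^sub>2 \<Longrightarrow>
    mono_on {0..1} \<xi>\<^sub>1 \<or> antimono_on {0..1} \<xi>\<^sub>1 \<Longrightarrow> \<bar>\<sigma>\<bar> = 1 \<Longrightarrow>
    (\<And>t x. t \<in> {0..1} \<Longrightarrow> V\<^sub>1 t x - V\<^sub>2 t x = a t + \<sigma> *
      (speed \<xi>\<^sub>1 t * U (\<xi>\<^sub>1 t) x - speed \<xi>\<^sub>2 t * U (\<xi>\<^sub>2 t) x)) \<Longrightarrow>
    (\<And>t c y v. K\<^sub>1 t c y v - K\<^sub>2 t c y v = \<sigma> * (speed \<xi>\<^sub>1 t * H (\<xi>\<^sub>1 t) c y v - speed \<xi>\<^sub>2 t * H (\<xi>\<^sub>2 t) c y v)) \<Longrightarrow>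
    D0 A b h (V\<^sub>1, K\<^sub>1) (V\<^sub>2, K\<^sub>2) \<le> C * ham_norm (\<lambda>t. \<xi>\<^sub>1 t - \<xi>\<^sub>2 t)"
    by (rule D0_reparam_le[OF indep bounded_lipschitz_space[OF lip_U]]) blast+
  obtain C' where C': "\<And>\<xi>\<^sub>1 \<xi>\<^sub>2 V\<^sub>1 V\<^sub>2 K\<^sub>1 K\<^sub>2 a \<sigma>. parameter_change \<xi>\<^sub>1 \<Longrightarrow> parameter_change \<xi>\<^sub>2 \<Longrightarrow>
    mono_on {0..1} \<xi>\<^sub>1 \<or> antimono_on {0..1} \<xi>\<^sub>1 \<Longrightarrow> \<bar>\<sigma>\<bar> = 1 \<Longrightarrow>
    (\<And>t x. t \<in> {0..1} \<Longrightarrow> V\<^sub>1 t x - V\<^sub>2 t x = a t + \<sigma> *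
      (speed \<xi>\<^sub>1 t * pullback_potential (\<xi>\<^sub>1 t) (\<xi>\<^sub>1 0) x - speed \<xi>\<^sub>2 t * pullback_potential (\<xi>\<^sub>2 t) (\<xi>\<^sub>2 0) x)) \<Longrightarrow>
    (\<And>t c y v. K\<^sub>1 t c y v - K\<^sub>2 t c y v = \<sigma> * (speed \<xi>\<^sub>1 t * H (\<xi>\<^sub>1 t) c y v - speed \<xi>\<^sub>2 t * H (\<xi>\<^sub>2 t) c y v)) \<Longrightarrow>
    D0 A b h (V\<^sub>1, K\<^sub>1) (V\<^sub>2, K\<^sub>2) \<le> C' * ham_norm (\<lambda>t. \<xi>\<^sub>1 t - \<xi>\<^sub>2 t)"
    by (rule D0_reparam_le[OF indep bounded_lipschitz_pullback_potential]) blast+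
  show thesis
  proof (rule that[of "(C + C') / 2"])
    fix \<xi>\<^sub>1 \<xi>\<^sub>2
    assume \<xi>: "parameter_change \<xi>\<^sub>1" "parameter_change \<xi>\<^sub>2" "mono_on {0..1} \<xi>\<^sub>1 \<or> antimono_on {0..1} \<xi>\<^sub>1"
    have "D0 A b h (reparam \<xi>\<^sub>1 (U, H)) (reparam \<xi>\<^sub>2 (U, H)) \<le> C * ham_norm (\<lambda>t. \<xi>\<^sub>1 t - \<xi>\<^sub>2 t)"
      unfolding reparam_def prod.case by (rule C[OF \<xi>, of 1 _ _ "\<lambda>t. 0"]) simp_all
    moreover have "D0 A b h (gen_inverse A \<omega> n (reparam \<xi>\<^sub>1 (U, H))) (gen_inverse A \<omega> n (reparam \<xi>\<^sub>2 (U, H)))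
        \<le> C' * ham_norm (\<lambda>t. \<xi>\<^sub>1 t - \<xi>\<^sub>2 t)"
    proof -
      obtain V\<^sub>1 a\<^sub>1 where 1:
        "gen_inverse A \<omega> n (reparam \<xi>\<^sub>1 (U, H)) = (V\<^sub>1, \<lambda>t c y v. - (speed \<xi>\<^sub>1 t * H (\<xi>\<^sub>1 t) c y v))"
        "\<And>t x. t \<in> {0..1} \<Longrightarrow> V\<^sub>1 t x = a\<^sub>1 t - speed \<xi>\<^sub>1 t * pullback_potential (\<xi>\<^sub>1 t) (\<xi>\<^sub>1 0) x"
        by (rule gen_inverse_reparam[OF \<xi>(1), of n]) blast
      obtain V\<^sub>2 a\<^sub>2 where 2:
        "gen_inverse A \<omega> n (reparam \<xi>\<^sub>2 (U, H)) = (V\<^sub>2, \<lambda>t c y v. - (speed \<xi>\<^sub>2 t * H (\<xi>\<^sub>2 t) c y v))"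
        "\<And>t x. t \<in> {0..1} \<Longrightarrow> V\<^sub>2 t x = a\<^sub>2 t - speed \<xi>\<^sub>2 t * pullback_potential (\<xi>\<^sub>2 t) (\<xi>\<^sub>2 0) x"
        by (rule gen_inverse_reparam[OF \<xi>(2), of n]) blast
      show ?thesis unfolding 1(1) 2(1)
        by (rule C'[OF \<xi>, of "-1" _ _ "\<lambda>t. a\<^sub>1 t - a\<^sub>2 t"]) (simp_all add: 1(2) 2(2))
    qed
    ultimately show "D1 A \<omega> n b h (reparam \<xi>\<^sub>1 (U, H)) (reparam \<xi>\<^sub>2 (U, H))
        \<le> (C + C') / 2 * ham_norm (\<lambda>t. \<xi>\<^sub>1 t - \<xi>\<^sub>2 t)"
      unfolding D1_def by (simp add: algebra_simps)
  qed
qed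

end

theorem lemma4p3:
  fixes A :: "('m::t2_space, 'd::finite) chart set"
    and \<omega> g :: "('m, 'd) form2"
    and n b :: nat
    and h :: "nat \<Rightarrow> ('m, 'd) form1"
    and U :: "real \<Rightarrow> 'm \<Rightarrow> real"
    and H :: "real \<Rightarrow> ('m, 'd) form1"
  assumes "closed_connected_manifold A"
    and "CARD('d) = 2 * n"
    and "symplectic_form A \<omega>"
    and "riemannian_metric A g"
    and "harmonic_basis A g b h"
    and "(U, H) \<in> generators A \<omega> g n b h"
  shows "\<exists>C::real. \<forall>\<xi>\<^sub>1 \<xi>\<^sub>2 :: real \<Rightarrow> real.
    smooth_on {0..1} \<xi>\<^sub>1 \<longrightarrow> \<xi>\<^sub>1 ` {0..1} \<subseteq> {0..1} \<longrightarrow>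
    smooth_on {0..1} \<xi>\<^sub>2 \<longrightarrow> \<xi>\<^sub>2 ` {0..1} \<subseteq> {0..1} \<longrightarrow>
    mono_on {0..1} \<xi>\<^sub>1 \<or> antimono_on {0..1} \<xi>\<^sub>1 \<longrightarrow>
    D1 A \<omega> n b h (reparam \<xi>\<^sub>1 (U, H)) (reparam \<xi>\<^sub>2 (U, H))
      \<le> C * ham_norm (\<lambda>t. \<xi>\<^sub>1 t - \<xi>\<^sub>2 t)"
proof -
  have basis: "\<And>i. i < b \<Longrightarrow> harmonic A g (h i)"
    "\<And>\<alpha>. harmonic A g \<alpha> \<Longrightarrow> \<exists>l. lin_comb_of A b h l \<alpha>"
    and indep: "\<And>l. lin_comb_of A b h l (\<lambda>c y v. 0) \<Longrightarrow> \<forall>i<b. l i = 0"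
    using assms(5) unfolding harmonic_basis_def by blast+
  have gen: "\<And>c. c \<in> A \<Longrightarrow> smooth_on ({0..1} \<times> crange c) (\<lambda>(t, y). U t (cinv c y))"
    "\<And>t. t \<in> {0..1} \<Longrightarrow> harmonic A g (H t)"
    "\<And>i. i < b \<Longrightarrow> smooth_on {0..1} (\<lambda>t. coords A b h (H t) i)"
    using assms(6) unfolding generators_def by blast+
  \<comment> \<open>The basis spans the harmonic forms, so the choice in \<open>coords\<close> picks
    an actual representation of \<open>H t\<close>.\<close>
  have comb: "lin_comb_of A b h (coords A b h (H t)) (H t)" if "t \<in> {0..1}" for t
    unfolding coords_def using basis(2)[OF gen(2)[OF that]] by (rule someI_ex)
  interpret symplectic_generator A \<omega> U H b h "\<lambda>i t. coords A b h (H t) i"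
  proof
    show "closed_connected_manifold A" "symplectic_form A \<omega>" by fact+
    show "\<And>t. t \<in> {0..1} \<Longrightarrow> one_form A (H t)" using gen(2) by (simp add: harmonic_def)
    show "\<And>i. i < b \<Longrightarrow> one_form A (h i)" using basis(1) by (simp add: harmonic_def)
    show "H t c y v = (\<Sum>i<b. coords A b h (H t) i * h i c y v)"
      if "t \<in> {0..1}" "c \<in> A" "y \<in> crange c" for t c y v
      using comb[OF that(1)] that(2,3) unfolding lin_comb_of_def by blast
  qed (use gen in auto)
  obtain C where C: "\<And>\<xi>\<^sub>1 \<xi>\<^sub>2. parameter_change \<xi>\<^sub>1 \<Longrightarrow> parameter_change \<xi>\<^sub>2 \<Longrightarrow>
    mono_on {0..1} \<xi>\<^sub>1 \<or> antimono_on {0..1} \<xi>\<^sub>1 \<Longrightarrow>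
    D1 A \<omega> n b h (reparam \<xi>\<^sub>1 (U, H)) (reparam \<xi>\<^sub>2 (U, H)) \<le> C * ham_norm (\<lambda>t. \<xi>\<^sub>1 t - \<xi>\<^sub>2 t)"
    by (rule D1_reparam_le[OF indep, of n]) blast+
  then show ?thesis by (intro exI[of _ C]) (simp add: parameter_change_def)
qed

end
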